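(* Let $\Theta=(\Sigma,\mathit{sim},\mathit{ser})$ be a comtrace alphabet with $|\Sigma|=k$ and a total order on $\Sigma$, and let $\tau$ be a comtrace over $\Theta$ whose step sequences contain $n$ action occurrences. Given the projection representation $\Pi^\perp_\tau$ of $\tau$, its Foata canonical form and its lexicographical canonical form can each be computed in time $O(nk^2)$.
   Context: A comtrace alphabet is $\Theta=(\Sigma,\mathit{sim},\mathit{ser})$ with $\Sigma$ finite nonempty, $\mathit{ser}\subseteq\mathit{sim}\subseteq\Sigma\times\Sigma$, $\mathit{sim}$ irreflexive and symmetric; steps are nonempty $A\subseteq\Sigma$ with $(a,b)\in\mathit{sim}$ for distinct $a,b\in A$; comtraces are classes of the reflexive, symmetric, transitive closure $\equiv_\Theta$ of $uABz\sim u(A\cup B)z$ for steps with $A\times B\subseteq\mathit{ser}$. $\mathit{ind}=\mathit{ser}\cap\mathit{ser}^{-1}$, $\mathit{ssm}=\mathit{sim}\setminus(\mathit{ser}\cup\mathit{ser}^{-1})$, $\mathit{wdp}=\mathit{ser}^{-1}\setminus\mathit{ser}$. Projection representation: with fresh symbol $\perp$, for $(a,b)\notin\mathit{ind}$ and a step $A$: $\Pi^\perp_{a,b}(A)=\epsilon$ if $\{a,b\}\cap A=\emptyset$; $a$ if $a\in A,b\notin A$; $b$ if $b\in A,a\notin A$; $a$ if $a=b\in A$; for distinct $a,b\in A$: $ba$ if $(a,b)\in\mathit{wdp}$, $ab$ if $(b,a)\in\mathit{wdp}$, $\perp$ if $(a,b)\in\mathit{ssm}$; concatenated over steps; $\Pi^\perp_\tau(a,b)=\Pi^\perp_{a,b}(w)$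 for any $w\in\tau$. Foata canonical form: the unique $A_1\ldots A_n\in\tau$ such that for each $i$, whenever $Av\equiv_\Theta A_i\ldots A_n$ with $A$ a step, $A\subseteq A_i$. Lexicographical canonical form: the least step sequence of $\tau$ w.r.t. the order where steps are compared by $A\widehat{\le}B$ iff $|A|<|B|$ or ($|A|=|B|$ and ($A=B$ or $\min(A\setminus B)\le\min(B\setminus A)$)), extended lexicographically to sequences. *)

theory Defs
  imports Main
begin

record 'a comtrace_alphabet =
  acts :: "'a set"
  sim :: "'a rel"
  ser :: "'a rel"

definition comtrace_alphabet :: "'a comtrace_alphabet \<Rightarrow> bool" where
  "comtrace_alphabet \<Theta> \<longleftrightarrow>
     finite (acts \<Theta>) \<and> acts \<Theta> \<noteq> {} \<and>
     ser \<Theta> \<subseteq> sim \<Theta> \<and> sim \<Theta> \<subseteq> acts \<Theta> \<times> acts \<Theta> \<and>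
     irrefl (sim \<Theta>) \<and> sym (sim \<Theta>)"

definition ind :: "'a comtrace_alphabet \<Rightarrow> 'a rel" where
  "ind \<Theta> = ser \<Theta> \<inter> (ser \<Theta>)\<inverse>"

definition ssm :: "'a comtrace_alphabet \<Rightarrow> 'a rel" where
  "ssm \<Theta> = sim \<Theta> - (ser \<Theta> \<union> (ser \<Theta>)\<inverse>)"

definition wdp :: "'a comtrace_alphabet \<Rightarrow> 'a rel" where
  "wdp \<Theta> = (ser \<Theta>)\<inverse> - ser \<Theta>"

definition is_step :: "'a comtrace_alphabet \<Rightarrow> 'a set \<Rightarrow> bool" where
  "is_step \<Theta> A \<longleftrightarrow>
     A \<noteq> {} \<and> A \<subseteq> acts \<Theta> \<and> (\<forall>a\<in>A. \<forall>b\<in>A. a \<noteq> b \<longrightarrow> (a, b) \<in> sim \<Theta>)"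

definition step_seqs :: "'a comtrace_alphabet \<Rightarrow> 'a set list set" where
  "step_seqs \<Theta> = {w. \<forall>A\<in>set w. is_step \<Theta> A}"

inductive serialise :: "'a comtrace_alphabet \<Rightarrow> 'a set list \<Rightarrow> 'a set list \<Rightarrow> bool"
  for \<Theta> where
  "\<lbrakk>u \<in> step_seqs \<Theta>; z \<in> step_seqs \<Theta>; is_step \<Theta> A; is_step \<Theta> B; A \<times> B \<subseteq> ser \<Theta>\<rbrakk>
    \<Longrightarrow> serialise \<Theta> (u @ [A, B] @ z) (u @ [A \<union> B] @ z)"

definition ct_equiv :: "'a comtrace_alphabet \<Rightarrow> 'a set list \<Rightarrow> 'a set list \<Rightarrow> bool" where
  "ct_equiv \<Theta> = equivclp (serialise \<Theta>)"

definition comtraces :: "'a comtrace_alphabet \<Rightarrow> 'a set list set set" where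
  "comtraces \<Theta> =
     step_seqs \<Theta> // {(u, v). u \<in> step_seqs \<Theta> \<and> v \<in> step_seqs \<Theta> \<and> ct_equiv \<Theta> u v}"

definition occurrences :: "'a set list \<Rightarrow> nat" where
  "occurrences w = sum_list (map card w)"


text \<open>
  Projections are words over \<^typ>\<open>'a option\<close>, where \<^term>\<open>None\<close> is the fresh symbol
  \<open>\<perp>\<close>.  They are meaningful only for pairs outside \<^term>\<open>ind \<Theta>\<close>.
\<close>

definition proj_step :: "'a comtrace_alphabet \<Rightarrow> 'a \<Rightarrow> 'a \<Rightarrow> 'a set \<Rightarrow> 'a option list" where
  "proj_step \<Theta> a b A =
     (if a \<notin> A \<and> b \<notin> A then []
      else if b \<notin> A then [Some a]
      else if a \<notin> A then [Some b]
      else if a = b then [Some a]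
      else if (a, b) \<in> wdp \<Theta> then [Some b, Some a]
      else if (b, a) \<in> wdp \<Theta> then [Some a, Some b]
      else if (a, b) \<in> ssm \<Theta> then [None]
      else undefined)"

definition proj_seq :: "'a comtrace_alphabet \<Rightarrow> 'a \<Rightarrow> 'a \<Rightarrow> 'a set list \<Rightarrow> 'a option list" where
  "proj_seq \<Theta> a b w = concat (map (proj_step \<Theta> a b) w)"

text \<open>The choice of representative is immaterial outside \<^term>\<open>ind \<Theta>\<close>, see \<open>proj_rep_eq\<close> below.\<close>

definition proj_rep :: "'a comtrace_alphabet \<Rightarrow> 'a set list set \<Rightarrow> 'a \<Rightarrow> 'a \<Rightarrow> 'a option list" where
  "proj_rep \<Theta> \<tau> a b = proj_seq \<Theta> a b (SOME w. w \<in> \<tau>)"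


definition is_foata_form :: "'a comtrace_alphabet \<Rightarrow> 'a set list set \<Rightarrow> 'a set list \<Rightarrow> bool" where
  "is_foata_form \<Theta> \<tau> w \<longleftrightarrow> w \<in> \<tau> \<and>
     (\<forall>i<length w. \<forall>A v. is_step \<Theta> A \<longrightarrow> v \<in> step_seqs \<Theta> \<longrightarrow>
        ct_equiv \<Theta> (A # v) (drop i w) \<longrightarrow> A \<subseteq> w ! i)"

definition foata_form :: "'a comtrace_alphabet \<Rightarrow> 'a set list set \<Rightarrow> 'a set list" where
  "foata_form \<Theta> \<tau> = (THE w. is_foata_form \<Theta> \<tau> w)"

definition step_le :: "'a::linorder set \<Rightarrow> 'a set \<Rightarrow> bool" where
  "step_le A B \<longleftrightarrow> card A < card B \<or>
     (card A = card B \<and> (A = B \<or> Min (A - B) \<le> Min (B - A)))"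

definition seq_le :: "'a::linorder set list \<Rightarrow> 'a set list \<Rightarrow> bool" where
  "seq_le u v \<longleftrightarrow> u = v \<or> (u, v) \<in> lexord {(A, B). step_le A B \<and> A \<noteq> B}"

definition is_lex_form :: "'a::linorder set list set \<Rightarrow> 'a set list \<Rightarrow> bool" where
  "is_lex_form \<tau> w \<longleftrightarrow> w \<in> \<tau> \<and> (\<forall>v\<in>\<tau>. seq_le w v)"

definition lex_form :: "'a::linorder set list set \<Rightarrow> 'a set list" where
  "lex_form \<tau> = (THE w. is_lex_form \<tau> w)"


text \<open>
  The cost model is the uniform-cost random access machine with addition and truncated
  subtraction only: structured programs over scalar registers and integer arrays, both named
  by natural numbers (a program mentions only finitely many), where every assignment, array
  access and test costs one unit.
\<close>

datatype com =
    Skip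
  | Const nat nat           \<comment> \<open>\<open>r\<^sub>x := c\<close>\<close>
  | Add nat nat nat         \<comment> \<open>\<open>r\<^sub>x := r\<^sub>y + r\<^sub>z\<close>\<close>
  | Sub nat nat nat         \<comment> \<open>\<open>r\<^sub>x := r\<^sub>y - r\<^sub>z\<close>\<close>
  | Load nat nat nat        \<comment> \<open>\<open>r\<^sub>x := m\<^sub>y[r\<^sub>z]\<close>\<close>
  | Store nat nat nat       \<comment> \<open>\<open>m\<^sub>x[r\<^sub>y] := r\<^sub>z\<close>\<close>
  | Seq com com
  | IfLess nat nat com com  \<comment> \<open>test \<open>r\<^sub>x < r\<^sub>y\<close>\<close>
  | WhileLess nat nat com   \<comment> \<open>test \<open>r\<^sub>x < r\<^sub>y\<close>\<close>

record ram_state =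
  reg :: "nat \<Rightarrow> nat"
  mem :: "nat \<Rightarrow> nat \<Rightarrow> nat"

text \<open>\<open>exec P s t s'\<close>: started in \<open>s\<close>, \<open>P\<close> halts in \<open>s'\<close> after exactly \<open>t\<close> time units.\<close>

inductive exec :: "com \<Rightarrow> ram_state \<Rightarrow> nat \<Rightarrow> ram_state \<Rightarrow> bool" where
  exec_Skip: "exec Skip s 1 s"
| exec_Const: "exec (Const x c) s 1 (s\<lparr>reg := (reg s)(x := c)\<rparr>)"
| exec_Add: "exec (Add x y z) s 1 (s\<lparr>reg := (reg s)(x := reg s y + reg s z)\<rparr>)"
| exec_Sub: "exec (Sub x y z) s 1 (s\<lparr>reg := (reg s)(x := reg s y - reg s z)\<rparr>)"
| exec_Load: "exec (Load x y z) s 1 (s\<lparr>reg := (reg s)(x := mem s y (reg s z))\<rparr>)"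
| exec_Store: "exec (Store x y z) s 1
    (s\<lparr>mem := (mem s)(x := (mem s x)(reg s y := reg s z))\<rparr>)"
| exec_Seq: "\<lbrakk>exec P s t s'; exec Q s' t' s''\<rbrakk> \<Longrightarrow> exec (Seq P Q) s (t + t') s''"
| exec_IfTrue: "\<lbrakk>reg s x < reg s y; exec P s t s'\<rbrakk> \<Longrightarrow> exec (IfLess x y P Q) s (t + 1) s'"
| exec_IfFalse: "\<lbrakk>\<not> reg s x < reg s y; exec Q s t s'\<rbrakk> \<Longrightarrow> exec (IfLess x y P Q) s (t + 1) s'"
| exec_WhileFalse: "\<not> reg s x < reg s y \<Longrightarrow> exec (WhileLess x y P) s 1 s"
| exec_WhileTrue: "\<lbrakk>reg s x < reg s y; exec P s t s'; exec (WhileLess x y P) s' t' s''\<rbrakk>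
    \<Longrightarrow> exec (WhileLess x y P) s (t + t' + 1) s''"


text \<open>
  With \<open>k\<close> the number of actions, an action is coded by its rank \<open>0, \<dots>, k - 1\<close> in the total
  order, and \<open>\<perp>\<close> by \<open>k\<close>.
\<close>

definition act_code :: "'a::linorder comtrace_alphabet \<Rightarrow> 'a \<Rightarrow> nat" where
  "act_code \<Theta> a = card {b \<in> acts \<Theta>. b < a}"

definition sym_code :: "'a::linorder comtrace_alphabet \<Rightarrow> 'a option \<Rightarrow> nat" where
  "sym_code \<Theta> x = (case x of None \<Rightarrow> card (acts \<Theta>) | Some a \<Rightarrow> act_code \<Theta> a)"

text \<open>The pair of the actions coded by \<open>i\<close> and \<open>j\<close> is at position \<open>i * k + j\<close>.\<close>

definition act_pairs :: "'a::linorder comtrace_alphabet \<Rightarrow> ('a \<times> 'a) list" where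
  "act_pairs \<Theta> =
     List.product (sorted_list_of_set (acts \<Theta>)) (sorted_list_of_set (acts \<Theta>))"

definition proj_words ::
  "'a::linorder comtrace_alphabet \<Rightarrow> ('a \<Rightarrow> 'a \<Rightarrow> 'a option list) \<Rightarrow> nat list list" where
  "proj_words \<Theta> \<Pi> =
     map (\<lambda>(a, b). if (a, b) \<in> ind \<Theta> then [] else map (sym_code \<Theta>) (\<Pi> a b)) (act_pairs \<Theta>)"

definition array_of :: "nat list \<Rightarrow> nat \<Rightarrow> nat" where
  "array_of xs i = (if i < length xs then xs ! i else 0)"

definition offsets :: "'b list list \<Rightarrow> nat list" where
  "offsets xss = map (\<lambda>i. length (concat (take i xss))) [0..<Suc (length xss)]"

text \<open>
  Input: register 0 holds \<open>k\<close>; arrays 0 and 1 hold the incidence matrices of \<open>sim\<close> and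
  \<open>ser\<close>; array 3 holds all projection words one after another and array 2 the positions
  where they start (and, as its last entry, the total length).  Everything else is 0.
\<close>

definition input_state ::
  "'a::linorder comtrace_alphabet \<Rightarrow> ('a \<Rightarrow> 'a \<Rightarrow> 'a option list) \<Rightarrow> ram_state" where
  "input_state \<Theta> \<Pi> =
     \<lparr>reg = (\<lambda>_. 0)(0 := card (acts \<Theta>)),
      mem = (\<lambda>_ _. 0)
        (0 := array_of (map (\<lambda>p. if p \<in> sim \<Theta> then 1 else 0) (act_pairs \<Theta>)),
         1 := array_of (map (\<lambda>p. if p \<in> ser \<Theta> then 1 else 0) (act_pairs \<Theta>)),
         2 := array_of (offsets (proj_words \<Theta> \<Pi>)),
         3 := array_of (concat (proj_words \<Theta> \<Pi>)))\<rparr>"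

text \<open>
  Output: register 1 holds the number of steps; array 5 lists the actions of the steps one
  after another, each step without repetition and in any order, and array 4 the positions
  where the steps start (and, as its last entry, the total number of occurrences).
\<close>

definition outputs :: "'a::linorder comtrace_alphabet \<Rightarrow> ram_state \<Rightarrow> 'a set list \<Rightarrow> bool" where
  "outputs \<Theta> s w \<longleftrightarrow>
     reg s 1 = length w \<and>
     (\<forall>i\<le>length w. mem s 4 i = occurrences (take i w)) \<and>
     (\<forall>i<length w. mem s 5 ` {mem s 4 i..<mem s 4 (Suc i)} = act_code \<Theta> ` (w ! i))"


lemma serialise_proj_seq:
  assumes \<Theta>: "comtrace_alphabet \<Theta>" and "(a, b) \<notin> ind \<Theta>" and "serialise \<Theta> u v"
  shows "proj_seq \<Theta> a b u = proj_seq \<Theta> a b v"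
  using assms(3)
proof cases
  case (1 u z A B)
  have "x \<notin> B" if "x \<in> A" for x
    using 1(7) that \<Theta> unfolding comtrace_alphabet_def irrefl_def by blast
  moreover have "(x, y) \<in> ser \<Theta>" if "x \<in> A" "y \<in> B" for x y
    using 1(7) that by blast
  ultimately have "proj_step \<Theta> a b A @ proj_step \<Theta> a b B = proj_step \<Theta> a b (A \<union> B)"
    using assms(2) unfolding proj_step_def ind_def wdp_def ssm_def
    by (cases "a \<in> A"; cases "b \<in> A"; cases "a \<in> B"; cases "b \<in> B") auto
  then show ?thesis
    unfolding 1 proj_seq_def by simp
qed

lemma serialise_occurrences:
  assumes \<Theta>: "comtrace_alphabet \<Theta>" and "serialise \<Theta> u v"
  shows "occurrences u = occurrences v"
  using assms(2)
proof cases
  case (1 u z A B)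
  have "A \<inter> B = {}"
    using 1(7) \<Theta> unfolding comtrace_alphabet_def irrefl_def by blast
  moreover have "finite A" "finite B"
    using 1(5,6) \<Theta> unfolding comtrace_alphabet_def is_step_def by (auto intro: finite_subset)
  ultimately show ?thesis
    unfolding 1 occurrences_def by (simp add: card_Un_disjoint)
qed

lemma equivclp_invariant:
  assumes "\<And>u v. r u v \<Longrightarrow> f u = f v" and "equivclp r u v"
  shows "f u = f v"
  using assms(2) unfolding equivclp_def
  by (induction rule: rtranclp_induct) (auto elim!: symclpE dest: assms(1))

lemma comtraces_equiv:
  assumes "\<tau> \<in> comtraces \<Theta>" "u \<in> \<tau>" "v \<in> \<tau>"
  shows "ct_equiv \<Theta> u v"
proof -
  obtain w where "ct_equiv \<Theta> w u" "ct_equiv \<Theta> w v"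
    using assms unfolding comtraces_def by (auto elim!: quotientE)
  then show ?thesis
    unfolding ct_equiv_def by (meson equivclp_sym equivclp_trans)
qed

lemma proj_rep_eq:
  assumes "comtrace_alphabet \<Theta>" "\<tau> \<in> comtraces \<Theta>" "(a, b) \<notin> ind \<Theta>" "w \<in> \<tau>"
  shows "proj_rep \<Theta> \<tau> a b = proj_seq \<Theta> a b w"
proof -
  have "(SOME w. w \<in> \<tau>) \<in> \<tau>"
    using assms(4) by (rule someI)
  then have "ct_equiv \<Theta> (SOME w. w \<in> \<tau>) w"
    using comtraces_equiv assms by blast
  then show ?thesis
    unfolding proj_rep_def ct_equiv_def
    by (rule equivclp_invariant[rotated]) (rule serialise_proj_seq[OF assms(1,3)])
qed

lemma comtraces_occurrences:
  assumes "comtrace_alphabet \<Theta>" "\<tau> \<in> comtraces \<Theta>" "u \<in> \<tau>" "v \<in> \<tau>"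
  shows "occurrences u = occurrences v"
  using comtraces_equiv[OF assms(2-4)] unfolding ct_equiv_def
  by (rule equivclp_invariant[rotated]) (rule serialise_occurrences[OF assms(1)])

end

theory Submission
  imports Defs
begin

text \<open>
  Whether a set \<open>A\<close> of actions can be the first step of a comtrace is visible in the projections: for
  \<open>a \<in> A\<close> and every \<open>b\<close> not independent of \<open>a\<close>, the word of \<open>(a, b)\<close> has to start with \<open>a\<close>, or else with
  \<open>\<perp>\<close>, or with \<open>ba\<close> where \<open>a\<close> weakly depends on \<open>b\<close>, and then \<open>b \<in> A\<close>.  So the possible first steps are
  the nonempty closed sets of a directed graph on the actions, restricted to those from which no
  blocked action is reachable.  Comtraces are cancellative, hence both canonical forms are obtained
  greedily: the Foata form by taking the largest closed set, which is the complement of a backward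
  search from the blocked actions, and the lexicographical form by taking the smallest one, which is
  the smallest set reachable from a single action.
\<close>

section \<open>First steps of a comtrace\<close>

text \<open>The time bound is the obstacle. Building the graph and moving the positions cost O(k^2)
  per emitted step, which is affordable because steps are nonempty and so at most n are emitted. One
  full search also costs O(k^2), enough for the Foata form; but comparing the sets reachable from
  all k actions would cost O(k^3) for a step that may have a single action. Each dequeued vertex
  costs one matrix row, so a search cut off beyond L vertices costs O(L k), and k of them O(L k^2).
  Guessing L by doubling charges this to the size of the step that is found, and the sizes sum to n.
  Cancellation comes from the projections: they determine the class, since a closed set read off the
  words can be pulled to the front of any representative, and common prefixes of words cancel.
  Existence of the canonical forms is not proved on its own: the run of the program exhibits a
  greedy sequence in the comtrace, and antisymmetry of the two orders identifies it with the
  \<open>THE\<close> of the definitions.\<close>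

lemma ct_equiv_refl [simp]: "ct_equiv \<Theta> u u"
  by (simp add: ct_equiv_def)

lemma ct_equiv_sym: "ct_equiv \<Theta> u v \<Longrightarrow> ct_equiv \<Theta> v u"
  unfolding ct_equiv_def by (rule equivclp_sym)

lemma ct_equiv_trans [trans]: "ct_equiv \<Theta> u v \<Longrightarrow> ct_equiv \<Theta> v w \<Longrightarrow> ct_equiv \<Theta> u w"
  unfolding ct_equiv_def by (rule equivclp_trans)

lemma serialise_append:
  assumes "serialise \<Theta> u v" "x \<in> step_seqs \<Theta>" "y \<in> step_seqs \<Theta>"
  shows "serialise \<Theta> (x @ u @ y) (x @ v @ y)"
  using assms(1)
proof cases
  case (1 u z A B)
  have "serialise \<Theta> ((x @ u) @ [A, B] @ (z @ y)) ((x @ u) @ [A \<union> B] @ (z @ y))"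
    using 1 assms by (intro serialise.intros) (auto simp: step_seqs_def)
  then show ?thesis using 1 by simp
qed

lemma ct_equiv_append:
  assumes "ct_equiv \<Theta> u v" "x \<in> step_seqs \<Theta>" "y \<in> step_seqs \<Theta>"
  shows "ct_equiv \<Theta> (x @ u @ y) (x @ v @ y)"
  using assms(1) unfolding ct_equiv_def equivclp_def
proof (induction rule: rtranclp_induct)
  case (step v w)
  then have "symclp (serialise \<Theta>) (x @ v @ y) (x @ w @ y)"
    using serialise_append[OF _ assms(2,3)] by (auto simp: symclp_def)
  then show ?case using step by (meson rtranclp.rtrancl_into_rtrancl)
qed simp

lemma ct_equiv_proj_seq:
  assumes "comtrace_alphabet \<Theta>" "ct_equiv \<Theta> u v" "(a, b) \<notin> ind \<Theta>"
  shows "proj_seq \<Theta> a b u = proj_seq \<Theta> a b v"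
  using assms(2) unfolding ct_equiv_def
  by (rule equivclp_invariant[rotated]) (rule serialise_proj_seq[OF assms(1,3)])

lemma ct_equiv_occurrences:
  assumes "comtrace_alphabet \<Theta>" "ct_equiv \<Theta> u v"
  shows "occurrences u = occurrences v"
  using assms(2) unfolding ct_equiv_def
  by (rule equivclp_invariant[rotated]) (rule serialise_occurrences[OF assms(1)])

lemma proj_seq_Nil [simp]: "proj_seq \<Theta> a b [] = []"
  by (simp add: proj_seq_def)

lemma proj_seq_Cons [simp]: "proj_seq \<Theta> a b (A # w) = proj_step \<Theta> a b A @ proj_seq \<Theta> a b w"
  by (simp add: proj_seq_def)

lemma is_step_finite: "comtrace_alphabet \<Theta> \<Longrightarrow> is_step \<Theta> A \<Longrightarrow> finite A"
  unfolding comtrace_alphabet_def is_step_def by (auto intro: finite_subset)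

lemma occurrences_Cons [simp]: "occurrences (A # w) = card A + occurrences w"
  by (simp add: occurrences_def)

lemma occurrences_append [simp]: "occurrences (u @ v) = occurrences u + occurrences v"
  by (simp add: occurrences_def)

lemma occurrences_Nil [simp]: "occurrences [] = 0"
  by (simp add: occurrences_def)

lemma occurrences_eq_0:
  assumes "comtrace_alphabet \<Theta>" "w \<in> step_seqs \<Theta>"
  shows "occurrences w = 0 \<longleftrightarrow> w = []"
proof (cases w)
  case (Cons A v)
  then have "is_step \<Theta> A" using assms by (auto simp: step_seqs_def)
  then have "card A > 0"
    using is_step_finite[OF assms(1)] by (auto simp: card_gt_0_iff is_step_def)
  then show ?thesis using Cons by simp
qed simp

text \<open>The word of \<open>(a, a)\<close> has one letter per occurrence of \<open>a\<close>.
  This is used twice: empty projections force an empty sequence, and the program obtains n from the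
  lengths of the diagonal words.\<close>

lemma sum_length_proj_seq:
  assumes "comtrace_alphabet \<Theta>" "w \<in> step_seqs \<Theta>"
  shows "(\<Sum>a\<in>acts \<Theta>. length (proj_seq \<Theta> a a w)) = occurrences w"
  using assms(2)
proof (induction w)
  case (Cons A w)
  have fin: "finite (acts \<Theta>)" and A: "A \<subseteq> acts \<Theta>"
    using assms(1) Cons.prems by (auto simp: comtrace_alphabet_def step_seqs_def is_step_def)
  have "(\<Sum>a\<in>acts \<Theta>. length (proj_step \<Theta> a a A)) = (\<Sum>a\<in>acts \<Theta>. if a \<in> A then 1 else 0)"
    by (rule sum.cong) (auto simp: proj_step_def)
  also have "\<dots> = card A"
    using fin A by (simp add: sum.If_cases Int_absorb1)
  finally show ?case using Cons by (simp add: sum.distrib step_seqs_def)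
qed simp

section \<open>Closed sets of actions and admissible first steps\<close>

definition free :: "'a comtrace_alphabet \<Rightarrow> 'a set list \<Rightarrow> 'a \<Rightarrow> 'a \<Rightarrow> bool" where
  "free \<Theta> w a b \<longleftrightarrow> (\<exists>r. proj_seq \<Theta> a b w = Some a # r)"

text \<open>If \<open>a\<close> weakly depends on \<open>b\<close>, the prefix \<open>ba\<close>
  arises both from the step \<open>{a, b}\<close> and from \<open>b\<close> followed by
  \<open>a\<close>; these are equivalent because \<open>(b, a)\<close> is in \<open>ser\<close>.
  Hence \<open>a\<close> can still be first, but only together with \<open>b\<close>.\<close>

definition needs :: "'a comtrace_alphabet \<Rightarrow> 'a set list \<Rightarrow> 'a \<Rightarrow> 'a \<Rightarrow> bool" where
  "needs \<Theta> w a b \<longleftrightarrow> (\<exists>r. proj_seq \<Theta> a b w = None # r) \<or>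
     (a, b) \<in> wdp \<Theta> \<and> (\<exists>r. proj_seq \<Theta> a b w = Some b # Some a # r)"

definition closed :: "'a comtrace_alphabet \<Rightarrow> 'a set list \<Rightarrow> 'a set \<Rightarrow> bool" where
  "closed \<Theta> w A \<longleftrightarrow> A \<subseteq> acts \<Theta> \<and>
     (\<forall>a\<in>A. \<forall>b\<in>acts \<Theta>. (a, b) \<notin> ind \<Theta> \<longrightarrow> free \<Theta> w a b \<or> needs \<Theta> w a b \<and> b \<in> A)"

definition adm :: "'a comtrace_alphabet \<Rightarrow> 'a set list \<Rightarrow> 'a set \<Rightarrow> bool" where
  "adm \<Theta> w A \<longleftrightarrow> is_step \<Theta> A \<and> (\<exists>v\<in>step_seqs \<Theta>. ct_equiv \<Theta> (A # v) w)"

text \<open>Steps are nonempty, but the parts into which a step is cut below may be empty; an empty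
  part becomes the empty sequence.\<close>

definition opt_step :: "'a set \<Rightarrow> 'a set list" where
  "opt_step A = (if A = {} then [] else [A])"

text \<open>Distinct actions of a step are related by \<open>sim\<close>, and outside
  \<open>ind\<close> only these three alternatives remain; the \<open>undefined\<close> branch of
  \<open>proj_step\<close> is never reached.\<close>

lemma proj_step_both:
  assumes "comtrace_alphabet \<Theta>" "is_step \<Theta> A" "a \<in> A" "b \<in> A" "a \<noteq> b" "(a, b) \<notin> ind \<Theta>"
  obtains "(a, b) \<in> wdp \<Theta>" "(b, a) \<in> ser \<Theta>" "(a, b) \<notin> ser \<Theta>" "proj_step \<Theta> a b A = [Some b, Some a]"
  | "(b, a) \<in> wdp \<Theta>" "(a, b) \<in> ser \<Theta>" "(b, a) \<notin> ser \<Theta>" "proj_step \<Theta> a b A = [Some a, Some b]"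
  | "(a, b) \<in> ssm \<Theta>" "proj_step \<Theta> a b A = [None]"
proof -
  have "(a, b) \<in> sim \<Theta>" using assms by (auto simp: is_step_def)
  then consider "(a, b) \<in> wdp \<Theta>" | "(b, a) \<in> wdp \<Theta>" "(a, b) \<notin> wdp \<Theta>"
    | "(a, b) \<in> ssm \<Theta>" "(a, b) \<notin> wdp \<Theta>" "(b, a) \<notin> wdp \<Theta>"
    using assms(6) by (auto simp: wdp_def ssm_def ind_def)
  then show thesis
    using assms(3-5) that by cases (auto simp: proj_step_def wdp_def)
qed

lemma set_proj_step:
  assumes "comtrace_alphabet \<Theta>" "is_step \<Theta> A" "(a, b) \<notin> ind \<Theta>"
  shows "set (proj_step \<Theta> a b A) \<subseteq> {None, Some a, Some b}"
  by (cases "a \<in> A \<and> b \<in> A \<and> a \<noteq> b")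
    (auto elim!: proj_step_both[OF assms(1,2) _ _ _ assms(3)] simp: proj_step_def)

lemma set_proj_seq:
  assumes "comtrace_alphabet \<Theta>" "w \<in> step_seqs \<Theta>" "(a, b) \<notin> ind \<Theta>"
  shows "set (proj_seq \<Theta> a b w) \<subseteq> {None, Some a, Some b}"
  using assms(2)
proof (induction w)
  case (Cons A w)
  then show ?case using set_proj_step[OF assms(1) _ assms(3)] by (auto simp: step_seqs_def)
qed simp

text \<open>The symbol \<open>None\<close> is produced only by a step that contains both actions,
  and distinct actions of a step are related by \<open>sim\<close>.\<close>

lemma bot_imp_sim:
  assumes \<Theta>: "comtrace_alphabet \<Theta>" and "w \<in> step_seqs \<Theta>" "(a, b) \<notin> ind \<Theta>"
    "None \<in> set (proj_seq \<Theta> a b w)"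
  shows "(a, b) \<in> sim \<Theta>"
  using assms(2,4)
proof (induction w)
  case (Cons A w)
  have A: "is_step \<Theta> A" using Cons.prems by (simp add: step_seqs_def)
  show ?case
  proof (cases "a \<in> A \<and> b \<in> A \<and> a \<noteq> b")
    case True
    then show ?thesis using A by (auto simp: is_step_def)
  next
    case False
    then have "None \<notin> set (proj_step \<Theta> a b A)" by (auto simp: proj_step_def)
    then show ?thesis using Cons by (auto simp: step_seqs_def)
  qed
qed simp

lemma wdp_imp_sim:
  "comtrace_alphabet \<Theta> \<Longrightarrow> (a, b) \<in> wdp \<Theta> \<Longrightarrow> (a, b) \<in> sim \<Theta> \<and> (b, a) \<in> sim \<Theta>"
  by (auto simp: comtrace_alphabet_def wdp_def dest: symD)

lemma needs_imp_sim:
  assumes "comtrace_alphabet \<Theta>" "w \<in> step_seqs \<Theta>" "(a, b) \<notin> ind \<Theta>" "needs \<Theta> w a b"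
  shows "(a, b) \<in> sim \<Theta>"
  using assms(4) bot_imp_sim[OF assms(1-3)] wdp_imp_sim[OF assms(1)]
  unfolding needs_def by auto


lemma is_step_subset: "is_step \<Theta> A \<Longrightarrow> B \<subseteq> A \<Longrightarrow> B \<noteq> {} \<Longrightarrow> is_step \<Theta> B"
  by (auto simp: is_step_def)

text \<open>Suppose two members were not related by \<open>sim\<close>. Then no step contains both,
  so the words of \<open>(a, b)\<close> and \<open>(b, a)\<close> coincide; \<open>needs\<close> is
  excluded because it entails \<open>sim\<close>, so both members would be free and the common word
  would start with \<open>a\<close> and with \<open>b\<close>.\<close>

lemma closed_is_step:
  assumes \<Theta>: "comtrace_alphabet \<Theta>" and w: "w \<in> step_seqs \<Theta>" and A: "closed \<Theta> w A" "A \<noteq> {}"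
  shows "is_step \<Theta> A"
  unfolding is_step_def
proof (intro conjI ballI impI)
  fix a b assume ab: "a \<in> A" "b \<in> A" "a \<noteq> b"
  have ba: "b \<in> acts \<Theta>" "a \<in> acts \<Theta>" using A ab by (auto simp: closed_def)
  have symm: "(a, b) \<in> sim \<Theta> \<longleftrightarrow> (b, a) \<in> sim \<Theta>"
    using \<Theta> by (auto simp: comtrace_alphabet_def dest: symD)
  show "(a, b) \<in> sim \<Theta>"
  proof (cases "(a, b) \<in> ind \<Theta>")
    case True
    then show ?thesis using \<Theta> by (auto simp: ind_def comtrace_alphabet_def)
  next
    case False
    then have F: "(b, a) \<notin> ind \<Theta>" by (auto simp: ind_def)
    have "proj_seq \<Theta> a b w = proj_seq \<Theta> b a w \<or> (a, b) \<in> sim \<Theta>"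
    proof (cases "(a, b) \<in> sim \<Theta>")
      case False
      then have "proj_step \<Theta> a b B = proj_step \<Theta> b a B" if "B \<in> set w" for B
        using that w ab by (auto simp: step_seqs_def is_step_def proj_step_def)
      then show ?thesis by (auto simp: proj_seq_def intro!: arg_cong[of _ _ concat])
    qed simp
    moreover have "\<not> (free \<Theta> w a b \<and> free \<Theta> w b a)" if "proj_seq \<Theta> a b w = proj_seq \<Theta> b a w"
      using ab that by (auto simp: free_def)
    moreover have "free \<Theta> w a b \<or> (a, b) \<in> sim \<Theta>" "free \<Theta> w b a \<or> (a, b) \<in> sim \<Theta>"
      using A(1) ab ba False F needs_imp_sim[OF \<Theta> w False] needs_imp_sim[OF \<Theta> w F] symm
      by (auto simp: closed_def)
    ultimately show ?thesis by blast
  qed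
qed (use A in \<open>auto simp: closed_def\<close>)

lemma ct_equiv_opt_steps:
  assumes "x \<in> step_seqs \<Theta>" "z \<in> step_seqs \<Theta>"
    and "A = {} \<or> is_step \<Theta> A" "B = {} \<or> is_step \<Theta> B" "A \<times> B \<subseteq> ser \<Theta>"
  shows "ct_equiv \<Theta> (x @ opt_step A @ opt_step B @ z) (x @ opt_step (A \<union> B) @ z)"
proof (cases "A = {} \<or> B = {}")
  case False
  then have "serialise \<Theta> (x @ [A, B] @ z) (x @ [A \<union> B] @ z)"
    using assms by (intro serialise.intros) auto
  then show ?thesis using False
    by (auto simp: opt_step_def ct_equiv_def)
qed (auto simp: opt_step_def)

lemma opt_step_seqs: "A = {} \<or> is_step \<Theta> A \<Longrightarrow> opt_step A \<in> step_seqs \<Theta>"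
  by (auto simp: opt_step_def step_seqs_def)

lemma step_seqs_append [simp]: "u @ v \<in> step_seqs \<Theta> \<longleftrightarrow> u \<in> step_seqs \<Theta> \<and> v \<in> step_seqs \<Theta>"
  by (auto simp: step_seqs_def)

lemma step_seqs_Cons [simp]: "A # v \<in> step_seqs \<Theta> \<longleftrightarrow> is_step \<Theta> A \<and> v \<in> step_seqs \<Theta>"
  by (auto simp: step_seqs_def)

lemma step_seqs_Nil [simp]: "[] \<in> step_seqs \<Theta>"
  by (auto simp: step_seqs_def)

text \<open>All four facts are read off the first letters contributed by \<open>B\<close>. They are
  the side conditions for cutting \<open>B\<close> and \<open>A\<close> along
  \<open>A \<inter> B\<close>, for commuting the two differences, and for applying the induction
  hypothesis to \<open>A - B\<close>.\<close>

lemma closed_ConsD: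
  assumes \<Theta>: "comtrace_alphabet \<Theta>" and B: "is_step \<Theta> B" and A: "closed \<Theta> (B # u) A"
  shows "(A \<inter> B) \<times> (B - A) \<subseteq> ser \<Theta>"
    and "a \<in> A - B \<Longrightarrow> b \<in> B - A \<Longrightarrow> (a, b) \<in> ind \<Theta>"
    and "(A \<inter> B) \<times> (A - B) \<subseteq> ser \<Theta>"
    and "closed \<Theta> u (A - B)"
proof -
  have acts: "A \<subseteq> acts \<Theta>" "B \<subseteq> acts \<Theta>" using A B by (auto simp: closed_def is_step_def)
  have dicho: "free \<Theta> (B # u) a b \<or> needs \<Theta> (B # u) a b \<and> b \<in> A"
    if "a \<in> A" "b \<in> acts \<Theta>" "(a, b) \<notin> ind \<Theta>" for a b
    using A that by (auto simp: closed_def)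
  show "(A \<inter> B) \<times> (B - A) \<subseteq> ser \<Theta>"
  proof clarify
    fix c d assume cd: "c \<in> A" "c \<in> B" "d \<in> B" "d \<notin> A"
    show "(c, d) \<in> ser \<Theta>"
    proof (cases "(c, d) \<in> ind \<Theta>")
      case False
      then have "free \<Theta> (B # u) c d" using dicho cd acts by blast
      moreover have "c \<noteq> d" using cd by blast
      ultimately show ?thesis
        by (elim proj_step_both[OF \<Theta> B cd(2,3) _ False]) (auto simp: free_def)
    qed (simp add: ind_def)
  qed
  \<comment> \<open>Here \<open>B\<close> contributes exactly the letter \<open>b\<close>, so
    \<open>a\<close> is not free. It must therefore need \<open>b\<close>, which puts
    \<open>b\<close> into \<open>A\<close> and makes \<open>a\<close> the first letter of the
    remaining word.\<close>
  have outside: "b \<in> A \<and> (a, b) \<in> wdp \<Theta> \<and> (\<exists>r. proj_seq \<Theta> a b u = Some a # r)"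
    if "a \<in> A" "a \<notin> B" "b \<in> B" "(a, b) \<notin> ind \<Theta>" for a b
  proof -
    have "proj_step \<Theta> a b B = [Some b]" "a \<noteq> b" using that by (auto simp: proj_step_def)
    then show ?thesis using dicho[of a b] that acts by (auto simp: free_def needs_def)
  qed
  show "(a, b) \<in> ind \<Theta>" if "a \<in> A - B" "b \<in> B - A" for a b
    using outside[of a b] that by blast
  show "(A \<inter> B) \<times> (A - B) \<subseteq> ser \<Theta>"
    using outside by (auto simp: ind_def wdp_def)
  show "closed \<Theta> u (A - B)"
    unfolding closed_def
  proof (intro conjI ballI impI)
    fix a b assume ab: "a \<in> A - B" "b \<in> acts \<Theta>" "(a, b) \<notin> ind \<Theta>"
    show "free \<Theta> u a b \<or> needs \<Theta> u a b \<and> b \<in> A - B"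
    proof (cases "b \<in> B")
      case True
      then show ?thesis using outside ab by (auto simp: free_def)
    next
      case False
      then have "proj_step \<Theta> a b B = []" using ab by (auto simp: proj_step_def)
      then show ?thesis using dicho[of a b] ab False by (auto simp: free_def needs_def)
    qed
  qed (use acts in auto)
qed

text \<open>
  Induction on \<open>w = B # u\<close>: the parts \<open>A \<inter> B\<close>, \<open>B - A\<close> and \<open>A - B\<close> can be serialised in such a way
  that \<open>B - A\<close> is moved behind \<open>A - B\<close>, which is pulled out of \<open>u\<close> by the induction hypothesis.
\<close>

lemma closed_imp_ct_equiv:
  assumes \<Theta>: "comtrace_alphabet \<Theta>" and "w \<in> step_seqs \<Theta>" "closed \<Theta> w A"
  shows "\<exists>v\<in>step_seqs \<Theta>. ct_equiv \<Theta> (opt_step A @ v) w"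
  using assms(2,3)
proof (induction w arbitrary: A)
  case Nil
  \<comment> \<open>Irreflexivity of \<open>sim\<close> keeps the diagonal outside
    \<open>ind\<close>; the empty diagonal words then exclude every possible member of
    \<open>A\<close>.\<close>
  have "(a, a) \<notin> ind \<Theta>" for a
    using \<Theta> by (auto simp: ind_def comtrace_alphabet_def irrefl_def)
  then have "A = {}" using Nil by (fastforce simp: closed_def free_def needs_def)
  then show ?case by (auto simp: opt_step_def intro!: bexI[of _ "[]"])
next
  case (Cons B u)
  define C D E where "C = A \<inter> B" and "D = B - A" and "E = A - B"
  have B: "is_step \<Theta> B" and u: "u \<in> step_seqs \<Theta>" using Cons.prems by auto
  note cl = closed_ConsD[OF \<Theta> B Cons.prems(2), folded C_def D_def E_def]
  have A: "A = {} \<or> is_step \<Theta> A" using closed_is_step[OF \<Theta> Cons.prems] by blast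
  have steps: "C = {} \<or> is_step \<Theta> C" "D = {} \<or> is_step \<Theta> D" "E = {} \<or> is_step \<Theta> E"
    using A is_step_subset[OF B, of C] is_step_subset[OF B, of D] is_step_subset[of \<Theta> A E]
    by (auto simp: C_def D_def E_def)
  note seqs = steps[THEN opt_step_seqs]
  obtain v where v: "v \<in> step_seqs \<Theta>" "ct_equiv \<Theta> (opt_step E @ v) u"
    using Cons.IH[OF u cl(4)] by blast
  have DE: "D \<times> E \<subseteq> ser \<Theta>" "E \<times> D \<subseteq> ser \<Theta>" using cl(2) by (auto simp: ind_def)
  have "A = C \<union> E" by (auto simp: C_def E_def)
  then have "ct_equiv \<Theta> (opt_step A @ opt_step D @ v) (opt_step C @ opt_step E @ opt_step D @ v)"
    using ct_equiv_opt_steps[of "[]" \<Theta> "opt_step D @ v" C E] cl(3) steps seqs v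
    by (simp add: ct_equiv_sym)
  also have "ct_equiv \<Theta> \<dots> (opt_step C @ opt_step (E \<union> D) @ v)"
    using ct_equiv_opt_steps[of "opt_step C" \<Theta> v E D] steps seqs v DE by simp
  also have "E \<union> D = D \<union> E" by blast
  also have "ct_equiv \<Theta> (opt_step C @ opt_step (D \<union> E) @ v) (opt_step C @ opt_step D @ opt_step E @ v)"
    using ct_equiv_opt_steps[of "opt_step C" \<Theta> v D E] steps seqs v DE by (simp add: ct_equiv_sym)
  also have "ct_equiv \<Theta> \<dots> (opt_step C @ opt_step D @ u)"
    using ct_equiv_append[OF v(2), of "opt_step C @ opt_step D" "[]"] seqs by simp
  also have "ct_equiv \<Theta> \<dots> (opt_step (C \<union> D) @ u)"
    using ct_equiv_opt_steps[of "[]" \<Theta> u C D] cl(1) steps u by simp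
  also have "C \<union> D = B" by (auto simp: C_def D_def)
  also have "opt_step B @ u = B # u" using B by (simp add: opt_step_def is_step_def)
  finally have "ct_equiv \<Theta> (opt_step A @ opt_step D @ v) (B # u)" .
  then show ?case using seqs v by (intro bexI[of _ "opt_step D @ v"]) auto
qed

lemma adm_hd: "A # v \<in> step_seqs \<Theta> \<Longrightarrow> adm \<Theta> (A # v) A"
  unfolding adm_def using ct_equiv_refl by (metis step_seqs_Cons)

lemma adm_imp_closed:
  assumes \<Theta>: "comtrace_alphabet \<Theta>" and "adm \<Theta> w A"
  shows "closed \<Theta> w A"
proof -
  obtain v where v: "ct_equiv \<Theta> (A # v) w" and A: "is_step \<Theta> A"
    using assms(2) by (auto simp: adm_def)
  have "free \<Theta> w a b \<or> needs \<Theta> w a b \<and> b \<in> A" if "a \<in> A" "(a, b) \<notin> ind \<Theta>" for a b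
  proof -
    have eq: "proj_seq \<Theta> a b w = proj_step \<Theta> a b A @ proj_seq \<Theta> a b v"
      using ct_equiv_proj_seq[OF \<Theta> v that(2)] by simp
    show ?thesis
    proof (cases "b \<in> A \<and> a \<noteq> b")
      case True
      then have b: "b \<in> A" "a \<noteq> b" by auto
      show ?thesis
        by (rule proj_step_both[OF \<Theta> A that(1) b that(2)]) (use b in \<open>auto simp: free_def needs_def eq\<close>)
    next
      case False
      then have "proj_step \<Theta> a b A = [Some a]" using that by (auto simp: proj_step_def)
      then show ?thesis by (simp add: free_def eq)
    qed
  qed
  then show ?thesis using A by (auto simp: closed_def is_step_def)
qed

text \<open>The left side quantifies over equivalent sequences, the right side only looks at the
  projections. This is what makes the first steps computable from the input.\<close>

lemma adm_iff_closed:
  assumes "comtrace_alphabet \<Theta>" "w \<in> step_seqs \<Theta>"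
  shows "adm \<Theta> w A \<longleftrightarrow> closed \<Theta> w A \<and> A \<noteq> {}"
proof
  assume "closed \<Theta> w A \<and> A \<noteq> {}"
  then show "adm \<Theta> w A"
    using closed_imp_ct_equiv[OF assms, of A] closed_is_step[OF assms, of A]
    by (auto simp: adm_def opt_step_def)
qed (use adm_imp_closed[OF assms(1)] in \<open>auto simp: adm_def is_step_def\<close>)

section \<open>Projections determine the comtrace\<close>

lemma closed_cong:
  assumes "\<And>a b. (a, b) \<notin> ind \<Theta> \<Longrightarrow> proj_seq \<Theta> a b u = proj_seq \<Theta> a b v"
  shows "closed \<Theta> u A \<longleftrightarrow> closed \<Theta> v A"
  using assms unfolding closed_def free_def needs_def by metis

text \<open>The head \<open>A\<close> of \<open>u\<close> is closed for \<open>u\<close>, hence for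
  \<open>v\<close>, whose projections are the same. So \<open>v\<close> can be rewritten to begin
  with \<open>A\<close>; stripping the common prefix from each word leaves the same situation for
  the tails.\<close>

lemma proj_seq_eq_imp_ct_equiv:
  assumes \<Theta>: "comtrace_alphabet \<Theta>" and "u \<in> step_seqs \<Theta>" "v \<in> step_seqs \<Theta>"
    and "\<And>a b. (a, b) \<notin> ind \<Theta> \<Longrightarrow> proj_seq \<Theta> a b u = proj_seq \<Theta> a b v"
  shows "ct_equiv \<Theta> u v"
  using assms(2-4)
proof (induction u arbitrary: v)
  case Nil
  have "(a, a) \<notin> ind \<Theta>" for a
    using \<Theta> by (auto simp: ind_def comtrace_alphabet_def irrefl_def)
  then have "proj_seq \<Theta> a a v = []" for a
    using Nil.prems(3)[of a a] by simp
  then have "occurrences v = 0"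
    using sum_length_proj_seq[OF \<Theta> Nil.prems(2)] by simp
  then show ?case using occurrences_eq_0[OF \<Theta> Nil.prems(2)] by simp
next
  case (Cons A u)
  have "adm \<Theta> (A # u) A" using Cons.prems(1) by (rule adm_hd)
  then have "adm \<Theta> v A"
    using adm_iff_closed[OF \<Theta>] closed_cong[OF Cons.prems(3), of A] Cons.prems(1,2) by blast
  then obtain v' where v': "v' \<in> step_seqs \<Theta>" "ct_equiv \<Theta> (A # v') v" by (auto simp: adm_def)
  have "proj_seq \<Theta> a b u = proj_seq \<Theta> a b v'" if "(a, b) \<notin> ind \<Theta>" for a b
    using ct_equiv_proj_seq[OF \<Theta> v'(2) that] Cons.prems(3)[OF that]
    by (metis proj_seq_Cons same_append_eq)
  then have "ct_equiv \<Theta> u v'" using Cons.IH Cons.prems v' by simp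
  then have "ct_equiv \<Theta> (A # u) (A # v')"
    using ct_equiv_append[of \<Theta> u v' "[A]" "[]"] Cons.prems by simp
  then show ?case using v' ct_equiv_trans by blast
qed

lemma ct_equiv_cancel:
  assumes "comtrace_alphabet \<Theta>" "u \<in> step_seqs \<Theta>" "v \<in> step_seqs \<Theta>"
    "ct_equiv \<Theta> (A # u) (A # v)"
  shows "ct_equiv \<Theta> u v"
  using ct_equiv_proj_seq[OF assms(1,4)] by (intro proj_seq_eq_imp_ct_equiv assms) simp

section \<open>Greedy step sequences and the two canonical forms\<close>

definition best_step ::
  "('a set \<Rightarrow> 'a set \<Rightarrow> bool) \<Rightarrow> 'a comtrace_alphabet \<Rightarrow> 'a set list \<Rightarrow> 'a set \<Rightarrow> bool" where
  "best_step R \<Theta> w A \<longleftrightarrow> adm \<Theta> w A \<and> (\<forall>B. adm \<Theta> w B \<longrightarrow> R A B)"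

definition greedy ::
  "('a set \<Rightarrow> 'a set \<Rightarrow> bool) \<Rightarrow> 'a comtrace_alphabet \<Rightarrow> 'a set list \<Rightarrow> bool" where
  "greedy R \<Theta> w \<longleftrightarrow> (\<forall>i<length w. best_step R \<Theta> (drop i w) (w ! i))"

lemma adm_cong: "ct_equiv \<Theta> u v \<Longrightarrow> adm \<Theta> u A \<longleftrightarrow> adm \<Theta> v A"
  unfolding adm_def by (meson ct_equiv_sym ct_equiv_trans)

lemma best_step_cong: "ct_equiv \<Theta> u v \<Longrightarrow> best_step R \<Theta> u A \<longleftrightarrow> best_step R \<Theta> v A"
  unfolding best_step_def by (simp add: adm_cong)

lemma greedy_Cons: "greedy R \<Theta> (A # w) \<longleftrightarrow> best_step R \<Theta> (A # w) A \<and> greedy R \<Theta> w"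
  unfolding greedy_def by (auto simp: All_less_Suc2)

lemma comtraces_iff:
  assumes "\<tau> \<in> comtraces \<Theta>" "w \<in> \<tau>"
  shows "v \<in> \<tau> \<longleftrightarrow> v \<in> step_seqs \<Theta> \<and> ct_equiv \<Theta> w v"
proof -
  obtain u where "\<tau> = {v \<in> step_seqs \<Theta>. ct_equiv \<Theta> u v}"
    using assms unfolding comtraces_def by (auto elim!: quotientE)
  then show ?thesis using assms(2) by (auto intro: ct_equiv_trans ct_equiv_sym)
qed

lemma comtraces_step_seqs: "\<tau> \<in> comtraces \<Theta> \<Longrightarrow> w \<in> \<tau> \<Longrightarrow> w \<in> step_seqs \<Theta>"
  using comtraces_iff by blast

lemma comtraces_nonempty: "\<tau> \<in> comtraces \<Theta> \<Longrightarrow> \<tau> \<noteq> {}"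
  unfolding comtraces_def by (auto elim!: quotientE)

lemma ct_equiv_Nil:
  assumes "comtrace_alphabet \<Theta>" "v \<in> step_seqs \<Theta>" "ct_equiv \<Theta> [] v"
  shows "v = []"
  using ct_equiv_occurrences[OF assms(1,3)] occurrences_eq_0[OF assms(1,2)] by simp

text \<open>Each head is admissible for the other sequence, so antisymmetry of \<open>R\<close>
  makes the heads equal, and cancellation passes to the tails.\<close>

lemma greedy_unique:
  assumes \<Theta>: "comtrace_alphabet \<Theta>"
    and antisym: "\<And>A B. is_step \<Theta> A \<Longrightarrow> is_step \<Theta> B \<Longrightarrow> R A B \<Longrightarrow> R B A \<Longrightarrow> A = B"
    and "u \<in> step_seqs \<Theta>" "v \<in> step_seqs \<Theta>" "greedy R \<Theta> u" "greedy R \<Theta> v" "ct_equiv \<Theta> u v"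
  shows "u = v"
  using assms(3-)
proof (induction u arbitrary: v)
  case Nil
  then show ?case using ct_equiv_Nil[OF \<Theta>] by blast
next
  case (Cons A u)
  have "v \<noteq> []"
    using ct_equiv_Nil[OF \<Theta> Cons.prems(1)] ct_equiv_sym[OF Cons.prems(5)] by blast
  then obtain B v' where v: "v = B # v'" by (cases v) auto
  have "adm \<Theta> (A # u) B" "adm \<Theta> v A"
    using adm_cong[OF Cons.prems(5)] adm_hd Cons.prems v by blast+
  then have "A = B" using Cons.prems antisym by (auto simp: v greedy_Cons best_step_def)
  moreover have "ct_equiv \<Theta> u v'"
    using ct_equiv_cancel[OF \<Theta>] Cons.prems v calculation by auto
  ultimately show ?case using Cons v by (auto simp: greedy_Cons)
qed

text \<open>The Foata condition is greediness for \<open>(\<supseteq>)\<close>, except that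
  greediness also asks each step to be admissible for its own suffix, which always holds.\<close>

lemma foata_form_greedy:
  assumes \<Theta>: "comtrace_alphabet \<Theta>" and \<tau>: "\<tau> \<in> comtraces \<Theta>" and w: "w \<in> \<tau>" "greedy (\<supseteq>) \<Theta> w"
  shows "foata_form \<Theta> \<tau> = w"
proof -
  have iff: "is_foata_form \<Theta> \<tau> v \<longleftrightarrow> v \<in> \<tau> \<and> greedy (\<supseteq>) \<Theta> v" for v
  proof (cases "v \<in> \<tau>")
    case True
    then have v: "v \<in> step_seqs \<Theta>" using comtraces_step_seqs[OF \<tau>] by blast
    have "adm \<Theta> (drop i v) (v ! i)" if "i < length v" for i
    proof -
      have "v = take i v @ drop i v" by simp
      then have "drop i v \<in> step_seqs \<Theta>" using v by (metis step_seqs_append)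
      then show ?thesis using adm_hd Cons_nth_drop_Suc[OF that] by metis
    qed
    then show ?thesis using True
      unfolding is_foata_form_def greedy_def best_step_def adm_def by blast
  qed (simp add: is_foata_form_def)
  show ?thesis unfolding foata_form_def iff
  proof (rule the_equality)
    fix v assume "v \<in> \<tau> \<and> greedy (\<supseteq>) \<Theta> v"
    then show "v = w"
      using w comtraces_iff[OF \<tau> w(1)] ct_equiv_sym
      by (intro greedy_unique[OF \<Theta>, of "(\<supseteq>)"]) auto
  qed (use w in simp)
qed

text \<open>For different sets of equal finite size both differences are nonempty, so equal minima
  would be a common element of two disjoint sets.\<close>

lemma step_le_antisym:
  assumes "finite A" "finite B" "step_le A B" "step_le B A"
  shows "A = B"
proof (rule ccontr)
  assume ne: "A \<noteq> B"
  then have card: "card A = card B" and le: "Min (A - B) = Min (B - A)"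
    using assms(3,4) by (auto simp: step_le_def)
  then have "A - B \<noteq> {}" "B - A \<noteq> {}"
    using ne assms(1,2) card_subset_eq by (metis Diff_eq_empty_iff)+
  then have "Min (A - B) \<in> A - B" "Min (B - A) \<in> B - A"
    using assms(1,2) by (meson Min_in finite_Diff)+
  then show False using le by auto
qed

lemma seq_le_antisym:
  assumes "\<And>A. A \<in> set u \<union> set v \<Longrightarrow> finite A" "seq_le u v" "seq_le v u"
  shows "u = v"
  using assms
proof (induction u arbitrary: v)
  case (Cons A u)
  then obtain B v' where v: "v = B # v'" by (cases v) (auto simp: seq_le_def)
  have "A = B" using Cons.prems step_le_antisym[of A B] by (auto simp: seq_le_def v)
  then show ?case using Cons.IH[of v'] Cons.prems by (auto simp: seq_le_def v)
qed (auto simp: seq_le_def)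

text \<open>The head of \<open>v\<close> is admissible for \<open>u\<close>, so the greedy head is
  at most as large. If the heads agree, cancellation makes the tails equivalent, so local minimality
  is enough for lexicographic minimality.\<close>

lemma greedy_seq_le:
  assumes \<Theta>: "comtrace_alphabet \<Theta>" and "u \<in> step_seqs \<Theta>" "v \<in> step_seqs \<Theta>"
    "greedy step_le \<Theta> u" "ct_equiv \<Theta> u v"
  shows "seq_le u v"
  using assms(2-)
proof (induction u arbitrary: v)
  case Nil
  then show ?case using ct_equiv_Nil[OF \<Theta>] by (auto simp: seq_le_def)
next
  case (Cons A u)
  have "v \<noteq> []"
    using ct_equiv_Nil[OF \<Theta> Cons.prems(1)] ct_equiv_sym[OF Cons.prems(4)] by blast
  then obtain B v' where v: "v = B # v'" by (cases v) auto
  have "adm \<Theta> (A # u) B"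
    using adm_cong[OF Cons.prems(4)] adm_hd Cons.prems v by blast
  then have le: "step_le A B" using Cons.prems by (auto simp: greedy_Cons best_step_def)
  show ?case
  proof (cases "A = B")
    case True
    then have "ct_equiv \<Theta> u v'" using ct_equiv_cancel[OF \<Theta>] Cons.prems v by auto
    then have "seq_le u v'" using Cons v by (auto simp: greedy_Cons)
    then show ?thesis using True by (auto simp: v seq_le_def)
  qed (use le in \<open>auto simp: v seq_le_def\<close>)
qed

lemma lex_form_greedy:
  fixes \<Theta> :: "'a::linorder comtrace_alphabet"
  assumes \<Theta>: "comtrace_alphabet \<Theta>" and \<tau>: "\<tau> \<in> comtraces \<Theta>" and w: "w \<in> \<tau>" "greedy step_le \<Theta> w"
  shows "lex_form \<tau> = w"
  unfolding lex_form_def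
proof (rule the_equality)
  note iff = comtraces_iff[OF \<tau> w(1)]
  show lex: "is_lex_form \<tau> w"
    using greedy_seq_le[OF \<Theta> _ _ w(2)] w(1) iff by (auto simp: is_lex_form_def)
  fix v assume v: "is_lex_form \<tau> v"
  then have "finite A" if "A \<in> set v \<union> set w" for A
    using that is_step_finite[OF \<Theta>] iff w by (auto simp: step_seqs_def is_lex_form_def)
  then show "v = w" using v lex by (intro seq_le_antisym) (auto simp: is_lex_form_def)
qed

section \<open>Time-bounded execution\<close>

text \<open>A syntactic upper bound on what a program may write. With \<open>wmems\<close> it lets
  invariants be carried across a program by inspecting its text.\<close>

primrec wregs :: "com \<Rightarrow> nat set" where
  "wregs Skip = {}"
| "wregs (Const x c) = {x}"
| "wregs (Add x y z) = {x}"
| "wregs (Sub x y z) = {x}"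
| "wregs (Load x y z) = {x}"
| "wregs (Store x y z) = {}"
| "wregs (Seq P Q) = wregs P \<union> wregs Q"
| "wregs (IfLess x y P Q) = wregs P \<union> wregs Q"
| "wregs (WhileLess x y P) = wregs P"

primrec wmems :: "com \<Rightarrow> nat set" where
  "wmems Skip = {}"
| "wmems (Const x c) = {}"
| "wmems (Add x y z) = {}"
| "wmems (Sub x y z) = {}"
| "wmems (Load x y z) = {}"
| "wmems (Store x y z) = {x}"
| "wmems (Seq P Q) = wmems P \<union> wmems Q"
| "wmems (IfLess x y P Q) = wmems P \<union> wmems Q"
| "wmems (WhileLess x y P) = wmems P"

definition frame :: "com \<Rightarrow> ram_state \<Rightarrow> ram_state \<Rightarrow> bool" where
  "frame P s s' \<longleftrightarrow> (\<forall>x. x \<notin> wregs P \<longrightarrow> reg s' x = reg s x) \<and>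
     (\<forall>y. y \<notin> wmems P \<longrightarrow> mem s' y = mem s y)"

lemma frame_refl [simp]: "frame P s s"
  by (simp add: frame_def)

lemma frame_trans: "frame P s s' \<Longrightarrow> frame P s' s'' \<Longrightarrow> frame P s s''"
  by (simp add: frame_def)

lemma exec_frame: "exec P s t s' \<Longrightarrow> frame P s s'"
  by (induction rule: exec.induct) (auto simp: frame_def)

text \<open>Total correctness with a time bound. The rules below hand the frame of the executed part
  to what follows, so postconditions need only describe what changes.\<close>

definition runs :: "com \<Rightarrow> ram_state \<Rightarrow> nat \<Rightarrow> (ram_state \<Rightarrow> bool) \<Rightarrow> bool" where
  "runs P s T Q \<longleftrightarrow> (\<exists>t s'. exec P s t s' \<and> t \<le> T \<and> Q s')"

lemma runs_conseq:
  assumes "runs P s T Q" "T \<le> T'" "\<And>s'. Q s' \<Longrightarrow> frame P s s' \<Longrightarrow> Q' s'"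
  shows "runs P s T' Q'"
  using assms unfolding runs_def by (meson exec_frame order_trans)

lemma runs_Seq:
  assumes "runs P s T1 Q" "\<And>s'. Q s' \<Longrightarrow> frame P s s' \<Longrightarrow> runs P' s' T2 R" "T1 + T2 \<le> T"
  shows "runs (Seq P P') s T R"
  using assms unfolding runs_def by (meson exec_Seq exec_frame add_mono order_trans)

lemma runs_IfLess:
  assumes "reg s x < reg s y \<Longrightarrow> runs P s T Q" "\<not> reg s x < reg s y \<Longrightarrow> runs P' s T Q" "T + 1 \<le> T'"
  shows "runs (IfLess x y P P') s T' Q"
  using assms unfolding runs_def
  by (cases "reg s x < reg s y") (meson exec_IfTrue exec_IfFalse add_mono order_refl order_trans)+

text \<open>The potential \<open>f\<close> pays for the body and for one test.\<close>

lemma runs_while: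
  assumes "I s"
    and step: "\<And>s'. frame P s s' \<Longrightarrow> I s' \<Longrightarrow> reg s' x < reg s' y \<Longrightarrow>
      \<exists>T. runs P s' T (\<lambda>s''. I s'' \<and> f s'' + T + 1 \<le> f s')"
    and "f s + 1 \<le> T"
  shows "runs (WhileLess x y P) s T (\<lambda>s'. I s' \<and> \<not> reg s' x < reg s' y)"
proof -
  have "runs (WhileLess x y P) s' (f s' + 1) (\<lambda>s'. I s' \<and> \<not> reg s' x < reg s' y)"
    if "frame P s s'" "I s'" for s'
    using that
  proof (induction "f s'" arbitrary: s' rule: less_induct)
    case less
    show ?case
    proof (cases "reg s' x < reg s' y")
      case True
      obtain T t s'' where 1: "exec P s' t s''" "t \<le> T" "I s''" "f s'' + T + 1 \<le> f s'"
        using step[OF less.prems True] unfolding runs_def by blast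
      moreover have "frame P s s''"
        using frame_trans[OF less.prems(1) exec_frame[OF 1(1)]] .
      ultimately obtain t' s3 where 2: "exec (WhileLess x y P) s'' t' s3" "t' \<le> f s'' + 1"
          "I s3" "\<not> reg s3 x < reg s3 y"
        using less.hyps[of s''] unfolding runs_def by auto
      then have "exec (WhileLess x y P) s' (t + t' + 1) s3"
        using exec_WhileTrue[OF True 1(1)] by blast
      then show ?thesis using 1 2 unfolding runs_def by fastforce
    next
      case False
      then show ?thesis using exec_WhileFalse[OF False] less.prems unfolding runs_def by fastforce
    qed
  qed
  from this[OF frame_refl assms(1)] show ?thesis
    using assms(3) by (rule runs_conseq) auto
qed

text \<open>Each of the \<open>n\<close> iterations pays for the body and for its successful test;
  the extra unit pays for the final failing test.\<close>

lemma runs_for: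
  assumes init: "reg s x = 0" "reg s y = n" "y \<notin> wregs P" "I 0 s"
    and step: "\<And>i s'. i < n \<Longrightarrow> frame P s s' \<Longrightarrow> reg s' x = i \<Longrightarrow> reg s' y = n \<Longrightarrow> I i s' \<Longrightarrow>
      runs P s' c (\<lambda>s''. I (Suc i) s'' \<and> reg s'' x = Suc i)"
    and T: "n * (c + 1) + 1 \<le> T"
  shows "runs (WhileLess x y P) s T (\<lambda>s'. I n s' \<and> reg s' x = n)"
proof -
  have y: "reg s' y = n" if "frame P s s'" for s'
    using that init(2,3) by (simp add: frame_def)
  have "runs (WhileLess x y P) s T (\<lambda>s'. (I (reg s' x) s' \<and> reg s' x \<le> n) \<and> \<not> reg s' x < reg s' y)"
  proof (rule runs_while[where f = "\<lambda>s'. (n - reg s' x) * (c + 1)"])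
    fix s' assume s': "frame P s s'" "I (reg s' x) s' \<and> reg s' x \<le> n" "reg s' x < reg s' y"
    have lt: "reg s' x < n" using s' y by simp
    then have *: "(n - Suc (reg s' x)) * (c + 1) + c + 1 = (n - reg s' x) * (c + 1)"
      by (metis Suc_diff_Suc add.commute add.left_commute mult_Suc)
    have "runs P s' c (\<lambda>s''. (I (reg s'' x) s'' \<and> reg s'' x \<le> n)
        \<and> (n - reg s'' x) * (c + 1) + c + 1 \<le> (n - reg s' x) * (c + 1))"
    proof (rule runs_conseq[OF step[OF lt s'(1) refl y[OF s'(1)] conjunct1[OF s'(2)]] order_refl])
      fix s'' assume "I (Suc (reg s' x)) s'' \<and> reg s'' x = Suc (reg s' x)"
      then show "(I (reg s'' x) s'' \<and> reg s'' x \<le> n)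
        \<and> (n - reg s'' x) * (c + 1) + c + 1 \<le> (n - reg s' x) * (c + 1)"
        using * lt by simp
    qed
    then show "\<exists>T. runs P s' T (\<lambda>s''. (I (reg s'' x) s'' \<and> reg s'' x \<le> n)
        \<and> (n - reg s'' x) * (c + 1) + T + 1 \<le> (n - reg s' x) * (c + 1))" by blast
  qed (use init T in auto)
  then show ?thesis
    by (rule runs_conseq) (use y in \<open>auto simp: frame_def\<close>)
qed

section \<open>Straight-line programs evaluated by simplification\<close>

primrec straight :: "com \<Rightarrow> bool" where
  "straight Skip = True"
| "straight (Const x c) = True"
| "straight (Add x y z) = True"
| "straight (Sub x y z) = True"
| "straight (Load x y z) = True"
| "straight (Store x y z) = True"
| "straight (Seq P Q) = (straight P \<and> straight Q)"
| "straight (IfLess x y P Q) = (straight P \<and> straight Q)"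
| "straight (WhileLess x y P) = False"

text \<open>An upper bound only: both branches of a test are charged, so that the value is computed
  without case distinctions. The entry for loops is a dummy, as \<open>straight\<close> excludes
  them.\<close>

primrec cost :: "com \<Rightarrow> nat" where
  "cost Skip = 1"
| "cost (Const x c) = 1"
| "cost (Add x y z) = 1"
| "cost (Sub x y z) = 1"
| "cost (Load x y z) = 1"
| "cost (Store x y z) = 1"
| "cost (Seq P Q) = cost P + cost Q"
| "cost (IfLess x y P Q) = cost P + cost Q + 1"
| "cost (WhileLess x y P) = 0"

primrec sem :: "com \<Rightarrow> ram_state \<Rightarrow> ram_state" where
  "sem Skip s = s"
| "sem (Const x c) s = s\<lparr>reg := (reg s)(x := c)\<rparr>"
| "sem (Add x y z) s = s\<lparr>reg := (reg s)(x := reg s y + reg s z)\<rparr>"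
| "sem (Sub x y z) s = s\<lparr>reg := (reg s)(x := reg s y - reg s z)\<rparr>"
| "sem (Load x y z) s = s\<lparr>reg := (reg s)(x := mem s y (reg s z))\<rparr>"
| "sem (Store x y z) s = s\<lparr>mem := (mem s)(x := (mem s x)(reg s y := reg s z))\<rparr>"
| "sem (Seq P Q) s = sem Q (sem P s)"
| "sem (IfLess x y P Q) s = (if reg s x < reg s y then sem P s else sem Q s)"
| "sem (WhileLess x y P) s = s"

lemma exec_sem: "straight P \<Longrightarrow> \<exists>t \<le> cost P. exec P s t (sem P s)"
proof (induction P arbitrary: s)
  case (Seq P Q)
  then obtain t t' where "t \<le> cost P" "exec P s t (sem P s)" "t' \<le> cost Q" "exec Q (sem P s) t' (sem Q (sem P s))"
    by (metis straight.simps(7))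
  then show ?case by (auto intro!: exI[of _ "t + t'"] exec.intros)
next
  case (IfLess x y P Q)
  then obtain t t' where "t \<le> cost P" "exec P s t (sem P s)" "t' \<le> cost Q" "exec Q s t' (sem Q s)"
    by (metis straight.simps(8))
  then show ?case
    using exec_IfTrue[of s x y P t "sem P s" Q] exec_IfFalse[of s x y Q t' "sem Q s" P]
    by (cases "reg s x < reg s y") (fastforce intro: exI[of _ "t + 1"], fastforce intro: exI[of _ "t' + 1"])
qed (force intro: exec.intros[unfolded One_nat_def])+

lemma runs_straight: "straight P \<Longrightarrow> cost P \<le> T \<Longrightarrow> Q (sem P s) \<Longrightarrow> runs P s T Q"
  using exec_sem[of P s] unfolding runs_def by (meson order_trans)

text \<open>The closing \<open>Skip\<close> takes one unit, so a block of m assignments costs m +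
  1.\<close>

primrec block :: "com list \<Rightarrow> com" where
  "block [] = Skip"
| "block (P # Ps) = Seq P (block Ps)"

section \<open>Bounded breadth-first search\<close>

text \<open>
  Registers: 0 holds \<open>k\<close>, 1 the number of steps and 2 the number of occurrences written so far,
  3 the total number of occurrences, 4, 5 and 6 the constants \<open>1\<close>, \<open>k + 1\<close> and \<open>0\<close>; all others are
  scratch.  Arrays, besides those of the input and the output: 6 holds the current position in each
  projection word, 7 the step to be emitted (as a 0/1 vector), 8 and 9 the multiples of \<open>k\<close> and
  \<open>k + 1\<close> (there is no multiplication), 10 the adjacency matrix of a graph on \<open>0, \<dots>, k\<close>,
  11 the marks and 12 the queue of a breadth-first search.

  A search starts at register 40 and gives up once more than register 41 vertices have been reached;
  register 44 counts them, and register 45 is set to 0 to leave the loop.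
\<close>

definition clear_marks :: com where
  "clear_marks = Seq (Const 42 0) (WhileLess 42 5 (block [Store 11 42 6, Add 42 42 4]))"

definition scan_row :: com where
  "scan_row = WhileLess 42 5 (block
     [Add 48 47 42, Load 49 10 48, Load 50 11 42,
      IfLess 6 49 (IfLess 50 4 (block [Store 11 42 4, Store 12 44 42, Add 44 44 4]) Skip) Skip,
      Add 42 42 4])"

text \<open>Register 6 is 0, so \<open>Add 45 44 6\<close> copies the end of the queue into the loop
  bound. Bound 0 ends the loop at once when the limit is exceeded.\<close>

definition set_bound :: com where
  "set_bound = IfLess 41 44 (Const 45 0) (Add 45 44 6)"

definition search_init :: com where
  "search_init = block [Store 11 40 4, Store 12 6 40, Const 43 0, Const 44 1, set_bound]"

definition next_vertex :: com where
  "next_vertex = block [Load 46 12 43, Add 43 43 4, Load 47 9 46, Const 42 0]"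

definition search :: com where
  "search = Seq clear_marks (Seq search_init
     (WhileLess 43 45 (Seq next_vertex (Seq scan_row set_bound))))"

lemmas search_defs = clear_marks_def scan_row_def set_bound_def search_init_def next_vertex_def search_def

text \<open>The tables include index \<open>k\<close>: table 9 then covers the row of the extra
  vertex, and entry \<open>k\<close> of table 8 is \<open>k * k\<close>, the number of positions to
  initialise.\<close>

definition ready :: "nat \<Rightarrow> ram_state \<Rightarrow> bool" where
  "ready k s \<longleftrightarrow> reg s 0 = k \<and> reg s 4 = 1 \<and> reg s 5 = Suc k \<and> reg s 6 = 0 \<and>
     (\<forall>i\<le>k. mem s 8 i = i * k) \<and> (\<forall>i\<le>k. mem s 9 i = i * Suc k)"

lemma ready_frame:
  assumes "ready k s" "frame P s s'" "wregs P \<inter> {0, 4, 5, 6} = {}" "wmems P \<inter> {8, 9} = {}"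
  shows "ready k s'"
proof -
  have "0 \<notin> wregs P" "4 \<notin> wregs P" "5 \<notin> wregs P" "6 \<notin> wregs P" "8 \<notin> wmems P" "9 \<notin> wmems P"
    using assms(3,4) by auto
  then show ?thesis using assms(1,2) by (simp add: ready_def frame_def)
qed

definition edges :: "nat \<Rightarrow> ram_state \<Rightarrow> nat rel" where
  "edges k s = {(u, v). u \<le> k \<and> v \<le> k \<and> 0 < mem s 10 (u * Suc k + v)}"

definition queue :: "nat \<Rightarrow> nat list \<Rightarrow> ram_state \<Rightarrow> bool" where
  "queue k qs s \<longleftrightarrow> reg s 44 = length qs \<and> (\<forall>i<length qs. mem s 12 i = qs ! i) \<and> distinct qs \<and>
     set qs \<subseteq> {..k} \<and> (\<forall>v\<le>k. mem s 11 v = (if v \<in> set qs then 1 else 0))"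

lemma runs_clear_marks:
  assumes "ready k s"
  shows "runs clear_marks s (10 * Suc k) (\<lambda>s'. \<forall>v\<le>k. mem s' 11 v = 0)"
  unfolding clear_marks_def
proof (rule runs_Seq)
  show "runs (Const 42 0) s 1 (\<lambda>s'. reg s' 42 = 0)"
    by (rule runs_straight) auto
next
  fix s' assume s': "reg s' 42 = 0" "frame (Const 42 0) s s'"
  have r: "ready k s'" using ready_frame[OF assms s'(2)] by simp
  show "runs (WhileLess 42 5 (block [Store 11 42 6, Add 42 42 4])) s' (Suc k * 4 + 1) (\<lambda>s'. \<forall>v\<le>k. mem s' 11 v = 0)"
  proof (rule runs_conseq[OF runs_for[where n = "Suc k" and c = 3 and I = "\<lambda>i s. \<forall>v<i. mem s 11 v = 0"]])
    fix i s'' assume *: "i < Suc k" "frame (block [Store 11 42 6, Add 42 42 4]) s' s''" "reg s'' 42 = i"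
      "\<forall>v<i. mem s'' 11 v = 0"
    have "ready k s''" using ready_frame[OF r *(2)] by simp
    then show "runs (block [Store 11 42 6, Add 42 42 4]) s'' 3
       (\<lambda>s''. (\<forall>v<Suc i. mem s'' 11 v = 0) \<and> reg s'' 42 = Suc i)"
      using * by (intro runs_straight) (auto simp: ready_def less_Suc_eq)
  qed (use r s' in \<open>auto simp: ready_def less_Suc_eq_le\<close>)
qed simp

lemma runs_scan_row:
  assumes r: "ready k s" and q: "queue k qs s" and s: "reg s 42 = 0" "reg s 47 = u * Suc k" "u \<le> k"
  shows "runs scan_row s (Suc k * 15 + 1)
    (\<lambda>s'. \<exists>ys. queue k (qs @ ys) s' \<and> set (qs @ ys) = set qs \<union> edges k s `` {u})"
proof -
  define body where "body = block
     [Add 48 47 42, Load 49 10 48, Load 50 11 42,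
      IfLess 6 49 (IfLess 50 4 (block [Store 11 42 4, Store 12 44 42, Add 44 44 4]) Skip) Skip,
      Add 42 42 4]"
  define I where "I = (\<lambda>i s'. \<exists>ys. queue k (qs @ ys) s' \<and>
     set (qs @ ys) = set qs \<union> {v. v < i \<and> (u, v) \<in> edges k s})"
  have "runs (WhileLess 42 5 body) s (Suc k * 15 + 1) (\<lambda>s'. I (Suc k) s' \<and> reg s' 42 = Suc k)"
  proof (rule runs_for[where c = 14])
    fix i s' assume *: "i < Suc k" "frame body s s'" "reg s' 42 = i" "I i s'"
    have r': "ready k s'" by (rule ready_frame[OF r *(2)]) (simp_all add: body_def)
    have s': "reg s' 47 = u * Suc k" "mem s' 10 = mem s 10"
      using *(2) s by (simp_all add: frame_def body_def)
    obtain ys where ys: "queue k (qs @ ys) s'" "set (qs @ ys) = set qs \<union> {v. v < i \<and> (u, v) \<in> edges k s}"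
      using *(4) by (auto simp: I_def)
    show "runs body s' 14 (\<lambda>s''. I (Suc i) s'' \<and> reg s'' 42 = Suc i)"
    proof (rule runs_straight)
      show "I (Suc i) (sem body s') \<and> reg (sem body s') 42 = Suc i"
      proof (cases "(u, i) \<in> edges k s \<and> i \<notin> set (qs @ ys)")
        case True
        then have "queue k (qs @ ys @ [i]) (sem body s')"
          using r' s' ys(1) * by (auto simp: body_def ready_def queue_def edges_def nth_append less_Suc_eq)
        moreover have "set (qs @ ys @ [i]) = set qs \<union> {v. v < Suc i \<and> (u, v) \<in> edges k s}"
          using ys(2) True by (auto simp: less_Suc_eq)
        moreover have "reg (sem body s') 42 = Suc i"
          using r' * by (auto simp: body_def ready_def)
        ultimately show ?thesis unfolding I_def by blast
      next
        case False
        then have "sem body s' = s'\<lparr>reg := (reg s')(48 := u * Suc k + i, 49 := mem s 10 (u * Suc k + i),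
            50 := mem s' 11 i, 42 := Suc i)\<rparr>"
          using r' s' ys(1) * s(3) by (auto simp: body_def ready_def queue_def edges_def)
        then have "queue k (qs @ ys) (sem body s')" "reg (sem body s') 42 = Suc i"
          using ys(1) by (simp_all add: queue_def)
        moreover have "set (qs @ ys) = set qs \<union> {v. v < Suc i \<and> (u, v) \<in> edges k s}"
          using ys(2) False by (auto simp: less_Suc_eq)
        ultimately show ?thesis unfolding I_def by blast
      qed
    qed (simp_all add: body_def)
  next
    show "I 0 s" unfolding I_def using q by (auto intro!: exI[of _ "[]"])
  qed (use r s in \<open>auto simp: ready_def body_def\<close>)
  then show ?thesis unfolding scan_row_def body_def[symmetric]
  proof (rule runs_conseq)
    fix s' assume "I (Suc k) s' \<and> reg s' 42 = Suc k"
    moreover have "{v. v < Suc k \<and> (u, v) \<in> edges k s} = edges k s `` {u}"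
      by (auto simp: edges_def)
    ultimately show "\<exists>ys. queue k (qs @ ys) s' \<and> set (qs @ ys) = set qs \<union> edges k s `` {u}"
      by (simp add: I_def)
  qed simp
qed

lemma Image_rtrancl_subset:
  assumes "x \<in> V" "E `` V \<subseteq> V"
  shows "E\<^sup>* `` {x} \<subseteq> V"
proof clarify
  fix y assume "(x, y) \<in> E\<^sup>*"
  then show "y \<in> V" using assms by (induction rule: rtrancl_induct) auto
qed

lemma reachable_bounded:
  assumes "x \<le> k" shows "(edges k s)\<^sup>* `` {x} \<subseteq> {..k}"
  using assms by (intro Image_rtrancl_subset) (auto simp: edges_def)

text \<open>When the loop ends, either more than \<open>L\<close> vertices are queued, all of them
  in \<open>R\<close>, so \<open>R\<close> is too large; or all queued vertices have been expanded,
  so the queue is closed under edges and equals \<open>R\<close>.\<close>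

lemma runs_search:
  assumes r: "ready k s" and x: "reg s 40 = x" "x \<le> k" and L: "reg s 41 = L"
  defines "R \<equiv> (edges k s)\<^sup>* `` {x}"
  shows "runs search s (50 * (Suc k * Suc L)) (\<lambda>s'. (reg s' 44 \<le> L \<longleftrightarrow> card R \<le> L) \<and>
     (card R \<le> L \<longrightarrow> reg s' 44 = card R \<and> (\<forall>v\<le>k. mem s' 11 v = (if v \<in> R then 1 else 0))))"
    (is "runs _ _ _ ?Q")
  unfolding search_def
proof (rule runs_Seq[OF runs_clear_marks[OF r]])
  define body where "body = Seq next_vertex (Seq scan_row set_bound)"
  have finR: "finite R" and Rk: "R \<subseteq> {..k}"
    using reachable_bounded[OF x(2)] by (auto simp: R_def intro: finite_subset)
  define I where "I = (\<lambda>s'. \<exists>qs. queue k qs s' \<and> reg s' 43 \<le> length qs \<and> x \<in> set qs \<and> set qs \<subseteq> R \<and>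
    (\<forall>i<reg s' 43. edges k s `` {qs ! i} \<subseteq> set qs) \<and> reg s' 45 = (if L < length qs then 0 else length qs))"
  fix s1 assume s1: "\<forall>v\<le>k. mem s1 11 v = 0" and f1: "frame clear_marks s s1"
  have r1: "ready k s1" by (rule ready_frame[OF r f1]) (simp_all add: search_defs)
  have m1: "reg s1 40 = x" "reg s1 41 = L" "mem s1 10 = mem s 10"
    using f1 x L by (simp_all add: frame_def search_defs)
  show "runs (Seq search_init (WhileLess 43 45 (Seq next_vertex (Seq scan_row set_bound)))) s1
     (10 + (30 * (Suc k * L) + 1)) ?Q"
    unfolding body_def[symmetric]
  proof (rule runs_Seq)
    show "runs search_init s1 10 (\<lambda>s'. I s' \<and> reg s' 43 = 0)"
      using r1 m1 s1 x(2)
      by (intro runs_straight)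
        (auto simp: search_defs I_def queue_def ready_def R_def intro!: exI[of _ "[x]"])
    fix s2 assume s2: "I s2 \<and> reg s2 43 = 0" and f2: "frame search_init s1 s2"
    have r2: "ready k s2" by (rule ready_frame[OF r1 f2]) (simp_all add: search_defs)
    have m2: "reg s2 41 = L" "mem s2 10 = mem s 10"
      using f2 m1 by (simp_all add: frame_def search_defs)
    have "runs (WhileLess 43 45 body) s2 (30 * (Suc k * L) + 1) (\<lambda>s'. I s' \<and> \<not> reg s' 43 < reg s' 45)"
    \<comment> \<open>While the loop runs, the queue has at most \<open>L\<close> entries, so its
      head is below \<open>L\<close>. An iteration costs at most 15 (k + 1) + 15, which is at most
      30 (k + 1).\<close>
    proof (rule runs_while[where f = "\<lambda>s'. 30 * (Suc k * (L - reg s' 43))"])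
      fix s3 assume f3: "frame body s2 s3" and s3: "I s3" "reg s3 43 < reg s3 45"
      have r3: "ready k s3" by (rule ready_frame[OF r2 f3]) (simp_all add: search_defs body_def)
      have m3: "reg s3 41 = L" "mem s3 10 = mem s 10"
        using f3 m2 by (simp_all add: frame_def search_defs body_def)
      define h where "h = reg s3 43"
      obtain qs where qs: "queue k qs s3" "h \<le> length qs" "x \<in> set qs" "set qs \<subseteq> R"
        "\<forall>i<h. edges k s `` {qs ! i} \<subseteq> set qs" and "reg s3 45 = (if L < length qs then 0 else length qs)"
        using s3(1) by (auto simp: I_def h_def)
      then have h: "h < length qs" "length qs \<le> L" using s3(2) by (auto simp: h_def split: if_splits)
      define u where "u = qs ! h"
      have u: "u \<in> set qs" using h by (simp add: u_def)
      then have u': "u \<le> k" "mem s3 12 h = u"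
        using h qs(1) by (auto simp: queue_def u_def[symmetric])
      have "runs body s3 (Suc k * 15 + 14) (\<lambda>s''. I s'' \<and> reg s'' 43 = Suc h)"
        unfolding body_def
      proof (rule runs_Seq)
        show "runs next_vertex s3 5 (\<lambda>s'. reg s' 43 = Suc h \<and> reg s' 47 = u * Suc k \<and> reg s' 42 = 0 \<and> queue k qs s')"
          using r3 u' qs(1)
          by (intro runs_straight) (auto simp: search_defs ready_def queue_def h_def[symmetric])
        fix s4 assume s4: "reg s4 43 = Suc h \<and> reg s4 47 = u * Suc k \<and> reg s4 42 = 0 \<and> queue k qs s4"
          and f4: "frame next_vertex s3 s4"
        have r4: "ready k s4" by (rule ready_frame[OF r3 f4]) (simp_all add: search_defs)
        have m4: "reg s4 41 = L" "edges k s4 = edges k s"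
          using f4 m3 by (simp_all add: frame_def search_defs edges_def)
        show "runs (Seq scan_row set_bound) s4 (Suc k * 15 + 1 + 3) (\<lambda>s''. I s'' \<and> reg s'' 43 = Suc h)"
        proof (rule runs_Seq[OF runs_scan_row[OF r4]])
          show "queue k qs s4" "reg s4 42 = 0" "reg s4 47 = u * Suc k" "u \<le> k" using s4 u' by auto
          fix s5 assume s5: "\<exists>ys. queue k (qs @ ys) s5 \<and> set (qs @ ys) = set qs \<union> edges k s4 `` {u}"
            and f5: "frame scan_row s4 s5"
          have r5: "ready k s5" by (rule ready_frame[OF r4 f5]) (simp_all add: search_defs)
          have m5: "reg s5 41 = L" "reg s5 43 = Suc h"
            using f5 m4 s4 by (simp_all add: frame_def search_defs)
          obtain ys where ys: "queue k (qs @ ys) s5" "set (qs @ ys) = set qs \<union> edges k s `` {u}"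
            using s5 m4 by auto
          have "edges k s `` {u} \<subseteq> R"
            using u qs(4) by (auto simp: R_def intro: rtrancl_into_rtrancl)
          then have "set (qs @ ys) \<subseteq> R" using ys(2) qs(4) by simp
          moreover have "edges k s `` {(qs @ ys) ! i} \<subseteq> set (qs @ ys)" if "i < Suc h" for i
          proof (cases "i = h")
            case True
            then show ?thesis using h ys(2) by (simp add: nth_append u_def)
          next
            case False
            then have "i < h" using that by simp
            then show ?thesis using h qs(5) by (auto simp: nth_append)
          qed
          moreover have "queue k (qs @ ys) (sem set_bound s5)" "reg (sem set_bound s5) 43 = Suc h"
            "reg (sem set_bound s5) 45 = (if L < length (qs @ ys) then 0 else length (qs @ ys))"
            using ys(1) m5 r5 by (auto simp: queue_def search_defs ready_def)
          ultimately have "I (sem set_bound s5)"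
            unfolding I_def using h(1) qs(3) by (intro exI[of _ "qs @ ys"]) auto
          then show "runs set_bound s5 3 (\<lambda>s''. I s'' \<and> reg s'' 43 = Suc h)"
            using m5 by (intro runs_straight) (auto simp: search_defs)
        qed simp
      qed simp
      moreover have "30 * (Suc k * (L - Suc h)) + (Suc k * 15 + 14) + 1 \<le> 30 * (Suc k * (L - h))"
      proof -
        have "L - h = Suc (L - Suc h)" using h by simp
        then show ?thesis by (simp add: algebra_simps)
      qed
      ultimately show "\<exists>T. runs body s3 T (\<lambda>s''. I s'' \<and> 30 * (Suc k * (L - reg s'' 43)) + T + 1
           \<le> 30 * (Suc k * (L - reg s3 43)))"
        unfolding h_def[symmetric]
        by (intro exI[of _ "Suc k * 15 + 14"]) (erule runs_conseq, auto)
    qed (use s2 in auto)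
    then show "runs (WhileLess 43 45 body) s2 (30 * (Suc k * L) + 1) ?Q"
    proof (rule runs_conseq)
      fix s' assume "I s' \<and> \<not> reg s' 43 < reg s' 45"
      then obtain qs where qs: "queue k qs s'" "reg s' 43 \<le> length qs" "x \<in> set qs" "set qs \<subseteq> R"
        "\<forall>i<reg s' 43. edges k s `` {qs ! i} \<subseteq> set qs" "reg s' 45 = (if L < length qs then 0 else length qs)"
        "\<not> reg s' 43 < reg s' 45"
        by (auto simp: I_def)
      have len: "reg s' 44 = length qs" "length qs = card (set qs)"
        using qs(1) by (auto simp: queue_def distinct_card)
      show "?Q s'"
      proof (cases "L < length qs")
        case True
        then have "L < card R" using card_mono[OF finR qs(4)] len by simp
        then show ?thesis using True len by simp
      next
        case False
        then have "reg s' 43 = length qs" using qs by simp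
        then have "edges k s `` set qs \<subseteq> set qs" using qs(5) by (force simp: in_set_conv_nth)
        then have "R = set qs" using qs(3,4) unfolding R_def
          by (intro subset_antisym Image_rtrancl_subset) auto
        then show ?thesis using False len qs(1) by (auto simp: queue_def)
      qed
    qed simp
  qed simp
qed simp

section \<open>The graph of a comtrace\<close>

definition enum_act :: "'a::linorder comtrace_alphabet \<Rightarrow> nat \<Rightarrow> 'a" where
  "enum_act \<Theta> i = sorted_list_of_set (acts \<Theta>) ! i"

lemma enum_act_strict_mono:
  "j < card (acts \<Theta>) \<Longrightarrow> i < j \<Longrightarrow> enum_act \<Theta> i < enum_act \<Theta> j"
  unfolding enum_act_def
  using sorted_wrt_nth_less[OF strict_sorted_list_of_set, of i j "acts \<Theta>"] by simp

lemma enum_act_less_iff: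
  "i < card (acts \<Theta>) \<Longrightarrow> j < card (acts \<Theta>) \<Longrightarrow> enum_act \<Theta> i < enum_act \<Theta> j \<longleftrightarrow> i < j"
  by (metis enum_act_strict_mono linorder_neqE_nat less_asym less_irrefl)

lemma enum_act_eq_iff:
  "i < card (acts \<Theta>) \<Longrightarrow> j < card (acts \<Theta>) \<Longrightarrow> enum_act \<Theta> i = enum_act \<Theta> j \<longleftrightarrow> i = j"
  by (metis enum_act_strict_mono linorder_neqE_nat less_irrefl)

lemma inj_on_enum_act: "inj_on (enum_act \<Theta>) {..<card (acts \<Theta>)}"
  by (auto simp: inj_on_def enum_act_eq_iff)

lemma enum_act_image: "finite (acts \<Theta>) \<Longrightarrow> enum_act \<Theta> ` {..<card (acts \<Theta>)} = acts \<Theta>"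
  using set_sorted_list_of_set[of "acts \<Theta>"] unfolding enum_act_def
  by (auto simp: set_conv_nth simp del: set_sorted_list_of_set)

lemma act_code_enum_act:
  assumes "finite (acts \<Theta>)" "i < card (acts \<Theta>)"
  shows "act_code \<Theta> (enum_act \<Theta> i) = i"
proof -
  define k where "k = card (acts \<Theta>)"
  have "enum_act \<Theta> j < enum_act \<Theta> i \<longleftrightarrow> j < i" if "j < k" for j
    using that assms(2) enum_act_less_iff by (simp add: k_def)
  then have "{b \<in> enum_act \<Theta> ` {..<k}. b < enum_act \<Theta> i} = enum_act \<Theta> ` {..<i}"
    using assms(2) by (fastforce simp: k_def[symmetric])
  then have "{b \<in> acts \<Theta>. b < enum_act \<Theta> i} = enum_act \<Theta> ` {..<i}"
    using enum_act_image[OF assms(1)] by (simp add: k_def)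
  moreover have "inj_on (enum_act \<Theta>) {..<i}"
    using inj_on_enum_act by (rule inj_on_subset) (use assms in auto)
  ultimately show ?thesis by (simp add: act_code_def card_image)
qed

text \<open>The words of the remaining comtrace are suffixes of the input words. Nothing is copied:
  only the starting positions in array 6 move, while array 2 keeps marking the ends.\<close>

definition represents :: "'a::linorder comtrace_alphabet \<Rightarrow> 'a set list \<Rightarrow> ram_state \<Rightarrow> bool" where
  "represents \<Theta> w s \<longleftrightarrow> (let k = card (acts \<Theta>) in ready k s \<and>
     (\<forall>i<k. \<forall>j<k. mem s 1 (i * k + j) = (if (enum_act \<Theta> i, enum_act \<Theta> j) \<in> ser \<Theta> then 1 else 0)) \<and>
     (\<forall>i<k. \<forall>j<k. (enum_act \<Theta> i, enum_act \<Theta> j) \<notin> ind \<Theta> \<longrightarrow>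
        map (mem s 3) [mem s 6 (i * k + j)..<mem s 2 (Suc (i * k + j))] =
        map (sym_code \<Theta>) (proj_seq \<Theta> (enum_act \<Theta> i) (enum_act \<Theta> j) w)))"

lemma represents_frame:
  assumes "represents \<Theta> w s" "frame P s s'"
    "wregs P \<inter> {0, 4, 5, 6} = {}" "wmems P \<inter> {1, 2, 3, 6, 8, 9} = {}"
  shows "represents \<Theta> w s'"
proof -
  have "1 \<notin> wmems P" "2 \<notin> wmems P" "3 \<notin> wmems P" "6 \<notin> wmems P"
    using assms(4) by auto
  then have "mem s' 1 = mem s 1" "mem s' 2 = mem s 2" "mem s' 3 = mem s 3" "mem s' 6 = mem s 6"
    using assms(2) by (simp_all add: frame_def)
  then show ?thesis
    using assms(1) ready_frame[OF _ assms(2,3)] assms(4) unfolding represents_def Let_def by auto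
qed

section \<open>Computing the graph from the projection words\<close>

definition relation_code :: "'a comtrace_alphabet \<Rightarrow> 'a set list \<Rightarrow> 'a \<Rightarrow> 'a \<Rightarrow> nat" where
  "relation_code \<Theta> w a b =
     (if (a, b) \<in> ind \<Theta> \<or> free \<Theta> w a b then 0 else if needs \<Theta> w a b then 1 else 2)"

text \<open>
  An empty word of a pair \<open>(a, b)\<close> outside \<open>ind\<close>, in particular of \<open>(a, a)\<close>, means that \<open>a\<close> does
  not occur, and is coded like a blocked pair.
\<close>

definition load_pair :: com where
  "load_pair = block
     [Load 22 8 20, Add 22 22 21, Load 23 8 21, Add 23 23 20, Load 24 1 22, Load 25 1 23,
      Load 26 6 22, Add 27 22 4, Load 27 2 27, Load 28 3 26, Add 29 26 4, Load 31 3 29,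
      Add 32 24 25, Sub 33 28 20, Sub 34 20 28, Add 33 33 34, Sub 35 31 20, Sub 34 20 31, Add 35 35 34]"

text \<open>The tests, in order: both directions lie in \<open>ser\<close> (their sum exceeds 1),
  the word is nonempty, its first code is below k and so not that of \<open>None\<close>, the first
  letter differs from \<open>a\<close>, \<open>a\<close> weakly depends on \<open>b\<close>, a
  second letter exists, and it differs from \<open>a\<close>. There is no equality test, so two
  codes are compared through the sum of both truncated differences. The second letter may have been
  loaded from beyond the word, but is used only after the check that it exists.\<close>

definition classify :: com where
  "classify = IfLess 4 32 (Const 30 0) (IfLess 26 27
     (IfLess 28 0
        (IfLess 6 33
           (IfLess 24 25 (IfLess 29 27 (IfLess 6 35 (Const 30 2) (Const 30 1)) (Const 30 2)) (Const 30 2))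
           (Const 30 0))
        (Const 30 1))
     (Const 30 2))"

lemma runs_classify:
  assumes \<Theta>: "comtrace_alphabet \<Theta>" and w: "w \<in> step_seqs \<Theta>" and rep: "represents \<Theta> w s"
    and ij: "reg s 20 = i" "reg s 21 = j" "i < card (acts \<Theta>)" "j < card (acts \<Theta>)"
  shows "runs (Seq load_pair classify) s 40
    (\<lambda>s'. reg s' 30 = relation_code \<Theta> w (enum_act \<Theta> i) (enum_act \<Theta> j))"
proof (rule runs_Seq)
  define k where "k = card (acts \<Theta>)"
  define a b where "a = enum_act \<Theta> i" and "b = enum_act \<Theta> j"
  define p q where "p = mem s 6 (i * k + j)" and "q = mem s 2 (Suc (i * k + j))"
  have fin: "finite (acts \<Theta>)" using \<Theta> by (simp add: comtrace_alphabet_def)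
  have r: "ready k s" using rep by (simp add: represents_def k_def Let_def)
  have ser: "mem s 1 (i * k + j) = (if (a, b) \<in> ser \<Theta> then 1 else 0)"
    "mem s 1 (j * k + i) = (if (b, a) \<in> ser \<Theta> then 1 else 0)"
    using rep ij by (auto simp: represents_def k_def[symmetric] Let_def a_def b_def)
  have word: "map (mem s 3) [p..<q] = map (sym_code \<Theta>) (proj_seq \<Theta> a b w)" if "(a, b) \<notin> ind \<Theta>"
    using rep ij that by (auto simp: represents_def k_def[symmetric] Let_def a_def b_def p_def q_def)
  have code: "sym_code \<Theta> (Some a) = i" "sym_code \<Theta> (Some b) = j" "sym_code \<Theta> None = k"
    using act_code_enum_act[OF fin] ij by (simp_all add: sym_code_def a_def b_def k_def)
  have ab: "a = b \<longleftrightarrow> i = j" using enum_act_eq_iff ij by (auto simp: a_def b_def)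
  define diff where "diff = (\<lambda>x y. x - y + (y - x :: nat))"
  have diff: "0 < diff x y \<longleftrightarrow> x \<noteq> y" for x y by (auto simp: diff_def)
  show "runs load_pair s 20 (\<lambda>s'. reg s' 24 = mem s 1 (i * k + j) \<and> reg s' 25 = mem s 1 (j * k + i) \<and>
     reg s' 32 = mem s 1 (i * k + j) + mem s 1 (j * k + i) \<and> reg s' 26 = p \<and> reg s' 27 = q \<and>
     reg s' 28 = mem s 3 p \<and> reg s' 29 = Suc p \<and> reg s' 33 = diff (mem s 3 p) i \<and>
     reg s' 35 = diff (mem s 3 (Suc p)) i)"
    using r ij unfolding k_def[symmetric]
    by (intro runs_straight) (simp_all add: load_pair_def ready_def p_def q_def diff_def)
  fix s1 assume s1: "reg s1 24 = mem s 1 (i * k + j) \<and> reg s1 25 = mem s 1 (j * k + i) \<and>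
     reg s1 32 = mem s 1 (i * k + j) + mem s 1 (j * k + i) \<and> reg s1 26 = p \<and> reg s1 27 = q \<and>
     reg s1 28 = mem s 3 p \<and> reg s1 29 = Suc p \<and> reg s1 33 = diff (mem s 3 p) i \<and>
     reg s1 35 = diff (mem s 3 (Suc p)) i" and f1: "frame load_pair s s1"
  have r1: "ready k s1" by (rule ready_frame[OF r f1]) (simp_all add: load_pair_def)
  have "reg (sem classify s1) 30 = relation_code \<Theta> w a b"
  proof (cases "(a, b) \<in> ind \<Theta>")
    case True
    then show ?thesis using s1 r1 ser by (simp add: classify_def relation_code_def ready_def ind_def)
  next
    case nind: False
    note word = word[OF nind]
    have not_ind: "\<not> 1 < reg s1 32" using s1 ser nind by (auto simp: ind_def)
    note set_w = set_proj_seq[OF \<Theta> w nind]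
    show ?thesis
    proof (cases "proj_seq \<Theta> a b w")
      case Nil
      then have "\<not> p < q" using word by auto
      then show ?thesis using s1 r1 not_ind nind Nil
        by (simp add: classify_def relation_code_def ready_def free_def needs_def)
    next
      case (Cons x xs)
      then have pq: "p < q" using word by (cases "p < q") auto
      then have upt: "[p..<q] = p # [Suc p..<q]" by (simp add: upt_rec)
      have hd: "mem s 3 p = sym_code \<Theta> x" and tl: "map (mem s 3) [Suc p..<q] = map (sym_code \<Theta>) xs"
        using word Cons upt by auto
      \<comment> \<open>Only \<open>a\<close>, \<open>b\<close> and \<open>None\<close> occur in the
        word, with the distinct codes \<open>i\<close>, \<open>j\<close> and \<open>k\<close>;
        comparing the second code with \<open>i\<close> therefore identifies
        \<open>a\<close>.\<close>
      have second: "needs \<Theta> w a b \<longleftrightarrow> (a, b) \<in> wdp \<Theta> \<and> Suc p < q \<and> mem s 3 (Suc p) = i" if "x = Some b" "a \<noteq> b"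
      proof (cases xs)
        case Nil
        then show ?thesis using tl that Cons by (auto simp: needs_def)
      next
        case (Cons y ys)
        then have pq': "Suc p < q" using tl by (cases "Suc p < q") auto
        then have "[Suc p..<q] = Suc p # [Suc (Suc p)..<q]" by (simp add: upt_rec)
        then have "mem s 3 (Suc p) = sym_code \<Theta> y" using tl Cons by auto
        moreover have "y \<in> {None, Some a, Some b}" using set_w Cons \<open>proj_seq \<Theta> a b w = x # xs\<close> by auto
        ultimately have "mem s 3 (Suc p) = i \<longleftrightarrow> y = Some a"
          using code that(2) ab ij(3) k_def by auto
        then show ?thesis using Cons \<open>proj_seq \<Theta> a b w = x # xs\<close> that pq' by (auto simp: needs_def)
      qed
      have x: "x \<in> {None, Some a, Some b}" using set_w Cons by auto
      have ik: "i < k" "j < k" using ij by (auto simp: k_def)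
      consider "x = None" | "x = Some a" | "x = Some b" "a \<noteq> b" using x by blast
      then show ?thesis
      proof cases
        case 1
        then show ?thesis using s1 r1 not_ind nind Cons hd code pq
          by (simp add: classify_def relation_code_def ready_def free_def needs_def)
      next
        case 2
        then show ?thesis using s1 r1 not_ind nind Cons hd code pq ik diff
          by (simp add: classify_def relation_code_def ready_def free_def)
      next
        case 3
        have "\<not> free \<Theta> w a b" using 3 Cons by (simp add: free_def)
        moreover have "mem s 3 p = j" "j \<noteq> i" using 3 hd code ab by auto
        moreover have "(a, b) \<in> wdp \<Theta> \<longleftrightarrow> reg s1 24 < reg s1 25"
          using s1 ser by (auto simp: wdp_def)
        ultimately show ?thesis using second[OF 3] s1 r1 not_ind nind pq ik diff
          by (simp add: classify_def relation_code_def ready_def)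
      qed
    qed
  qed
  then show "runs classify s1 20 (\<lambda>s'. reg s' 30 = relation_code \<Theta> w (enum_act \<Theta> i) (enum_act \<Theta> j))"
    unfolding a_def b_def by (intro runs_straight) (simp_all add: classify_def)
qed simp

text \<open>With \<open>tr\<close> the matrix is stored transposed, so that the same forward search,
  started at vertex \<open>k\<close>, becomes the backward search needed for the Foata form.\<close>

definition edge_cell :: "bool \<Rightarrow> nat \<Rightarrow> nat \<Rightarrow> nat \<Rightarrow> com" where
  "edge_cell tr x a b = (if tr then Seq (Load x 9 b) (Add x x a) else Seq (Load x 9 a) (Add x x b))"

definition edge_index :: "bool \<Rightarrow> nat \<Rightarrow> nat \<Rightarrow> nat \<Rightarrow> nat" where
  "edge_index tr k a b = (if tr then b * Suc k + a else a * Suc k + b)"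

definition row_init :: "bool \<Rightarrow> com" where
  "row_init tr = block [Const 21 0, edge_cell tr 37 20 0, Store 10 37 6]"

text \<open>Register 37 addresses the cell for the edge to vertex \<open>k\<close>, which
  \<open>row_init\<close> clears. A blocked pair sets that cell instead of its own, so one such pair
  anywhere in the row suffices.\<close>

definition mark_edge :: "bool \<Rightarrow> com" where
  "mark_edge tr = block [edge_cell tr 36 20 21,
     IfLess 30 4 (Store 10 36 6)
       (IfLess 4 30 (Seq (Store 10 36 6) (Store 10 37 4)) (Store 10 36 4)),
     Add 21 21 4]"

definition build_row :: "bool \<Rightarrow> com" where
  "build_row tr = WhileLess 21 0 (Seq (Seq load_pair classify) (mark_edge tr))"

definition build :: "bool \<Rightarrow> com" where
  "build tr = Seq (Const 20 0)
     (WhileLess 20 0 (Seq (row_init tr) (Seq (build_row tr) (Add 20 20 4))))"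

lemmas build_defs = build_def build_row_def mark_edge_def row_init_def edge_cell_def
  load_pair_def classify_def

lemma edge_index_eq_iff:
  assumes "a \<le> k" "b \<le> k" "a' \<le> k" "b' \<le> k"
  shows "edge_index tr k a b = edge_index tr k a' b' \<longleftrightarrow> a = a' \<and> b = b'"
proof -
  have *: "x = x' \<and> y = y'" if "x * Suc k + y = x' * Suc k + y'" "y \<le> k" "y' \<le> k" for x y x' y'
  proof -
    have "(x * Suc k + y) div Suc k = x" "(x' * Suc k + y') div Suc k = x'"
      using that(2,3) by (simp_all add: div_mult_self3 div_less del: mult_Suc_right)
    then have "x = x'" using that(1) by metis
    then show ?thesis using that(1) by simp
  qed
  show ?thesis using assms *[of b a b' a'] *[of a b a' b'] unfolding edge_index_def by (cases tr) auto
qed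

definition row_done :: "bool \<Rightarrow> nat \<Rightarrow> (nat \<Rightarrow> nat \<Rightarrow> nat) \<Rightarrow> nat \<Rightarrow> nat \<Rightarrow> ram_state \<Rightarrow> bool" where
  "row_done tr k st i j s \<longleftrightarrow>
     (\<forall>b<j. mem s 10 (edge_index tr k i b) = (if st i b = 1 then 1 else 0)) \<and>
     mem s 10 (edge_index tr k i k) = (if \<exists>b<j. st i b = 2 then 1 else 0)"

lemma runs_build_row:
  assumes \<Theta>: "comtrace_alphabet \<Theta>" and w: "w \<in> step_seqs \<Theta>" and rep: "represents \<Theta> w s"
    and i: "reg s 20 = i" "i < k" "reg s 21 = 0" "reg s 37 = edge_index tr k i k"
    and k: "k = card (acts \<Theta>)"
    and st: "st = (\<lambda>i j. relation_code \<Theta> w (enum_act \<Theta> i) (enum_act \<Theta> j))"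
    and init: "row_done tr k st i 0 s" "\<forall>a<i. row_done tr k st a k s"
  shows "runs (build_row tr) s (60 * k + 1) (\<lambda>s'. \<forall>a\<le>i. row_done tr k st a k s')"
proof -
  define body where "body = Seq (Seq load_pair classify) (mark_edge tr)"
  define I where "I = (\<lambda>j s'. row_done tr k st i j s' \<and> (\<forall>a<i. row_done tr k st a k s'))"
  have r: "ready k s" using rep by (simp add: represents_def k Let_def)
  have wr: "wregs body \<inter> {0, 4, 5, 6} = {}" "wmems body \<inter> {1, 2, 3, 6, 8, 9} = {}"
    by (auto simp: body_def build_defs)
  have "runs (WhileLess 21 0 body) s (60 * k + 1) (\<lambda>s'. I k s' \<and> reg s' 21 = k)"
  proof (rule runs_for[where c = 59])
    fix j s1 assume j: "j < k" and f1: "frame body s s1" and s1: "reg s1 21 = j" "I j s1"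
    have rep1: "represents \<Theta> w s1" by (rule represents_frame[OF rep f1 wr])
    have m1: "reg s1 20 = i" "reg s1 37 = edge_index tr k i k"
      using f1 i by (simp_all add: frame_def body_def build_defs)
    show "runs body s1 59 (\<lambda>s''. I (Suc j) s'' \<and> reg s'' 21 = Suc j)"
      unfolding body_def
    proof (rule runs_Seq[OF runs_classify[OF \<Theta> w rep1 m1(1) s1(1) i(2)[unfolded k] j[unfolded k]]])
      fix s2 assume s2: "reg s2 30 = relation_code \<Theta> w (enum_act \<Theta> i) (enum_act \<Theta> j)"
        and f2: "frame (Seq load_pair classify) s1 s2"
      have rep2: "represents \<Theta> w s2"
        by (rule represents_frame[OF rep1 f2]) (auto simp: build_defs)
      then have r2: "ready k s2" by (simp add: represents_def k Let_def)
      have m2: "reg s2 20 = i" "reg s2 21 = j" "reg s2 37 = edge_index tr k i k" "mem s2 10 = mem s1 10"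
        using f2 m1 s1 by (simp_all add: frame_def build_defs)
      have cell: "reg (sem (edge_cell tr 36 20 21) s2) = (reg s2)(36 := edge_index tr k i j)"
        "mem (sem (edge_cell tr 36 20 21) s2) = mem s2"
        using r2 m2 i(2) j by (auto simp: edge_cell_def ready_def edge_index_def)
      define m where "m = (mem s1 10)(edge_index tr k i j := (if st i j = 1 then 1 else 0))"
      have st2: "reg s2 30 = st i j" "st i j \<le> 2" using s2 by (auto simp: st relation_code_def)
      have "mem (sem (mark_edge tr) s2) 10 = (if st i j = 2 then m(edge_index tr k i k := 1) else m)"
        using r2 m2 st2 by (auto simp: mark_edge_def cell ready_def m_def)
      moreover have "edge_index tr k a b \<noteq> edge_index tr k i j" "edge_index tr k a b \<noteq> edge_index tr k i k"
        if "a < i" "b \<le> k" for a b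
        using that i(2) j by (auto simp: edge_index_eq_iff)
      moreover have "edge_index tr k i b \<noteq> edge_index tr k i k" if "b < k" for b
        using that i(2) by (auto simp: edge_index_eq_iff)
      moreover have "edge_index tr k i k \<noteq> edge_index tr k i j"
        using i(2) j by (auto simp: edge_index_eq_iff)
      moreover have "edge_index tr k i b \<noteq> edge_index tr k i j" if "b < j" for b
        using that i(2) j by (auto simp: edge_index_eq_iff)
      ultimately have "I (Suc j) (sem (mark_edge tr) s2)"
        using s1(2) j by (auto simp: I_def row_done_def m_def less_Suc_eq)
      moreover have "reg (sem (mark_edge tr) s2) 21 = Suc j"
        using r2 m2 by (auto simp: mark_edge_def cell ready_def)
      ultimately show "runs (mark_edge tr) s2 19 (\<lambda>s''. I (Suc j) s'' \<and> reg s'' 21 = Suc j)"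
        by (intro runs_straight) (auto simp: build_defs)
    qed simp
  next
    show "0 \<notin> wregs body" using wr by auto
  qed (use r i init in \<open>auto simp: ready_def I_def\<close>)
  then show ?thesis unfolding build_row_def body_def[symmetric]
    by (rule runs_conseq) (auto simp: I_def le_less)
qed

lemma runs_build:
  assumes \<Theta>: "comtrace_alphabet \<Theta>" and w: "w \<in> step_seqs \<Theta>" and rep: "represents \<Theta> w s"
    and k: "k = card (acts \<Theta>)"
    and st: "st = (\<lambda>i j. relation_code \<Theta> w (enum_act \<Theta> i) (enum_act \<Theta> j))"
  shows "runs (build tr) s (80 * k\<^sup>2 + 2) (\<lambda>s'. \<forall>a<k. row_done tr k st a k s')"
  unfolding build_def
proof (rule runs_Seq)
  define body where "body = Seq (row_init tr) (Seq (build_row tr) (Add 20 20 4))"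
  have wr: "wregs body \<inter> {0, 4, 5, 6} = {}" "wmems body \<inter> {1, 2, 3, 6, 8, 9} = {}"
    by (auto simp: body_def build_defs)
  have kpos: "k \<ge> 1"
    using \<Theta> by (simp add: k comtrace_alphabet_def card_gt_0_iff Suc_leI)
  show "runs (Const 20 0) s 1 (\<lambda>s'. reg s' 20 = 0)" by (rule runs_straight) auto
  fix s0 assume s0: "reg s0 20 = 0" and f0: "frame (Const 20 0) s s0"
  have rep0: "represents \<Theta> w s0" by (rule represents_frame[OF rep f0]) simp_all
  have "runs (WhileLess 20 0 body) s0 (80 * k\<^sup>2 + 1)
      (\<lambda>s'. (\<forall>a<k. row_done tr k st a k s') \<and> reg s' 20 = k)"
  proof (rule runs_for[where c = "60 * k + 10" and n = k and I = "\<lambda>i s'. \<forall>a<i. row_done tr k st a k s'"])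
    fix i s1 assume i: "i < k" and f1: "frame body s0 s1" and s1: "reg s1 20 = i"
      "\<forall>a<i. row_done tr k st a k s1"
    have rep1: "represents \<Theta> w s1" by (rule represents_frame[OF rep0 f1 wr])
    then have r1: "ready k s1" by (simp add: represents_def k Let_def)
    show "runs body s1 (60 * k + 10)
        (\<lambda>s'. (\<forall>a<Suc i. row_done tr k st a k s') \<and> reg s' 20 = Suc i)"
      unfolding body_def
    proof (rule runs_Seq)
      have cell: "reg (sem (edge_cell tr 37 20 0) s') = (reg s')(37 := edge_index tr k i k)"
        "mem (sem (edge_cell tr 37 20 0) s') = mem s'" if "ready k s'" "reg s' 20 = i" for s'
        using that i by (auto simp: edge_cell_def ready_def edge_index_def)
      have "ready k (s1\<lparr>reg := (reg s1)(21 := 0)\<rparr>)" using r1 by (simp add: ready_def)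
      note cell = cell[OF this]
      have "edge_index tr k a b \<noteq> edge_index tr k i k" if "a < i" "b \<le> k" for a b
        using that i by (auto simp: edge_index_eq_iff)
      then show "runs (row_init tr) s1 6 (\<lambda>s'. reg s' 20 = i \<and> reg s' 21 = 0 \<and>
          reg s' 37 = edge_index tr k i k \<and> row_done tr k st i 0 s' \<and> (\<forall>a<i. row_done tr k st a k s'))"
        using s1 r1
        by (intro runs_straight) (simp add: build_defs, simp add: build_defs,
          simp add: row_init_def cell row_done_def ready_def)
      fix s2 assume s2: "reg s2 20 = i \<and> reg s2 21 = 0 \<and>
          reg s2 37 = edge_index tr k i k \<and> row_done tr k st i 0 s2 \<and> (\<forall>a<i. row_done tr k st a k s2)"
        and f2: "frame (row_init tr) s1 s2"
      have rep2: "represents \<Theta> w s2"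
        by (rule represents_frame[OF rep1 f2]) (auto simp: build_defs)
      show "runs (Seq (build_row tr) (Add 20 20 4)) s2 (60 * k + 1 + 1)
          (\<lambda>s'. (\<forall>a<Suc i. row_done tr k st a k s') \<and> reg s' 20 = Suc i)"
      proof (rule runs_Seq[OF runs_build_row[OF \<Theta> w rep2 _ i _ _ k st]])
        fix s3 assume s3: "\<forall>a\<le>i. row_done tr k st a k s3" and f3: "frame (build_row tr) s2 s3"
        have rep3: "represents \<Theta> w s3"
          by (rule represents_frame[OF rep2 f3]) (auto simp: build_defs)
        have "reg s3 20 = i" using f3 s2 by (auto simp: frame_def build_defs)
        then show "runs (Add 20 20 4) s3 1
          (\<lambda>s'. (\<forall>a<Suc i. row_done tr k st a k s') \<and> reg s' 20 = Suc i)"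
          using rep3 s3 by (intro runs_straight)
            (auto simp: represents_def Let_def ready_def row_done_def less_Suc_eq_le)
      qed (use s2 in auto)
    qed simp
  next
    have "k * (60 * k + 10 + 1) \<le> 80 * k\<^sup>2"
      using kpos by (simp add: power2_eq_square algebra_simps)
    then show "k * (60 * k + 10 + 1) + 1 \<le> 80 * k\<^sup>2 + 1" by simp
    show "0 \<notin> wregs body" using wr by auto
  qed (use rep0 s0 in \<open>auto simp: represents_def ready_def Let_def k\<close>)
  then show "runs (WhileLess 20 0 (Seq (row_init tr) (Seq (build_row tr) (Add 20 20 4)))) s0 (80 * k\<^sup>2 + 1)
      (\<lambda>s'. \<forall>a<k. row_done tr k st a k s')"
    unfolding body_def by (rule runs_conseq) auto
qed simp

text \<open>
  The extra vertex \<open>k\<close> stands for being blocked, so that the admissible steps become the nonempty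
  sets of vertices below \<open>k\<close> that no edge leaves.  Nothing is said about edges leaving \<open>k\<close>,
  which are never relevant.
\<close>

definition step_graph :: "'a::linorder comtrace_alphabet \<Rightarrow> 'a set list \<Rightarrow> nat rel \<Rightarrow> bool" where
  "step_graph \<Theta> w E \<longleftrightarrow> (let k = card (acts \<Theta>);
     st = (\<lambda>i j. relation_code \<Theta> w (enum_act \<Theta> i) (enum_act \<Theta> j)) in
     E \<subseteq> {..k} \<times> {..k} \<and>
     (\<forall>a<k. (\<forall>b<k. (a, b) \<in> E \<longleftrightarrow> st a b = 1) \<and> ((a, k) \<in> E \<longleftrightarrow> (\<exists>b<k. st a b = 2))))"

section \<open>Admissible steps as vertex sets without outgoing edges\<close>

lemma step_graph_edges:
  assumes "\<forall>a<k. row_done tr k st a k s" "k = card (acts \<Theta>)"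
    "st = (\<lambda>i j. relation_code \<Theta> w (enum_act \<Theta> i) (enum_act \<Theta> j))"
  shows "step_graph \<Theta> w (if tr then (edges k s)\<inverse> else edges k s)"
proof -
  define E where "E = (if tr then (edges k s)\<inverse> else edges k s)"
  have E: "(a, b) \<in> E \<longleftrightarrow> 0 < mem s 10 (edge_index tr k a b)" if "a \<le> k" "b \<le> k" for a b
    using that by (auto simp: E_def edges_def edge_index_def)
  have rows: "mem s 10 (edge_index tr k a b) = (if st a b = 1 then 1 else 0)"
    "mem s 10 (edge_index tr k a k) = (if \<exists>b<k. st a b = 2 then 1 else 0)" if "a < k" "b < k" for a b
    using assms(1) that unfolding row_done_def by blast+
  have "E \<subseteq> {..k} \<times> {..k}" by (auto simp: E_def edges_def)
  moreover have "(a, b) \<in> E \<longleftrightarrow> st a b = 1" "(a, k) \<in> E \<longleftrightarrow> (\<exists>b<k. st a b = 2)" if "a < k" "b < k" for a b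
    using that by (simp_all only: E rows order_refl less_imp_le split: if_splits) auto
  ultimately show ?thesis
    unfolding step_graph_def Let_def assms(2,3)[symmetric] E_def[symmetric] by blast
qed

text \<open>Since \<open>V\<close> lies below \<open>k\<close>, an edge to the vertex
  \<open>k\<close> leaves \<open>V\<close>; the single inclusion thus expresses both that needed
  actions are present and that no member is blocked.\<close>

lemma closed_enum_act:
  assumes \<Theta>: "comtrace_alphabet \<Theta>" and E: "step_graph \<Theta> w E" and V: "V \<subseteq> {..<card (acts \<Theta>)}"
  shows "closed \<Theta> w (enum_act \<Theta> ` V) \<longleftrightarrow> E `` V \<subseteq> V"
proof -
  define k st where "k = card (acts \<Theta>)"
    and "st = (\<lambda>i j. relation_code \<Theta> w (enum_act \<Theta> i) (enum_act \<Theta> j))"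
  have fin: "finite (acts \<Theta>)" using \<Theta> by (simp add: comtrace_alphabet_def)
  note acts = enum_act_image[OF fin, folded k_def]
  have V: "V \<subseteq> {..<k}" using V by (simp add: k_def)
  have mem: "enum_act \<Theta> b \<in> enum_act \<Theta> ` V \<longleftrightarrow> b \<in> V" if "b < k" for b
    using that V enum_act_eq_iff[of _ \<Theta> b] by (force simp: k_def)
  have E: "E \<subseteq> {..k} \<times> {..k}" "\<And>a b. a < k \<Longrightarrow> b < k \<Longrightarrow> (a, b) \<in> E \<longleftrightarrow> st a b = 1"
    "\<And>a. a < k \<Longrightarrow> (a, k) \<in> E \<longleftrightarrow> (\<exists>b<k. st a b = 2)"
    using E by (auto simp: step_graph_def Let_def k_def st_def)
  have st: "((enum_act \<Theta> a, enum_act \<Theta> b) \<notin> ind \<Theta> \<longrightarrow> free \<Theta> w (enum_act \<Theta> a) (enum_act \<Theta> b) \<or>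
      needs \<Theta> w (enum_act \<Theta> a) (enum_act \<Theta> b) \<and> b \<in> V) \<longleftrightarrow> st a b = 0 \<or> st a b = 1 \<and> b \<in> V" for a b
    by (auto simp: st_def relation_code_def)
  have "closed \<Theta> w (enum_act \<Theta> ` V) \<longleftrightarrow> (\<forall>a\<in>V. \<forall>b<k. st a b = 0 \<or> st a b = 1 \<and> b \<in> V)"
    unfolding closed_def acts[symmetric] st[symmetric] using V mem by auto
  also have "\<dots> \<longleftrightarrow> (\<forall>a\<in>V. (a, k) \<notin> E \<and> (\<forall>b<k. (a, b) \<in> E \<longrightarrow> b \<in> V))"
  proof -
    have "st a b = 0 \<or> st a b = 1 \<or> st a b = 2" for a b by (simp add: st_def relation_code_def)
    then show ?thesis using E(2,3) V
      by (metis lessThan_iff subsetD zero_neq_one one_eq_numeral_iff zero_neq_numeral num.distinct(1))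
  qed
  also have "\<dots> \<longleftrightarrow> E `` V \<subseteq> V"
  proof
    assume *: "\<forall>a\<in>V. (a, k) \<notin> E \<and> (\<forall>b<k. (a, b) \<in> E \<longrightarrow> b \<in> V)"
    have "b \<in> V" if "a \<in> V" "(a, b) \<in> E" for a b
    proof -
      have "b \<le> k" "b \<noteq> k" using E(1) that * by auto
      then show ?thesis using * that by auto
    qed
    then show "E `` V \<subseteq> V" by auto
  qed (use V in auto)
  finally show ?thesis .
qed

lemma adm_enum_act:
  assumes \<Theta>: "comtrace_alphabet \<Theta>" and w: "w \<in> step_seqs \<Theta>" and E: "step_graph \<Theta> w E"
  shows "adm \<Theta> w A \<longleftrightarrow> (\<exists>V. A = enum_act \<Theta> ` V \<and> V \<subseteq> {..<card (acts \<Theta>)} \<and> V \<noteq> {} \<and> E `` V \<subseteq> V)"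
proof
  assume "adm \<Theta> w A"
  then have A: "closed \<Theta> w A" "A \<noteq> {}" using adm_iff_closed[OF \<Theta> w] by auto
  have fin: "finite (acts \<Theta>)" using \<Theta> by (simp add: comtrace_alphabet_def)
  have "A \<subseteq> enum_act \<Theta> ` {..<card (acts \<Theta>)}" using A enum_act_image[OF fin] by (simp add: closed_def)
  then obtain V where "V \<subseteq> {..<card (acts \<Theta>)}" "A = enum_act \<Theta> ` V" by (meson subset_imageE)
  then show "\<exists>V. A = enum_act \<Theta> ` V \<and> V \<subseteq> {..<card (acts \<Theta>)} \<and> V \<noteq> {} \<and> E `` V \<subseteq> V"
    using A closed_enum_act[OF \<Theta> E, of V] by (intro exI[of _ V]) simp
next
  assume "\<exists>V. A = enum_act \<Theta> ` V \<and> V \<subseteq> {..<card (acts \<Theta>)} \<and> V \<noteq> {} \<and> E `` V \<subseteq> V"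
  then obtain V where "A = enum_act \<Theta> ` V" "V \<subseteq> {..<card (acts \<Theta>)}" "V \<noteq> {}" "E `` V \<subseteq> V" by blast
  then show "adm \<Theta> w A" using closed_enum_act[OF \<Theta> E, of V] by (simp add: adm_iff_closed[OF \<Theta> w])
qed

text \<open>The head of the sequence is itself an admissible step, so the selection of a step cannot
  come back empty-handed.\<close>

lemma step_graph_adm_exists:
  assumes "comtrace_alphabet \<Theta>" "w \<in> step_seqs \<Theta>" "w \<noteq> []" "step_graph \<Theta> w E"
  obtains V where "V \<subseteq> {..<card (acts \<Theta>)}" "V \<noteq> {}" "E `` V \<subseteq> V"
proof -
  obtain A v where "w = A # v" using assms(3) by (cases w) auto
  then have "adm \<Theta> w A" using assms(2) adm_hd[of A v \<Theta>] by simp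
  then show thesis unfolding adm_enum_act[OF assms(1,2,4)] by (elim exE conjE) (rule that)
qed

text \<open>Here \<open>E\<close> is the transposed graph. A set \<open>V\<close> below
  \<open>k\<close> has no outgoing edge exactly if its complement is closed under \<open>E\<close>;
  that complement contains \<open>k\<close>, hence everything \<open>E\<close> reaches from
  \<open>k\<close>. So the unreached vertices form the largest candidate.\<close>

lemma best_step_foata:
  assumes \<Theta>: "comtrace_alphabet \<Theta>" and w: "w \<in> step_seqs \<Theta>" "w \<noteq> []"
    and E: "step_graph \<Theta> w (E\<inverse>)" and k: "k = card (acts \<Theta>)"
  shows "best_step (\<supseteq>) \<Theta> w (enum_act \<Theta> ` ({..<k} - E\<^sup>* `` {k}))"
proof -
  define R where "R = E\<^sup>* `` {k}"
  have bnd: "E \<subseteq> {..k} \<times> {..k}" using E by (auto simp: step_graph_def Let_def k)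
  have kR: "k \<in> R" by (simp add: R_def)
  have "E\<inverse> `` ({..<k} - R) \<subseteq> {..<k} - R"
  proof clarify
    fix a b assume "a < k" "a \<notin> R" "(b, a) \<in> E"
    then have "b \<notin> R" by (auto simp: R_def intro: rtrancl_into_rtrancl)
    moreover have "b \<le> k" using bnd \<open>(b, a) \<in> E\<close> by auto
    ultimately show "b \<in> {..<k} - R" using kR by (cases "b = k") auto
  qed
  moreover have max: "V \<subseteq> {..<k} - R" if "V \<subseteq> {..<k}" "E\<inverse> `` V \<subseteq> V" for V
  proof -
    have "R \<subseteq> - V" unfolding R_def using that by (intro Image_rtrancl_subset) auto
    then show ?thesis using that by auto
  qed
  moreover have "{..<k} - R \<noteq> {}"
    using max by (auto intro: step_graph_adm_exists[OF \<Theta> w E, folded k])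
  ultimately show ?thesis
    unfolding best_step_def adm_enum_act[OF \<Theta> w(1) E, folded k] R_def[symmetric]
    by (auto intro!: exI[of _ "{..<k} - R"] imageI)
qed

text \<open>The bound \<open>i\<close> turns optimality into an invariant of a scan through the
  vertices in increasing order; \<open>i = k\<close> gives the global optimum.\<close>

definition min_reach :: "nat \<Rightarrow> nat rel \<Rightarrow> nat \<Rightarrow> nat \<Rightarrow> bool" where
  "min_reach k E i x \<longleftrightarrow> x < i \<and> k \<notin> E\<^sup>* `` {x} \<and>
     (\<forall>y<i. k \<notin> E\<^sup>* `` {y} \<longrightarrow> card (E\<^sup>* `` {x}) < card (E\<^sup>* `` {y}) \<or>
        card (E\<^sup>* `` {x}) = card (E\<^sup>* `` {y}) \<and> x \<le> y)"

text \<open>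
  Two smallest admissible steps are equal or disjoint, because each is the set of vertices reachable
  from any of its elements; hence ties are decided by the smallest element.
\<close>

lemma best_step_lex:
  assumes \<Theta>: "comtrace_alphabet \<Theta>" and w: "w \<in> step_seqs \<Theta>"
    and E: "step_graph \<Theta> w E" and k: "k = card (acts \<Theta>)" and x: "min_reach k E k x"
  shows "best_step step_le \<Theta> w (enum_act \<Theta> ` (E\<^sup>* `` {x}))"
  unfolding best_step_def
proof (intro conjI allI impI)
  define R where "R = (\<lambda>x. E\<^sup>* `` {x})"
  have Rx_eq: "R x = E\<^sup>* `` {x}" by (simp add: R_def)
  have bnd: "E \<subseteq> {..k} \<times> {..k}" using E by (auto simp: step_graph_def Let_def k)
  have Rx: "x < k" "k \<notin> R x"
    and min: "\<And>y. y < k \<Longrightarrow> k \<notin> R y \<Longrightarrow> card (R x) < card (R y) \<or> card (R x) = card (R y) \<and> x \<le> y"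
    using x by (auto simp: min_reach_def R_def)
  have closedR: "E `` R y \<subseteq> R y" for y by (auto simp: R_def intro: rtrancl_into_rtrancl)
  have subR: "R y \<subseteq> V" if "y \<in> V" "E `` V \<subseteq> V" for y V
    unfolding R_def using that by (rule Image_rtrancl_subset)
  have selfR: "y \<in> R y" for y by (simp add: R_def)
  have RxV: "R x \<subseteq> {..<k}"
  proof -
    have "R x \<subseteq> {..k}" using bnd Rx by (intro subR) auto
    then show ?thesis using Rx(2) by (auto simp: le_less)
  qed
  then show "adm \<Theta> w (enum_act \<Theta> ` (E\<^sup>* `` {x}))"
    unfolding adm_enum_act[OF \<Theta> w E, folded k] Rx_eq[symmetric]
    using closedR[of x] selfR[of x] by (intro exI[of _ "R x"]) auto
  fix B assume "adm \<Theta> w B"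
  then obtain V where B: "B = enum_act \<Theta> ` V" and V: "V \<subseteq> {..<k}" "V \<noteq> {}" "E `` V \<subseteq> V"
    unfolding adm_enum_act[OF \<Theta> w E, folded k] by (elim exE conjE)
  have fin: "finite V" "finite (R x)" using V(1) RxV by (auto intro: finite_subset)
  have inj: "inj_on (enum_act \<Theta>) {..<k}" using inj_on_enum_act by (simp add: k)
  have card: "card (enum_act \<Theta> ` V) = card V" "card (enum_act \<Theta> ` R x) = card (R x)"
    using V(1) RxV inj by (auto intro!: card_image inj_on_subset[OF inj])
  have RV: "R y \<subseteq> V" "k \<notin> R y" "y < k" "card (R x) \<le> card (R y)" if "y \<in> V" for y
  proof -
    show "R y \<subseteq> V" using that V(3) by (rule subR)
    then show "k \<notin> R y" using V by auto
    show "y < k" using that V by auto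
    then show "card (R x) \<le> card (R y)" using min[of y] \<open>k \<notin> R y\<close> by auto
  qed
  obtain y0 where y0: "y0 \<in> V" using V by blast
  have le: "card (R x) \<le> card V"
    using RV[OF y0] card_mono[OF fin(1)] by (meson order_trans)
  have RR: "R y = R x" if "y \<in> R x" for y
  proof -
    have sub: "R y \<subseteq> R x" using that closedR by (rule subR)
    moreover have "card (R x) \<le> card (R y)" using min[of y] that RxV sub Rx(2) by fastforce
    ultimately show ?thesis using fin(2) by (simp add: card_seteq)
  qed
  show "step_le (enum_act \<Theta> ` (E\<^sup>* `` {x})) B"
  \<comment> \<open>A smaller size or equal sets settle the order at once; only distinct sets of
    equal size need the comparison of minima.\<close>
  proof (cases "card (R x) = card V \<and> R x \<noteq> V")
    case True
    have RVeq: "R y = V" if "y \<in> V" for y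
      using RV[OF that] True fin by (simp add: card_seteq)
    then have disj: "R x \<inter> V = {}" using RR True by blast
    then have "enum_act \<Theta> ` R x \<inter> enum_act \<Theta> ` V = {}"
      using inj V(1) RxV by (simp add: inj_on_image_Int[symmetric])
    then have diff: "enum_act \<Theta> ` R x - enum_act \<Theta> ` V = enum_act \<Theta> ` R x"
      "enum_act \<Theta> ` V - enum_act \<Theta> ` R x = enum_act \<Theta> ` V" by auto
    \<comment> \<open>The vertex \<open>x\<close> belongs to \<open>R x\<close>, and no vertex of
      \<open>V\<close> is smaller: each of them reaches a set of the same size, and
      \<open>min_reach\<close> prefers the least such vertex.\<close>
    have "Min (enum_act \<Theta> ` R x) \<le> enum_act \<Theta> x"
      using fin selfR by simp
    also have "\<dots> \<le> Min (enum_act \<Theta> ` V)"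
    proof (rule Min.boundedI)
      fix b assume "b \<in> enum_act \<Theta> ` V"
      then obtain y where y: "y \<in> V" "b = enum_act \<Theta> y" by blast
      have "x \<le> y" using min[of y] RV[OF y(1)] RVeq[OF y(1)] True by auto
      then show "enum_act \<Theta> x \<le> b"
        using enum_act_strict_mono[of y \<Theta> x] RV[OF y(1)] y(2) k by (cases "x = y") auto
    qed (use fin V in auto)
    finally show ?thesis
      unfolding step_le_def B Rx_eq[symmetric] diff using card True by auto
  next
    case False
    then show ?thesis using le unfolding step_le_def B Rx_eq[symmetric] card by auto
  qed
qed

section \<open>Selection of a step\<close>

definition marked :: "nat \<Rightarrow> nat set \<Rightarrow> ram_state \<Rightarrow> bool" where
  "marked k V s \<longleftrightarrow> (\<forall>v<k. mem s 7 v = (if v \<in> V then 1 else 0))"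

text \<open>With \<open>neg\<close> the marks are complemented, because the Foata step consists of
  the vertices that the search has not reached.\<close>

definition copy_marks :: "bool \<Rightarrow> com" where
  "copy_marks neg = Seq (Const 54 0) (WhileLess 54 0
     (block [Load 55 11 54, if neg then Sub 55 4 55 else Skip, Store 7 54 55, Add 54 54 4]))"

lemma runs_copy_marks:
  assumes r: "ready k s" and m: "\<forall>v\<le>k. mem s 11 v = (if v \<in> R then 1 else 0)"
  shows "runs (copy_marks neg) s (6 * k + 2) (marked k {v. v \<in> R \<longleftrightarrow> \<not> neg})"
  unfolding copy_marks_def
proof (rule runs_Seq)
  define body where "body = block [Load 55 11 54, if neg then Sub 55 4 55 else Skip, Store 7 54 55, Add 54 54 4]"
  show "runs (Const 54 0) s 1 (\<lambda>s'. reg s' 54 = 0)" by (rule runs_straight) auto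
  fix s1 assume s1: "reg s1 54 = 0" and f1: "frame (Const 54 0) s s1"
  have r1: "ready k s1" by (rule ready_frame[OF r f1]) auto
  have m1: "mem s1 11 = mem s 11" using f1 by (simp add: frame_def)
  have "runs (WhileLess 54 0 body) s1 (6 * k + 1)
      (\<lambda>s'. marked k {v. v \<in> R \<longleftrightarrow> \<not> neg} s' \<and> reg s' 54 = k)"
  proof (rule runs_for[where c = 5 and n = k and I = "\<lambda>i. marked i {v. v \<in> R \<longleftrightarrow> \<not> neg}"])
    fix i s2 assume i: "i < k" and f2: "frame body s1 s2" and s2: "reg s2 54 = i" "marked i {v. v \<in> R \<longleftrightarrow> \<not> neg} s2"
    have r2: "ready k s2" by (rule ready_frame[OF r1 f2]) (auto simp: body_def)
    have "mem s2 11 i = (if i \<in> R then 1 else 0)"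
      using f2 m1 m i by (simp add: frame_def body_def)
    then show "runs body s2 5 (\<lambda>s'. marked (Suc i) {v. v \<in> R \<longleftrightarrow> \<not> neg} s' \<and> reg s' 54 = Suc i)"
      using r2 s2 by (intro runs_straight) (auto simp: body_def ready_def marked_def less_Suc_eq)
  qed (use r1 s1 in \<open>auto simp: ready_def marked_def body_def\<close>)
  then show "runs (WhileLess 54 0 (block [Load 55 11 54, if neg then Sub 55 4 55 else Skip, Store 7 54 55, Add 54 54 4]))
     s1 (6 * k + 1) (marked k {v. v \<in> R \<longleftrightarrow> \<not> neg})"
    unfolding body_def by (rule runs_conseq) auto
qed simp

definition selected ::
  "('a set \<Rightarrow> 'a set \<Rightarrow> bool) \<Rightarrow> 'a::linorder comtrace_alphabet \<Rightarrow> 'a set list \<Rightarrow> nat set \<Rightarrow> bool" where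
  "selected R \<Theta> w V \<longleftrightarrow> V \<subseteq> {..<card (acts \<Theta>)} \<and> best_step R \<Theta> w (enum_act \<Theta> ` V)"

text \<open>The limit k + 1 is the number of vertices, so this search never gives up.\<close>

definition select_foata :: com where
  "select_foata = Seq (build True) (Seq (Seq (Add 40 0 6) (Add 41 5 6)) (Seq search (copy_marks True)))"

lemma card_acts_pos: "comtrace_alphabet \<Theta> \<Longrightarrow> 1 \<le> card (acts \<Theta>)"
  by (simp add: comtrace_alphabet_def card_gt_0_iff Suc_leI)

lemma runs_select_foata:
  assumes \<Theta>: "comtrace_alphabet \<Theta>" and w: "w \<in> step_seqs \<Theta>" "w \<noteq> []" and rep: "represents \<Theta> w s"
    and k: "k = card (acts \<Theta>)"
  shows "\<exists>V. selected (\<supseteq>) \<Theta> w V \<and> runs select_foata s (2000 * (card V * k\<^sup>2)) (marked k V)"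
proof -
  define st where "st = (\<lambda>i j. relation_code \<Theta> w (enum_act \<Theta> i) (enum_act \<Theta> j))"
  have kpos: "1 \<le> k" using card_acts_pos[OF \<Theta>] k by simp
  \<comment> \<open>The set depends on the graph built during the run, so it is first existential in
    the postcondition and then taken from the run itself. As it is nonempty, the bound can
    afterwards be weakened to the form shared with \<open>select_lex\<close>.\<close>
  have "runs select_foata s (400 * k\<^sup>2) (\<lambda>s'. \<exists>V. selected (\<supseteq>) \<Theta> w V \<and> marked k V s')"
    unfolding select_foata_def
  proof (rule runs_Seq[OF runs_build[OF \<Theta> w(1) rep k st_def]])
    fix s1 assume s1: "\<forall>a<k. row_done True k st a k s1" and f1: "frame (build True) s s1"
    have rep1: "represents \<Theta> w s1" by (rule represents_frame[OF rep f1]) (auto simp: build_defs)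
    then have r1: "ready k s1" by (simp add: represents_def k Let_def)
    have graph: "step_graph \<Theta> w ((edges k s1)\<inverse>)"
      using step_graph_edges[OF s1 k st_def] by simp
    define R where "R = (edges k s1)\<^sup>* `` {k}"
    have sel: "selected (\<supseteq>) \<Theta> w ({..<k} - R)"
      using best_step_foata[OF \<Theta> w graph k] by (auto simp: selected_def R_def k)
    show "runs (Seq (Seq (Add 40 0 6) (Add 41 5 6)) (Seq search (copy_marks True))) s1
        (2 + (50 * (Suc k * Suc (Suc k)) + (6 * k + 2))) (\<lambda>s'. \<exists>V. selected (\<supseteq>) \<Theta> w V \<and> marked k V s')"
    proof (rule runs_Seq)
      show "runs (Seq (Add 40 0 6) (Add 41 5 6)) s1 2 (\<lambda>s'. reg s' 40 = k \<and> reg s' 41 = Suc k)"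
        using r1 by (intro runs_straight) (auto simp: ready_def)
      fix s2 assume s2: "reg s2 40 = k \<and> reg s2 41 = Suc k" and f2: "frame (Seq (Add 40 0 6) (Add 41 5 6)) s1 s2"
      have r2: "ready k s2" by (rule ready_frame[OF r1 f2]) auto
      have e2: "edges k s2 = edges k s1" using f2 by (simp add: frame_def edges_def)
      have Rk: "R \<subseteq> {..k}" unfolding R_def by (rule reachable_bounded) simp
      then have cR: "card R \<le> Suc k" using card_mono[OF _ Rk] by simp
      show "runs (Seq search (copy_marks True)) s2 (50 * (Suc k * Suc (Suc k)) + (6 * k + 2))
          (\<lambda>s'. \<exists>V. selected (\<supseteq>) \<Theta> w V \<and> marked k V s')"
      proof (rule runs_Seq[OF runs_search[OF r2]])
        show "reg s2 40 = k" "reg s2 41 = Suc k" using s2 by auto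
        fix s3 assume "(reg s3 44 \<le> Suc k \<longleftrightarrow> card ((edges k s2)\<^sup>* `` {k}) \<le> Suc k) \<and>
          (card ((edges k s2)\<^sup>* `` {k}) \<le> Suc k \<longrightarrow> reg s3 44 = card ((edges k s2)\<^sup>* `` {k}) \<and>
           (\<forall>v\<le>k. mem s3 11 v = (if v \<in> (edges k s2)\<^sup>* `` {k} then 1 else 0)))" and f3: "frame search s2 s3"
        then have m3: "\<forall>v\<le>k. mem s3 11 v = (if v \<in> R then 1 else 0)"
          using cR unfolding e2 R_def[symmetric] by blast
        have r3: "ready k s3" by (rule ready_frame[OF r2 f3]) (auto simp: search_defs)
        show "runs (copy_marks True) s3 (6 * k + 2) (\<lambda>s'. \<exists>V. selected (\<supseteq>) \<Theta> w V \<and> marked k V s')"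
          by (rule runs_conseq[OF runs_copy_marks[OF r3 m3] order_refl])
            (use sel in \<open>auto simp: marked_def intro!: exI[of _ "{..<k} - R"]\<close>)
      qed simp_all
    qed simp
  next
    have "Suc k * Suc (Suc k) \<le> 6 * k\<^sup>2" "k \<le> k\<^sup>2" "1 \<le> k\<^sup>2"
    proof -
      obtain j where "k = Suc j" using kpos by (cases k) auto
      then show "Suc k * Suc (Suc k) \<le> 6 * k\<^sup>2" "k \<le> k\<^sup>2" "1 \<le> k\<^sup>2"
        by (simp_all add: power2_eq_square algebra_simps)
    qed
    then show "80 * k\<^sup>2 + 2 + (2 + (50 * (Suc k * Suc (Suc k)) + (6 * k + 2))) \<le> 400 * k\<^sup>2" by linarith
  qed
  then obtain t s' V where *: "exec select_foata s t s'" "t \<le> 400 * k\<^sup>2" "selected (\<supseteq>) \<Theta> w V" "marked k V s'"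
    unfolding runs_def by blast
  have "finite V" using *(3) by (auto simp: selected_def intro: finite_subset)
  moreover have "V \<noteq> {}" using *(3) by (auto simp: selected_def best_step_def adm_def is_step_def)
  ultimately have "1 \<le> card V" by (simp add: card_gt_0_iff Suc_leI)
  then have "400 * k\<^sup>2 \<le> 2000 * (card V * k\<^sup>2)" by (cases "card V") auto
  then show ?thesis using * unfolding runs_def by (meson order_trans)
qed

section \<open>Smallest reachable set by bounded searches with a doubled limit\<close>

definition lex_update :: com where
  "lex_update = Seq (block [Const 52 1, Sub 41 44 4]) (copy_marks False)"

definition lex_try :: com where
  "lex_try = Seq search (IfLess 41 44 Skip (Seq (Load 53 11 0) (IfLess 6 53 Skip lex_update)))"

text \<open>
  A pass with limit \<open>L\<close> costs \<open>O(L k\<^sup>2)\<close>, and \<open>L\<close> is doubled until a step is found.  The cost is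
  therefore \<open>O(m k\<^sup>2)\<close> for a step with \<open>m\<close> actions, which sums up to \<open>O(n k\<^sup>2)\<close>.
\<close>

definition lex_pass :: com where
  "lex_pass = Seq (block [Add 41 51 6, Const 40 0])
     (Seq (WhileLess 40 0 (Seq lex_try (Add 40 40 4))) (Add 51 51 51))"

definition select_lex :: com where
  "select_lex = Seq (build False) (Seq (block [Const 51 1, Const 52 0]) (WhileLess 52 4 lex_pass))"

lemmas lex_defs = lex_update_def lex_try_def lex_pass_def select_lex_def copy_marks_def search_defs

text \<open>Register 52 tells whether a candidate is known. After a success the limit drops to one
  less than its size, so only strictly smaller sets replace it and ties stay with the earlier
  vertex.\<close>

definition lex_inv :: "nat \<Rightarrow> nat rel \<Rightarrow> nat \<Rightarrow> nat \<Rightarrow> ram_state \<Rightarrow> bool" where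
  "lex_inv k E L i s \<longleftrightarrow>
     reg s 52 = 0 \<and> reg s 41 = L \<and> (\<forall>y<i. k \<notin> E\<^sup>* `` {y} \<longrightarrow> L < card (E\<^sup>* `` {y})) \<or>
     reg s 52 = 1 \<and> (\<exists>x. min_reach k E i x \<and> card (E\<^sup>* `` {x}) \<le> L \<and>
        reg s 41 = card (E\<^sup>* `` {x}) - 1 \<and> marked k (E\<^sup>* `` {x}) s)"

lemma runs_lex_try:
  assumes r: "ready k s" and E: "edges k s = E" and i: "reg s 40 = i" "i < k" and inv: "lex_inv k E L i s"
  shows "runs lex_try s (50 * (Suc k * Suc L) + 6 * k + 20) (lex_inv k E L (Suc i))"
proof -
  define R where "R = (\<lambda>x. E\<^sup>* `` {x})"
  define lim where "lim = reg s 41"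
  have finR: "finite (R x)" if "x \<le> k" for x
    using reachable_bounded[OF that, of s] by (auto simp: R_def E intro: finite_subset)
  have posR: "0 < card (R x)" if "x \<le> k" for x
    using finR[OF that] by (auto simp: card_gt_0_iff R_def)
  have limL: "lim \<le> L" using inv by (auto simp: lex_inv_def lim_def)
  \<comment> \<open>A blocked vertex or one that reaches too much changes nothing. If a candidate
    \<open>x\<close> is known, exceeding the limit \<open>card (R x) - 1\<close> means that
    \<open>R i\<close> is at least as large as \<open>R x\<close>, and \<open>x < i\<close> decides
    a tie.\<close>
  have keep: "lex_inv k E L (Suc i) s'" if "frame P s s'" "{41, 52} \<inter> wregs P = {}" "7 \<notin> wmems P"
    "k \<in> R i \<or> lim < card (R i)" for P s'
  proof -
    have eq: "reg s' 41 = reg s 41" "reg s' 52 = reg s 52" "mem s' 7 = mem s 7"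
      using that(1-3) by (auto simp: frame_def)
    show ?thesis using inv unfolding lex_inv_def
    proof (elim disjE conjE exE)
      assume *: "reg s 52 = 0" "reg s 41 = L" "\<forall>y<i. k \<notin> E\<^sup>* `` {y} \<longrightarrow> L < card (E\<^sup>* `` {y})"
      then show "reg s' 52 = 0 \<and> reg s' 41 = L \<and> (\<forall>y<Suc i. k \<notin> E\<^sup>* `` {y} \<longrightarrow> L < card (E\<^sup>* `` {y})) \<or>
         reg s' 52 = 1 \<and> (\<exists>x. min_reach k E (Suc i) x \<and> card (E\<^sup>* `` {x}) \<le> L \<and>
         reg s' 41 = card (E\<^sup>* `` {x}) - 1 \<and> marked k (E\<^sup>* `` {x}) s')"
        using that(4) eq unfolding lim_def R_def less_Suc_eq by auto
    next
      fix x assume *: "reg s 52 = 1" "min_reach k E i x" "card (E\<^sup>* `` {x}) \<le> L"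
        "reg s 41 = card (E\<^sup>* `` {x}) - 1" "marked k (E\<^sup>* `` {x}) s"
      then have x: "x < i" "k \<in> R i \<or> card (R x) \<le> card (R i)"
        using that(4) unfolding lim_def R_def min_reach_def by auto
      then have "min_reach k E (Suc i) x"
        using *(2) unfolding min_reach_def R_def less_Suc_eq by (auto simp: le_less)
      then show "reg s' 52 = 0 \<and> reg s' 41 = L \<and> (\<forall>y<Suc i. k \<notin> E\<^sup>* `` {y} \<longrightarrow> L < card (E\<^sup>* `` {y})) \<or>
         reg s' 52 = 1 \<and> (\<exists>x. min_reach k E (Suc i) x \<and> card (E\<^sup>* `` {x}) \<le> L \<and>
         reg s' 41 = card (E\<^sup>* `` {x}) - 1 \<and> marked k (E\<^sup>* `` {x}) s')"
        using * eq by (auto simp: marked_def)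
    qed
  qed
  show ?thesis unfolding lex_try_def
  proof (rule runs_Seq[OF runs_search[OF r i(1) _ lim_def[symmetric]]])
    show "i \<le> k" using i by simp
    fix s1 assume "(reg s1 44 \<le> lim \<longleftrightarrow> card ((edges k s)\<^sup>* `` {i}) \<le> lim) \<and>
       (card ((edges k s)\<^sup>* `` {i}) \<le> lim \<longrightarrow> reg s1 44 = card ((edges k s)\<^sup>* `` {i}) \<and>
         (\<forall>v\<le>k. mem s1 11 v = (if v \<in> (edges k s)\<^sup>* `` {i} then 1 else 0)))" and f1: "frame search s s1"
    then have s1: "reg s1 44 \<le> lim \<longleftrightarrow> card (R i) \<le> lim"
      "card (R i) \<le> lim \<Longrightarrow> reg s1 44 = card (R i) \<and> (\<forall>v\<le>k. mem s1 11 v = (if v \<in> R i then 1 else 0))"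
      unfolding E R_def by blast+
    have r1: "ready k s1" by (rule ready_frame[OF r f1]) (auto simp: lex_defs)
    have m1: "reg s1 41 = lim" using f1 by (simp add: frame_def lim_def lex_defs)
    have keep1: "lex_inv k E L (Suc i) s1" if "k \<in> R i \<or> lim < card (R i)"
      by (rule keep[OF f1 _ _ that]) (auto simp: lex_defs)
    show "runs (IfLess 41 44 Skip (Seq (Load 53 11 0) (IfLess 6 53 Skip lex_update))) s1
        (6 * k + 20) (lex_inv k E L (Suc i))"
    proof (rule runs_IfLess)
      assume "reg s1 41 < reg s1 44"
      then have "lex_inv k E L (Suc i) s1" using keep1 m1 s1 by auto
      then show "runs Skip s1 (6 * k + 19) (lex_inv k E L (Suc i))" by (intro runs_straight) auto
    next
      assume "\<not> reg s1 41 < reg s1 44"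
      then have small: "card (R i) \<le> lim" using m1 s1(1) by simp
      note s1 = s1(2)[OF small]
      show "runs (Seq (Load 53 11 0) (IfLess 6 53 Skip lex_update)) s1 (6 * k + 19) (lex_inv k E L (Suc i))"
      proof (rule runs_Seq)
        show "runs (Load 53 11 0) s1 1 (\<lambda>s'. reg s' 53 = (if k \<in> R i then 1 else 0))"
          using r1 s1 by (intro runs_straight) (auto simp: ready_def)
        fix s2 assume s2: "reg s2 53 = (if k \<in> R i then 1 else 0)" and f2: "frame (Load 53 11 0) s1 s2"
        have r2: "ready k s2" by (rule ready_frame[OF r1 f2]) auto
        have m2: "reg s2 41 = lim" "reg s2 44 = card (R i)" "mem s2 11 = mem s1 11"
          using f2 m1 s1 by (simp_all add: frame_def)
        show "runs (IfLess 6 53 Skip lex_update) s2 (6 * k + 18) (lex_inv k E L (Suc i))"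
        proof (rule runs_IfLess)
          assume "reg s2 6 < reg s2 53"
          then have "k \<in> R i" using s2 by (auto split: if_splits)
          then have "lex_inv k E L (Suc i) s1" using keep1 by simp
          then have "lex_inv k E L (Suc i) s2" using f2 by (simp add: lex_inv_def frame_def marked_def)
          then show "runs Skip s2 (6 * k + 16) (lex_inv k E L (Suc i))" by (intro runs_straight) auto
        next
          assume "\<not> reg s2 6 < reg s2 53"
          then have nk: "k \<notin> R i" using s2 r2 by (auto simp: ready_def split: if_splits)
          \<comment> \<open>Without a candidate all earlier unblocked sets exceed \<open>L\<close>.
            With a candidate, staying within \<open>card (R x) - 1\<close> means being strictly
            smaller, because \<open>posR\<close> makes the truncated subtraction exact.\<close>
          have min: "min_reach k E (Suc i) i"
            using inv unfolding lex_inv_def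
          proof (elim disjE conjE exE)
            assume "reg s 41 = L" "\<forall>y<i. k \<notin> E\<^sup>* `` {y} \<longrightarrow> L < card (E\<^sup>* `` {y})"
            then show ?thesis using nk small limL unfolding min_reach_def R_def less_Suc_eq by auto
          next
            fix x assume x: "min_reach k E i x" "reg s 41 = card (E\<^sup>* `` {x}) - 1"
            then have "card (R i) < card (R x)"
              using small posR[of x] i(2) by (auto simp: lim_def R_def min_reach_def)
            then show ?thesis using x(1) nk unfolding min_reach_def R_def less_Suc_eq by auto
          qed
          show "runs lex_update s2 (6 * k + 16) (lex_inv k E L (Suc i))"
            unfolding lex_update_def
          proof (rule runs_Seq)
            show "runs (block [Const 52 1, Sub 41 44 4]) s2 3 (\<lambda>s'. reg s' 52 = 1 \<and> reg s' 41 = card (R i) - 1)"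
              using r2 m2 by (intro runs_straight) (auto simp: ready_def)
            fix s3 assume s3: "reg s3 52 = 1 \<and> reg s3 41 = card (R i) - 1"
              and f3: "frame (block [Const 52 1, Sub 41 44 4]) s2 s3"
            have r3: "ready k s3" by (rule ready_frame[OF r2 f3]) auto
            have m3: "\<forall>v\<le>k. mem s3 11 v = (if v \<in> R i then 1 else 0)"
              using f3 m2 s1 by (simp add: frame_def)
            show "runs (copy_marks False) s3 (6 * k + 2) (lex_inv k E L (Suc i))"
            proof (rule runs_conseq[OF runs_copy_marks[OF r3 m3] order_refl])
              fix s4 assume s4: "marked k {v. v \<in> R i \<longleftrightarrow> \<not> False} s4" and f4: "frame (copy_marks False) s3 s4"
              have "reg s4 52 = 1" "reg s4 41 = card (R i) - 1"
                using f4 s3 by (auto simp: frame_def lex_defs)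
              moreover have "card (R i) \<le> L" using small limL by simp
              moreover have "marked k (R i) s4" using s4 by (simp add: marked_def)
              ultimately show "lex_inv k E L (Suc i) s4"
                using min unfolding lex_inv_def R_def by blast
            qed
          qed simp
        qed simp
      qed simp
    qed simp
  next
    have "Suc k * Suc lim \<le> Suc k * Suc L" using limL by (intro mult_le_mono) auto
    then show "50 * (Suc k * Suc lim) + (6 * k + 20) \<le> 50 * (Suc k * Suc L) + 6 * k + 20"
      by linarith
  qed
qed

lemma runs_lex_pass:
  assumes r: "ready k s" and E: "edges k s = E" and L: "reg s 51 = L" "1 \<le> L" and k: "1 \<le> k"
    and nf: "reg s 52 = 0"
  shows "runs lex_pass s (300 * (L * k\<^sup>2)) (\<lambda>s'. lex_inv k E L k s' \<and> reg s' 51 = 2 * L)"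
proof -
  define c where "c = 50 * (Suc k * Suc L) + 6 * k + 21"
  show ?thesis unfolding lex_pass_def
  proof (rule runs_Seq)
    define body where "body = Seq lex_try (Add 40 40 4)"
    show "runs (block [Add 41 51 6, Const 40 0]) s 3 (\<lambda>s'. lex_inv k E L 0 s' \<and> reg s' 40 = 0)"
      using r L nf by (intro runs_straight) (auto simp: ready_def lex_inv_def)
    fix s1 assume s1: "lex_inv k E L 0 s1 \<and> reg s1 40 = 0" and f1: "frame (block [Add 41 51 6, Const 40 0]) s s1"
    have r1: "ready k s1" by (rule ready_frame[OF r f1]) auto
    have m1: "edges k s1 = E" "reg s1 51 = L" using f1 E L by (auto simp: frame_def edges_def)
    show "runs (Seq (WhileLess 40 0 (Seq lex_try (Add 40 40 4))) (Add 51 51 51)) s1 ((k * (c + 1) + 1) + 1)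
        (\<lambda>s'. lex_inv k E L k s' \<and> reg s' 51 = 2 * L)"
    proof (rule runs_Seq)
      show "runs (WhileLess 40 0 (Seq lex_try (Add 40 40 4))) s1 (k * (c + 1) + 1)
          (\<lambda>s'. lex_inv k E L k s' \<and> reg s' 40 = k)"
        unfolding body_def[symmetric]
      proof (rule runs_for[where I = "lex_inv k E L" and n = k and c = c])
        fix i s2 assume i: "i < k" and f2: "frame body s1 s2" and s2: "reg s2 40 = i" "lex_inv k E L i s2"
        have r2: "ready k s2" by (rule ready_frame[OF r1 f2]) (auto simp: body_def lex_defs)
        have m2: "edges k s2 = E" using f2 m1 by (simp add: frame_def edges_def body_def lex_defs)
        show "runs body s2 c (\<lambda>s'. lex_inv k E L (Suc i) s' \<and> reg s' 40 = Suc i)"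
          unfolding body_def
        proof (rule runs_Seq[OF runs_lex_try[OF r2 m2 s2(1) i s2(2)]])
          fix s3 assume s3: "lex_inv k E L (Suc i) s3" and f3: "frame lex_try s2 s3"
          have r3: "ready k s3" by (rule ready_frame[OF r2 f3]) (auto simp: lex_defs)
          have "reg s3 40 = i" using f3 s2 by (simp add: frame_def lex_defs)
          then show "runs (Add 40 40 4) s3 1 (\<lambda>s'. lex_inv k E L (Suc i) s' \<and> reg s' 40 = Suc i)"
            using r3 s3 by (intro runs_straight) (auto simp: ready_def lex_inv_def marked_def)
        qed (simp add: c_def)
      qed (use r1 s1 in \<open>auto simp: ready_def body_def lex_defs\<close>)
      fix s2 assume s2: "lex_inv k E L k s2 \<and> reg s2 40 = k" and f2: "frame (WhileLess 40 0 (Seq lex_try (Add 40 40 4))) s1 s2"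
      have "reg s2 51 = L" using f2 m1 by (simp add: frame_def lex_defs)
      then show "runs (Add 51 51 51) s2 1 (\<lambda>s'. lex_inv k E L k s' \<and> reg s' 51 = 2 * L)"
        using s2 by (intro runs_straight) (auto simp: lex_inv_def marked_def)
    qed simp
  next
    \<comment> \<open>Writing \<open>k\<close> and \<open>L\<close> as successors removes the lower
      bounds and leaves an inequality between polynomials that holds coefficientwise.\<close>
    obtain j l where "k = Suc j" "L = Suc l" using k L(2) by (cases k; cases L) auto
    then show "3 + ((k * (c + 1) + 1) + 1) \<le> 300 * (L * k\<^sup>2)"
      by (simp add: c_def power2_eq_square algebra_simps)
  qed
qed

lemma runs_select_lex:
  assumes \<Theta>: "comtrace_alphabet \<Theta>" and w: "w \<in> step_seqs \<Theta>" "w \<noteq> []" and rep: "represents \<Theta> w s"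
    and k: "k = card (acts \<Theta>)"
  shows "\<exists>V. selected step_le \<Theta> w V \<and> runs select_lex s (2000 * (card V * k\<^sup>2)) (marked k V)"
proof -
  define st where "st = (\<lambda>i j. relation_code \<Theta> w (enum_act \<Theta> i) (enum_act \<Theta> j))"
  have kpos: "1 \<le> k" using card_acts_pos[OF \<Theta>] k by simp
  \<comment> \<open>The run of \<open>build\<close> is fixed first: its graph determines the size
    \<open>m\<close> of the smallest step, in which the bound for the remaining search is
    expressed.\<close>
  obtain t1 s1 where e1: "exec (build False) s t1 s1" "t1 \<le> 80 * k\<^sup>2 + 2" and s1: "\<forall>a<k. row_done False k st a k s1"
    using runs_build[OF \<Theta> w(1) rep k st_def, of False] unfolding runs_def by blast
  note f1 = exec_frame[OF e1(1)]
  have rep1: "represents \<Theta> w s1" by (rule represents_frame[OF rep f1]) (auto simp: build_defs)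
  then have r1: "ready k s1" by (simp add: represents_def k Let_def)
  define E where "E = edges k s1"
  define R where "R = (\<lambda>x. E\<^sup>* `` {x})"
  have graph: "step_graph \<Theta> w E" using step_graph_edges[OF s1 k st_def] by (simp add: E_def)
  define m where "m = (LEAST m. \<exists>y<k. k \<notin> R y \<and> card (R y) = m)"
  obtain V where V: "V \<subseteq> {..<k}" "V \<noteq> {}" "E `` V \<subseteq> V"
    using step_graph_adm_exists[OF \<Theta> w graph] unfolding k by metis
  then obtain y where y: "y \<in> V" by blast
  have "R y \<subseteq> V" unfolding R_def using y V(3) by (rule Image_rtrancl_subset)
  then have "\<exists>m. \<exists>y<k. k \<notin> R y \<and> card (R y) = m" using V(1) y by blast
  then obtain y0 where y0: "y0 < k" "k \<notin> R y0" "card (R y0) = m"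
    using LeastI_ex[of "\<lambda>m. \<exists>y<k. k \<notin> R y \<and> card (R y) = m"] unfolding m_def by blast
  have mle: "m \<le> card (R y)" if "y < k" "k \<notin> R y" for y
    unfolding m_def using that by (intro Least_le) blast
  have "finite (R y0)" "y0 \<in> R y0"
    using reachable_bounded[of y0 k s1] y0(1) by (auto simp: R_def E_def intro: finite_subset)
  then have "0 < card (R y0)" by (auto simp: card_gt_0_iff)
  then have mpos: "1 \<le> m" using y0(3) by simp
  have found: "selected step_le \<Theta> w (R x) \<and> card (R x) = m" if "min_reach k E k x" for x
  proof -
    have "R x \<subseteq> {..k}" unfolding R_def E_def
      by (rule reachable_bounded) (use that in \<open>simp add: min_reach_def\<close>)
    moreover have x: "x < k" "k \<notin> R x" "card (R x) \<le> card (R y0)"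
      using that y0 by (auto simp: min_reach_def R_def)
    ultimately have "R x \<subseteq> {..<k}" by (auto simp: le_less)
    moreover have "card (R x) = m" using x y0 mle[of x] by simp
    ultimately show ?thesis
      using best_step_lex[OF \<Theta> w(1) graph k that] by (simp add: selected_def R_def k)
  qed
  define ok where "ok = (\<lambda>s'. \<exists>x. min_reach k E k x \<and> marked k (R x) s')"
  \<comment> \<open>The limit stays below \<open>2 * m\<close> because it is doubled without success
    only after a pass that found nothing, and such a pass shows \<open>L < m\<close>.\<close>
  define I where "I = (\<lambda>s'. reg s' 52 = 0 \<and> 1 \<le> reg s' 51 \<and> reg s' 51 < 2 * m \<or> reg s' 52 = 1 \<and> ok s')"
  \<comment> \<open>An unsuccessful pass raises the limit by \<open>L\<close> and thereby releases
    301 k^2 L units, enough for its cost of 300 L k^2 and the test. With \<open>4 * m\<close> rather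
    than \<open>2 * m\<close>, at least \<open>L\<close> is still left for the final successful
    pass, where \<open>L < 2 * m\<close>.\<close>
  define f where "f = (\<lambda>s'::ram_state. if reg s' 52 = 0 then 301 * k\<^sup>2 * (4 * m - reg s' 51) else 0)"
  have "runs (Seq (block [Const 51 1, Const 52 0]) (WhileLess 52 4 lex_pass)) s1 (3 + (301 * k\<^sup>2 * (4 * m) + 1)) ok"
  proof (rule runs_Seq)
    show "runs (block [Const 51 1, Const 52 0]) s1 3 (\<lambda>s'. I s' \<and> f s' \<le> 301 * k\<^sup>2 * (4 * m))"
      using mpos by (intro runs_straight) (auto simp: I_def f_def)
    fix s2 assume s2: "I s2 \<and> f s2 \<le> 301 * k\<^sup>2 * (4 * m)" and f2: "frame (block [Const 51 1, Const 52 0]) s1 s2"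
    have r2: "ready k s2" by (rule ready_frame[OF r1 f2]) auto
    have m2: "edges k s2 = E" using f2 by (simp add: frame_def edges_def E_def)
    have "runs (WhileLess 52 4 lex_pass) s2 (301 * k\<^sup>2 * (4 * m) + 1) (\<lambda>s'. I s' \<and> \<not> reg s' 52 < reg s' 4)"
    proof (rule runs_while[where f = f])
      fix s3 assume f3: "frame lex_pass s2 s3" and s3: "I s3" "reg s3 52 < reg s3 4"
      have r3: "ready k s3" by (rule ready_frame[OF r2 f3]) (auto simp: lex_defs)
      have m3: "edges k s3 = E" using f3 m2 by (simp add: frame_def edges_def lex_defs)
      define L where "L = reg s3 51"
      have L: "reg s3 52 = 0" "1 \<le> L" "L < 2 * m"
        using s3 r3 by (auto simp: I_def ready_def L_def)
      have fs3: "f s3 = 301 * k\<^sup>2 * (4 * m - L)" using L by (simp add: f_def L_def)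
      have step_cost: "L * 301 * k\<^sup>2 \<ge> 300 * (L * k\<^sup>2) + 1"
        using L(2) kpos by (simp add: algebra_simps Suc_leI)
      have "runs lex_pass s3 (300 * (L * k\<^sup>2)) (\<lambda>s'. I s' \<and> f s' + 300 * (L * k\<^sup>2) + 1 \<le> f s3)"
      proof (rule runs_conseq[OF runs_lex_pass[OF r3 m3 L_def[symmetric] L(2) kpos L(1)] order_refl])
        fix s4 assume s4: "lex_inv k E L k s4 \<and> reg s4 51 = 2 * L"
        show "I s4 \<and> f s4 + 300 * (L * k\<^sup>2) + 1 \<le> f s3"
          using conjunct1[OF s4] unfolding lex_inv_def
        proof (elim disjE conjE exE)
          assume *: "reg s4 52 = 0" "\<forall>y<k. k \<notin> E\<^sup>* `` {y} \<longrightarrow> L < card (E\<^sup>* `` {y})"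
          then have "L < m" using y0 by (auto simp: R_def)
          moreover have "4 * m - L = (4 * m - 2 * L) + L" using \<open>L < m\<close> by simp
          then have "f s3 = 301 * k\<^sup>2 * (4 * m - 2 * L) + L * 301 * k\<^sup>2"
            unfolding fs3 by (simp only: distrib_left) (simp add: mult.assoc mult.commute mult.left_commute)
          ultimately show ?thesis
            using * s4 L step_cost by (simp add: I_def f_def)
        next
          fix x assume *: "reg s4 52 = 1" "min_reach k E k x" "marked k (E\<^sup>* `` {x}) s4"
          have "301 * k\<^sup>2 * L \<le> f s3" unfolding fs3 using L by (intro mult_le_mono) auto
          moreover have "301 * k\<^sup>2 * L = L * 301 * k\<^sup>2" by simp
          ultimately have "300 * (L * k\<^sup>2) + 1 \<le> f s3"
            using step_cost by linarith
          then show ?thesis using * by (auto simp: I_def f_def ok_def R_def)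
        qed
      qed
      then show "\<exists>T. runs lex_pass s3 T (\<lambda>s'. I s' \<and> f s' + T + 1 \<le> f s3)" by blast
    qed (use s2 in auto)
    then show "runs (WhileLess 52 4 lex_pass) s2 (301 * k\<^sup>2 * (4 * m) + 1) ok"
    proof (rule runs_conseq)
      fix s' assume s': "I s' \<and> \<not> reg s' 52 < reg s' 4" and f': "frame (WhileLess 52 4 lex_pass) s2 s'"
      have "ready k s'" by (rule ready_frame[OF r2 f']) (auto simp: lex_defs)
      then show "ok s'" using s' by (auto simp: I_def ready_def)
    qed simp
  qed simp
  then obtain t s' x where *: "exec (Seq (block [Const 51 1, Const 52 0]) (WhileLess 52 4 lex_pass)) s1 t s'"
    "t \<le> 3 + (301 * k\<^sup>2 * (4 * m) + 1)" "min_reach k E k x" "marked k (R x) s'"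
    unfolding runs_def ok_def by blast
  have "exec select_lex s (t1 + t) s'"
    unfolding select_lex_def using e1(1) *(1) by (rule exec_Seq)
  moreover have "t1 + t \<le> 2000 * (card (R x) * k\<^sup>2)"
  proof -
    have "1 \<le> k\<^sup>2" using kpos by (simp add: Suc_leI)
    then have "1 \<le> m * k\<^sup>2" "k\<^sup>2 \<le> m * k\<^sup>2" using mpos by (simp_all add: Suc_leI)
    moreover have "301 * k\<^sup>2 * (4 * m) = 1204 * (m * k\<^sup>2)" by simp
    ultimately have "80 * k\<^sup>2 + 2 + (3 + (301 * k\<^sup>2 * (4 * m) + 1)) \<le> 2000 * (m * k\<^sup>2)" by linarith
    then have "t1 + t \<le> 2000 * (m * k\<^sup>2)" using e1(2) *(2) by linarith
    then show ?thesis using found[OF *(3)] by simp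
  qed
  ultimately have "runs select_lex s (2000 * (card (R x) * k\<^sup>2)) (marked k (R x))"
    using *(4) unfolding runs_def by blast
  then show ?thesis using found[OF *(3)] by blast
qed

section \<open>Input and output\<close>

definition emit_loop :: com where
  "emit_loop = WhileLess 10 0
     (block [Load 11 7 10, IfLess 6 11 (Seq (Store 5 2 10) (Add 2 2 4)) Skip, Add 10 10 4])"

text \<open>Only the end of a step is written to array 4; it is also the start of the next step, and
  entry 0 is 0 from the beginning.\<close>

definition emit :: com where
  "emit = Seq (Const 10 0) (Seq emit_loop (Seq (Add 1 1 4) (Store 4 1 2)))"

text \<open>
  Positions are also advanced for independent pairs; they become meaningless but are never read,
  since such pairs are recognised from \<open>ser\<close> alone.
\<close>

definition advance_pair :: com where
  "advance_pair = block
     [Load 12 8 10, Add 12 12 11, Load 14 6 12, Load 15 7 10, Load 16 7 11, Load 17 3 14,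
      Add 18 15 16, IfLess 10 11 Skip (IfLess 11 10 Skip (Add 18 15 6)),
      IfLess 17 0 Skip (IfLess 4 18 (Const 18 1) Skip),
      Add 14 14 18, Store 6 12 14, Add 11 11 4]"

definition advance :: com where
  "advance = Seq (Const 10 0) (WhileLess 10 0
     (Seq (Const 11 0) (Seq (WhileLess 11 0 advance_pair) (Add 10 10 4))))"

definition init_strides :: com where
  "init_strides = Seq (Seq (Const 4 1) (Add 5 0 4)) (WhileLess 10 5
     (block [Store 8 10 11, Store 9 10 12, Add 11 11 0, Add 12 12 5, Add 10 10 4]))"

definition init_positions :: com where
  "init_positions = Seq (Seq (Load 13 8 0) (Const 10 0))
     (WhileLess 10 13 (block [Load 11 2 10, Store 6 10 11, Add 10 10 4]))"

text \<open>Position \<open>i * k + i\<close> belongs to a diagonal pair, whose word length is the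
  number of occurrences of that action.\<close>

definition init_count :: com where
  "init_count = Seq (Const 10 0) (WhileLess 10 0
     (block [Load 11 8 10, Add 11 11 10, Load 12 2 11, Add 11 11 4, Load 13 2 11, Sub 13 13 12,
        Add 3 3 13, Add 10 10 4]))"

text \<open>Registers 2 and 3 compare the occurrences written with their total; equality means that
  the remaining comtrace is empty.\<close>

definition canonical :: "com \<Rightarrow> com" where
  "canonical sel = Seq init_strides (Seq init_positions (Seq init_count
     (WhileLess 2 3 (Seq sel (Seq emit advance)))))"

lemmas io_defs = emit_loop_def emit_def advance_pair_def advance_def init_strides_def
  init_positions_def init_count_def

lemma runs_emit:
  assumes r: "ready k s" and V: "V \<subseteq> {..<k}" and m: "marked k V s" and c: "reg s 2 = c"
  shows "runs emit s (8 * k + 4) (\<lambda>s'. reg s' 2 = c + card V \<and> reg s' 1 = Suc (reg s 1) \<and>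
     mem s' 4 = (mem s 4)(Suc (reg s 1) := c + card V) \<and>
     mem s' 5 ` {c..<c + card V} = V \<and> (\<forall>j<c. mem s' 5 j = mem s 5 j))"
  unfolding emit_def
proof (rule runs_Seq)
  define body where "body = block [Load 11 7 10, IfLess 6 11 (Seq (Store 5 2 10) (Add 2 2 4)) Skip, Add 10 10 4]"
  define I where "I = (\<lambda>i (s'::ram_state). reg s' 2 = c + card (V \<inter> {..<i}) \<and>
     mem s' 5 ` {c..<c + card (V \<inter> {..<i})} = V \<inter> {..<i} \<and> (\<forall>j<c. mem s' 5 j = mem s 5 j))"
  show "runs (Const 10 0) s 1 (\<lambda>s'. reg s' 10 = 0)" by (rule runs_straight) auto
  fix s1 assume s1: "reg s1 10 = 0" and f1: "frame (Const 10 0) s s1"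
  have r1: "ready k s1" by (rule ready_frame[OF r f1]) auto
  have m1: "mem s1 = mem s" "reg s1 1 = reg s 1" "reg s1 2 = c" using f1 c by (auto simp: frame_def)
  show "runs (Seq emit_loop (Seq (Add 1 1 4) (Store 4 1 2))) s1 ((8 * k + 1) + 2)
    (\<lambda>s'. reg s' 2 = c + card V \<and> reg s' 1 = Suc (reg s 1) \<and> mem s' 4 = (mem s 4)(Suc (reg s 1) := c + card V) \<and>
     mem s' 5 ` {c..<c + card V} = V \<and> (\<forall>j<c. mem s' 5 j = mem s 5 j))"
  proof (rule runs_Seq)
    show "runs emit_loop s1 (8 * k + 1) (\<lambda>s'. I k s' \<and> reg s' 10 = k)"
      unfolding emit_loop_def body_def[symmetric]
    proof (rule runs_for[where I = I and c = 7 and n = k])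
      fix i s2 assume i: "i < k" and f2: "frame body s1 s2" and s2: "reg s2 10 = i" "I i s2"
      have r2: "ready k s2" by (rule ready_frame[OF r1 f2]) (auto simp: body_def)
      have m2: "mem s2 7 i = (if i \<in> V then 1 else 0)"
        using f2 m m1 i by (simp add: frame_def body_def marked_def)
      have "I (Suc i) (sem body s2)"
      proof (cases "i \<in> V")
        case True
        then have "V \<inter> {..<Suc i} = insert i (V \<inter> {..<i})" by auto
        moreover from this have "card (V \<inter> {..<Suc i}) = Suc (card (V \<inter> {..<i}))" by simp
        moreover have "{c..<Suc (c + n)} = insert (c + n) {c..<c + n}" for n by auto
        ultimately show ?thesis
          using s2 r2 m2 True by (auto simp: I_def body_def ready_def)
      next
        case False
        then have "V \<inter> {..<Suc i} = V \<inter> {..<i}" by (auto simp: less_Suc_eq)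
        then show ?thesis using s2 r2 m2 False by (simp add: I_def body_def ready_def)
      qed
      then show "runs body s2 7 (\<lambda>s'. I (Suc i) s' \<and> reg s' 10 = Suc i)"
        using s2 r2 by (intro runs_straight) (simp_all add: body_def ready_def)
    qed (use r1 s1 m1 in \<open>auto simp: I_def ready_def body_def\<close>)
    fix s2 assume s2: "I k s2 \<and> reg s2 10 = k" and f2: "frame emit_loop s1 s2"
    have r2: "ready k s2" by (rule ready_frame[OF r1 f2]) (auto simp: io_defs)
    have m2: "mem s2 4 = mem s 4" "reg s2 1 = reg s 1" using f2 m1 by (simp_all add: frame_def io_defs)
    have "V \<inter> {..<k} = V" using V by auto
    then show "runs (Seq (Add 1 1 4) (Store 4 1 2)) s2 2
      (\<lambda>s'. reg s' 2 = c + card V \<and> reg s' 1 = Suc (reg s 1) \<and> mem s' 4 = (mem s 4)(Suc (reg s 1) := c + card V) \<and>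
       mem s' 5 ` {c..<c + card V} = V \<and> (\<forall>j<c. mem s' 5 j = mem s 5 j))"
      using s2 r2 m2 by (intro runs_straight) (auto simp: I_def ready_def)
  qed simp
qed simp

text \<open>This is the number of letters that the step \<open>V\<close> contributes to the word at
  \<open>p\<close>: one for each member of the pair in \<open>V\<close>, a diagonal pair counting
  once. If both members are present but the current symbol has code at least \<open>k\<close>, that
  symbol is \<open>None\<close> and stands for both.\<close>

definition shift :: "nat \<Rightarrow> nat set \<Rightarrow> ram_state \<Rightarrow> nat \<Rightarrow> nat" where
  "shift k V s p = (let i = p div k; j = p mod k;
     d = (if i = j then of_bool (i \<in> V) else of_bool (i \<in> V) + of_bool (j \<in> V)) in
     if k \<le> mem s 3 (mem s 6 p) \<and> 1 < d then 1 else d)"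

lemma runs_advance_positions:
  assumes r: "ready k s" and m: "marked k V s" and k: "1 \<le> k"
  shows "runs advance s (50 * k\<^sup>2) (\<lambda>s'. \<forall>p<k * k. mem s' 6 p = mem s 6 p + shift k V s p)"
  unfolding advance_def
proof (rule runs_Seq)
  define body where "body = Seq (Const 11 0) (Seq (WhileLess 11 0 advance_pair) (Add 10 10 4))"
  \<comment> \<open>All positions are covered, not only those already visited, because
    \<open>shift\<close> refers to the initial state and an unvisited position must still hold its
    initial value.\<close>
  define I where "I = (\<lambda>n (s'::ram_state). \<forall>p. mem s' 6 p = mem s 6 p + (if p < n then shift k V s p else 0))"
  show "runs (Const 10 0) s 1 (\<lambda>s'. reg s' 10 = 0 \<and> I 0 s')" by (rule runs_straight) (auto simp: I_def)
  fix s1 assume s1: "reg s1 10 = 0 \<and> I 0 s1" and f1: "frame (Const 10 0) s s1"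
  have r1: "ready k s1" by (rule ready_frame[OF r f1]) auto
  have m1: "mem s1 7 = mem s 7" "mem s1 3 = mem s 3" using f1 by (auto simp: frame_def)
  have "runs (WhileLess 10 0 body) s1 (k * (30 * k + 3 + 1) + 1) (\<lambda>s'. I (k * k) s' \<and> reg s' 10 = k)"
  proof (rule runs_for[where I = "\<lambda>i. I (i * k)" and n = k and c = "30 * k + 3"])
    fix i s2 assume i: "i < k" and f2: "frame body s1 s2" and s2: "reg s2 10 = i" "I (i * k) s2"
    have r2: "ready k s2" by (rule ready_frame[OF r1 f2]) (auto simp: body_def io_defs)
    have m2: "mem s2 7 = mem s 7" "mem s2 3 = mem s 3"
      using f2 m1 by (simp_all add: frame_def body_def io_defs)
    show "runs body s2 (30 * k + 3) (\<lambda>s'. I (Suc i * k) s' \<and> reg s' 10 = Suc i)"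
      unfolding body_def
    proof (rule runs_Seq)
      show "runs (Const 11 0) s2 1 (\<lambda>s'. reg s' 11 = 0 \<and> I (i * k + 0) s')"
        using s2 by (intro runs_straight) (auto simp: I_def)
      fix s3 assume s3: "reg s3 11 = 0 \<and> I (i * k + 0) s3" and f3: "frame (Const 11 0) s2 s3"
      have r3: "ready k s3" by (rule ready_frame[OF r2 f3]) auto
      have m3: "mem s3 7 = mem s 7" "mem s3 3 = mem s 3" "reg s3 10 = i"
        using f3 m2 s2 by (simp_all add: frame_def)
      show "runs (Seq (WhileLess 11 0 advance_pair) (Add 10 10 4)) s3 ((30 * k + 1) + 1)
          (\<lambda>s'. I (Suc i * k) s' \<and> reg s' 10 = Suc i)"
      proof (rule runs_Seq)
        show "runs (WhileLess 11 0 advance_pair) s3 (30 * k + 1) (\<lambda>s'. I (i * k + k) s' \<and> reg s' 11 = k)"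
        proof (rule runs_for[where I = "\<lambda>j. I (i * k + j)" and n = k and c = 29])
          fix j s4 assume j: "j < k" and f4: "frame advance_pair s3 s4" and s4: "reg s4 11 = j" "I (i * k + j) s4"
          have r4: "ready k s4" by (rule ready_frame[OF r3 f4]) (auto simp: io_defs)
          have m4: "mem s4 7 = mem s 7" "mem s4 3 = mem s 3" "reg s4 10 = i"
            using f4 m3 by (simp_all add: frame_def io_defs)
          define p where "p = i * k + j"
          have div: "p div k = i" "p mod k = j" using j by (auto simp: p_def)
          have pos: "mem s4 6 p = mem s 6 p" using s4(2) by (simp add: I_def p_def)
          have mk: "mem s 7 i = of_bool (i \<in> V)" "mem s 7 j = of_bool (j \<in> V)"
            using m i j by (simp_all add: marked_def)
          have "mem (sem advance_pair s4) 6 = (mem s4 6)(p := mem s 6 p + shift k V s p)"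
            using r4 m4 s4 i j mk pos unfolding shift_def div
            by (simp add: advance_pair_def ready_def p_def[symmetric] not_less Let_def of_bool_def)
          then have "I (i * k + Suc j) (sem advance_pair s4)"
            using s4(2) by (auto simp: I_def p_def less_Suc_eq)
          moreover have "reg (sem advance_pair s4) 11 = Suc j"
            using r4 s4(1) by (simp add: advance_pair_def ready_def)
          moreover have "straight advance_pair" "cost advance_pair \<le> 29"
            by (simp_all add: advance_pair_def)
          ultimately show "runs advance_pair s4 29 (\<lambda>s'. I (i * k + Suc j) s' \<and> reg s' 11 = Suc j)"
            by (intro runs_straight conjI)
        qed (use r3 s3 in \<open>auto simp: ready_def io_defs\<close>)
        fix s4 assume s4: "I (i * k + k) s4 \<and> reg s4 11 = k" and f4: "frame (WhileLess 11 0 advance_pair) s3 s4"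
        have r4: "ready k s4" by (rule ready_frame[OF r3 f4]) (auto simp: io_defs)
        have "reg s4 10 = i" using f4 m3 by (simp add: frame_def io_defs)
        then show "runs (Add 10 10 4) s4 1 (\<lambda>s'. I (Suc i * k) s' \<and> reg s' 10 = Suc i)"
          using r4 s4 by (intro runs_straight) (auto simp: ready_def I_def add.commute)
      qed simp
    qed simp
  qed (use r1 s1 in \<open>auto simp: ready_def body_def io_defs\<close>)
  then show "runs (WhileLess 10 0 (Seq (Const 11 0) (Seq (WhileLess 11 0 advance_pair) (Add 10 10 4)))) s1
     (k * (30 * k + 3 + 1) + 1) (\<lambda>s'. \<forall>p<k * k. mem s' 6 p = mem s 6 p + shift k V s p)"
    unfolding body_def by (rule runs_conseq) (auto simp: I_def)
next
  obtain j where "k = Suc j" using k by (cases k) auto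
  then show "1 + (k * (30 * k + 3 + 1) + 1) \<le> 50 * k\<^sup>2"
    by (simp add: power2_eq_square algebra_simps)
qed

text \<open>By invariance of the projections, each word of \<open>w\<close> is the contribution of
  \<open>A\<close> followed by the word of \<open>v\<close>. The shift equals the length of that
  contribution, so the remaining suffix is the word of \<open>v\<close>.\<close>

lemma runs_advance:
  assumes \<Theta>: "comtrace_alphabet \<Theta>" and rep: "represents \<Theta> w s" and k: "k = card (acts \<Theta>)"
    and V: "V \<subseteq> {..<k}" "marked k V s"
    and A: "A = enum_act \<Theta> ` V" "is_step \<Theta> A" and v: "ct_equiv \<Theta> (A # v) w"
  shows "runs advance s (50 * k\<^sup>2) (represents \<Theta> v)"
proof -
  have r: "ready k s" using rep by (simp add: represents_def k Let_def)
  have kpos: "1 \<le> k" using card_acts_pos[OF \<Theta>] k by simp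
  have fin: "finite (acts \<Theta>)" using \<Theta> by (simp add: comtrace_alphabet_def)
  show ?thesis
  proof (rule runs_conseq[OF runs_advance_positions[OF r V(2) kpos] order_refl])
    fix s' assume s': "\<forall>p<k * k. mem s' 6 p = mem s 6 p + shift k V s p" and f: "frame advance s s'"
    have r': "ready k s'" by (rule ready_frame[OF r f]) (auto simp: io_defs)
    have m: "mem s' 1 = mem s 1" "mem s' 2 = mem s 2" "mem s' 3 = mem s 3"
      using f by (simp_all add: frame_def io_defs)
    have "map (mem s 3) [mem s' 6 (i * k + j)..<mem s 2 (Suc (i * k + j))] =
        map (sym_code \<Theta>) (proj_seq \<Theta> (enum_act \<Theta> i) (enum_act \<Theta> j) v)"
      if ij: "i < k" "j < k" and nind: "(enum_act \<Theta> i, enum_act \<Theta> j) \<notin> ind \<Theta>" for i j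
    proof -
      define a b where "a = enum_act \<Theta> i" and "b = enum_act \<Theta> j"
      define x where "x = i * k + j"
      define p q where "p = mem s 6 x" and "q = mem s 2 (Suc x)"
      have nind: "(a, b) \<notin> ind \<Theta>" using nind by (simp add: a_def b_def)
      have "x < k * k"
      proof -
        have "x < Suc i * k" using ij by (simp add: x_def)
        also have "\<dots> \<le> k * k" using ij by (intro mult_le_mono) auto
        finally show ?thesis .
      qed
      then have pos: "mem s' 6 x = p + shift k V s x" using s' by (simp add: p_def)
      have "map (mem s 3) [p..<q] = map (sym_code \<Theta>) (proj_seq \<Theta> a b w)"
        using rep ij nind by (auto simp: represents_def Let_def k[symmetric] p_def q_def x_def a_def b_def)
      then have word: "map (mem s 3) [p..<q] = map (sym_code \<Theta>) (proj_step \<Theta> a b A @ proj_seq \<Theta> a b v)"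
        using ct_equiv_proj_seq[OF \<Theta> v nind] by simp
      have inA: "a \<in> A \<longleftrightarrow> i \<in> V" "b \<in> A \<longleftrightarrow> j \<in> V" "a = b \<longleftrightarrow> i = j"
        using ij V(1) inj_on_enum_act[of \<Theta>] enum_act_eq_iff[of i \<Theta> j]
        by (auto simp: A(1) a_def b_def k[symmetric] inj_on_image_mem_iff)
      have div: "x div k = i" "x mod k = j" using ij by (auto simp: x_def)
      have "shift k V s x = length (proj_step \<Theta> a b A)"
      proof (cases "i \<in> V \<and> j \<in> V \<and> i \<noteq> j")
        case True
        then have ab: "a \<in> A" "b \<in> A" "a \<noteq> b" using inA by auto
        have ne: "proj_step \<Theta> a b A \<noteq> []" by (rule proj_step_both[OF \<Theta> A(2) ab nind]) auto
        then have "p < q" using word by (cases "p < q") auto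
        then have "[p..<q] = p # [Suc p..<q]" by (simp add: upt_rec)
        \<comment> \<open>With both actions in the step, the letter at the current position is the
          first letter of its contribution; it decides between one symbol \<open>None\<close> and
          two letters.\<close>
        then have hd: "mem s 3 p = sym_code \<Theta> (hd (proj_step \<Theta> a b A))"
          using word ne by (cases "proj_step \<Theta> a b A") auto
        have code: "sym_code \<Theta> (Some a) = i" "sym_code \<Theta> (Some b) = j" "sym_code \<Theta> None = k"
          using act_code_enum_act[OF fin] ij by (simp_all add: sym_code_def a_def b_def k)
        show ?thesis
          by (rule proj_step_both[OF \<Theta> A(2) ab nind])
            (use True hd code ij in \<open>simp_all add: shift_def div p_def[symmetric] Let_def\<close>)
      next
        case False
        then have "length (proj_step \<Theta> a b A) = (if i \<in> V \<or> j \<in> V then 1 else 0)"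
          using inA by (auto simp: proj_step_def)
        then show ?thesis using False by (auto simp: shift_def div Let_def)
      qed
      then have "[mem s' 6 x..<q] = drop (length (proj_step \<Theta> a b A)) [p..<q]"
        by (simp add: pos drop_upt)
      then have "map (mem s 3) [mem s' 6 x..<q] = drop (length (proj_step \<Theta> a b A)) (map (mem s 3) [p..<q])"
        by (simp only: drop_map)
      also have "\<dots> = map (sym_code \<Theta>) (proj_seq \<Theta> a b v)"
        unfolding word by simp
      finally show ?thesis by (simp add: x_def q_def a_def b_def)
    qed
    then show "represents \<Theta> v s'"
      using rep r' unfolding represents_def Let_def k[symmetric] m by blast
  qed
qed

section \<open>Layout of the input and initialisation\<close>

lemma offsets_slice:
  assumes "p < length xss"
  shows "map (array_of (concat xss)) [array_of (offsets xss) p..<array_of (offsets xss) (Suc p)] = xss ! p"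
    and "array_of (offsets xss) (Suc p) = array_of (offsets xss) p + length (xss ! p)"
proof -
  define l where "l = length (concat (take p xss))"
  have take: "concat (take (Suc p) xss) = concat (take p xss) @ xss ! p"
    using assms by (simp add: take_Suc_conv_app_nth)
  have off: "array_of (offsets xss) i = length (concat (take i xss))" if "i \<le> length xss" for i
    using that by (simp add: array_of_def offsets_def nth_append del: length_concat)
  show "array_of (offsets xss) (Suc p) = array_of (offsets xss) p + length (xss ! p)"
    using assms off[of p] off[of "Suc p"] take by (simp del: length_concat)
  have "concat xss = concat (take (Suc p) xss) @ concat (drop (Suc p) xss)"
    by (metis append_take_drop_id concat_append)
  then have "array_of (concat xss) (l + i) = xss ! p ! i" if "i < length (xss ! p)" for i
    using that by (simp add: array_of_def l_def take nth_append del: length_concat)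
  moreover have "array_of (offsets xss) p = l" "array_of (offsets xss) (Suc p) = l + length (xss ! p)"
    using assms off[of p] off[of "Suc p"] take by (simp_all add: l_def del: length_concat)
  ultimately show "map (array_of (concat xss)) [array_of (offsets xss) p..<array_of (offsets xss) (Suc p)] = xss ! p"
    by (intro nth_equalityI) auto
qed

lemma length_act_pairs: "length (act_pairs \<Theta>) = card (acts \<Theta>) * card (acts \<Theta>)"
  by (simp add: act_pairs_def)

lemma pair_index_less: "i < k \<Longrightarrow> j < k \<Longrightarrow> i * k + j < k * (k::nat)"
  by (metis add.commute add_less_cancel_left less_le_trans mult_Suc mult_le_mono1 Suc_leI)

lemma act_pairs_nth:
  assumes "i < card (acts \<Theta>)" "j < card (acts \<Theta>)"
  shows "act_pairs \<Theta> ! (i * card (acts \<Theta>) + j) = (enum_act \<Theta> i, enum_act \<Theta> j)"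
  using assms pair_index_less[OF assms] by (simp add: act_pairs_def enum_act_def product_nth)

lemma runs_init_strides:
  assumes "reg s 0 = k" "reg s 6 = 0" "reg s 10 = 0" "reg s 11 = 0" "reg s 12 = 0"
  shows "runs init_strides s (8 * Suc k + 3) (ready k)"
  unfolding init_strides_def
proof (rule runs_Seq)
  define body where "body = block [Store 8 10 11, Store 9 10 12, Add 11 11 0, Add 12 12 5, Add 10 10 4]"
  define I where "I = (\<lambda>i (s'::ram_state). reg s' 11 = i * k \<and> reg s' 12 = i * Suc k \<and>
    (\<forall>a<i. mem s' 8 a = a * k) \<and> (\<forall>a<i. mem s' 9 a = a * Suc k))"
  show "runs (Seq (Const 4 1) (Add 5 0 4)) s 2 (\<lambda>s'. reg s' 4 = 1 \<and> reg s' 5 = Suc k)"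
    using assms by (intro runs_straight) auto
  fix s1 assume s1: "reg s1 4 = 1 \<and> reg s1 5 = Suc k" and f1: "frame (Seq (Const 4 1) (Add 5 0 4)) s s1"
  have m1: "reg s1 0 = k" "reg s1 6 = 0" "reg s1 10 = 0" "reg s1 11 = 0" "reg s1 12 = 0"
    using f1 assms by (auto simp: frame_def)
  have "runs (WhileLess 10 5 body) s1 (Suc k * 7 + 1) (\<lambda>s'. I (Suc k) s' \<and> reg s' 10 = Suc k)"
  proof (rule runs_for[where n = "Suc k" and c = 6])
    fix i s2 assume i: "i < Suc k" and f2: "frame body s1 s2" and s2: "reg s2 10 = i" "reg s2 5 = Suc k" "I i s2"
    have "reg s2 4 = 1" "reg s2 0 = k" using f2 s1 m1 by (simp_all add: frame_def body_def)
    then show "runs body s2 6 (\<lambda>s'. I (Suc i) s' \<and> reg s' 10 = Suc i)"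
      using s2 by (intro runs_straight) (auto simp: body_def I_def less_Suc_eq)
  qed (use s1 m1 in \<open>auto simp: I_def body_def\<close>)
  then show "runs (WhileLess 10 5 (block [Store 8 10 11, Store 9 10 12, Add 11 11 0, Add 12 12 5, Add 10 10 4]))
     s1 (Suc k * 7 + 1) (ready k)"
    unfolding body_def[symmetric]
  proof (rule runs_conseq)
    fix s' assume s': "I (Suc k) s' \<and> reg s' 10 = Suc k" and f: "frame (WhileLess 10 5 body) s1 s'"
    then show "ready k s'"
      using s1 m1 by (simp add: ready_def I_def frame_def body_def less_Suc_eq_le)
  qed simp
qed simp

lemma runs_init_positions:
  assumes r: "ready k s"
  shows "runs init_positions s (5 * k\<^sup>2 + 3) (\<lambda>s'. \<forall>p<k * k. mem s' 6 p = mem s 2 p)"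
  unfolding init_positions_def
proof (rule runs_Seq)
  define body where "body = block [Load 11 2 10, Store 6 10 11, Add 10 10 4]"
  show "runs (Seq (Load 13 8 0) (Const 10 0)) s 2 (\<lambda>s'. reg s' 13 = k * k \<and> reg s' 10 = 0)"
    using r by (intro runs_straight) (auto simp: ready_def)
  fix s1 assume s1: "reg s1 13 = k * k \<and> reg s1 10 = 0" and f1: "frame (Seq (Load 13 8 0) (Const 10 0)) s s1"
  have r1: "ready k s1" by (rule ready_frame[OF r f1]) auto
  have m1: "mem s1 2 = mem s 2" using f1 by (simp add: frame_def)
  have "runs (WhileLess 10 13 body) s1 (5 * k\<^sup>2 + 1)
      (\<lambda>s'. (\<forall>p<k * k. mem s' 6 p = mem s 2 p) \<and> reg s' 10 = k * k)"
  proof (rule runs_for[where n = "k * k" and c = 4 and I = "\<lambda>i s'. \<forall>p<i. mem s' 6 p = mem s 2 p"])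
    fix i s2 assume i: "i < k * k" and f2: "frame body s1 s2" and s2: "reg s2 10 = i" "\<forall>p<i. mem s2 6 p = mem s 2 p"
    have r2: "ready k s2" by (rule ready_frame[OF r1 f2]) (auto simp: body_def)
    have "mem s2 2 = mem s 2" using f2 m1 by (simp add: frame_def body_def)
    then show "runs body s2 4 (\<lambda>s'. (\<forall>p<Suc i. mem s' 6 p = mem s 2 p) \<and> reg s' 10 = Suc i)"
      using s2 r2 by (intro runs_straight) (auto simp: body_def ready_def less_Suc_eq)
  qed (use s1 in \<open>auto simp: body_def power2_eq_square\<close>)
  then show "runs (WhileLess 10 13 (block [Load 11 2 10, Store 6 10 11, Add 10 10 4])) s1 (5 * k\<^sup>2 + 1)
      (\<lambda>s'. \<forall>p<k * k. mem s' 6 p = mem s 2 p)"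
    unfolding body_def by (rule runs_conseq) auto
qed simp

lemma runs_init_count:
  assumes r: "ready k s" and n: "reg s 3 = 0"
  shows "runs init_count s (10 * k + 2)
    (\<lambda>s'. reg s' 3 = (\<Sum>i<k. mem s 2 (Suc (i * k + i)) - mem s 2 (i * k + i)))"
  unfolding init_count_def
proof (rule runs_Seq)
  define body where "body = block [Load 11 8 10, Add 11 11 10, Load 12 2 11, Add 11 11 4,
     Load 13 2 11, Sub 13 13 12, Add 3 3 13, Add 10 10 4]"
  define S where "S = (\<lambda>n. \<Sum>i<n. mem s 2 (Suc (i * k + i)) - mem s 2 (i * k + i))"
  show "runs (Const 10 0) s 1 (\<lambda>s'. reg s' 10 = 0)" by (rule runs_straight) auto
  fix s1 assume s1: "reg s1 10 = 0" and f1: "frame (Const 10 0) s s1"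
  have r1: "ready k s1" by (rule ready_frame[OF r f1]) auto
  have m1: "mem s1 2 = mem s 2" "reg s1 3 = 0" using f1 n by (simp_all add: frame_def)
  have "runs (WhileLess 10 0 body) s1 (10 * k + 1) (\<lambda>s'. reg s' 3 = S k \<and> reg s' 10 = k)"
  proof (rule runs_for[where n = k and c = 9 and I = "\<lambda>i s'. reg s' 3 = S i"])
    fix i s2 assume i: "i < k" and f2: "frame body s1 s2" and s2: "reg s2 10 = i" "reg s2 3 = S i"
    have r2: "ready k s2" by (rule ready_frame[OF r1 f2]) (auto simp: body_def)
    have "mem s2 2 = mem s 2" using f2 m1 by (simp add: frame_def body_def)
    then show "runs body s2 9 (\<lambda>s'. reg s' 3 = S (Suc i) \<and> reg s' 10 = Suc i)"
      using s2 r2 i by (intro runs_straight) (auto simp: body_def ready_def S_def)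
  qed (use s1 r1 m1 in \<open>auto simp: body_def ready_def S_def\<close>)
  then show "runs (WhileLess 10 0 (block [Load 11 8 10, Add 11 11 10, Load 12 2 11, Add 11 11 4,
     Load 13 2 11, Sub 13 13 12, Add 3 3 13, Add 10 10 4])) s1 (10 * k + 1)
     (\<lambda>s'. reg s' 3 = (\<Sum>i<k. mem s 2 (Suc (i * k + i)) - mem s 2 (i * k + i)))"
    unfolding body_def S_def by (rule runs_conseq) auto
qed simp

lemma input_state_words:
  assumes \<Theta>: "comtrace_alphabet \<Theta>" and \<tau>: "\<tau> \<in> comtraces \<Theta>" "w \<in> \<tau>" and k: "k = card (acts \<Theta>)"
    and ij: "i < k" "j < k" and nind: "(enum_act \<Theta> i, enum_act \<Theta> j) \<notin> ind \<Theta>"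
  defines "s \<equiv> input_state \<Theta> (proj_rep \<Theta> \<tau>)"
  shows "map (mem s 3) [mem s 2 (i * k + j)..<mem s 2 (Suc (i * k + j))] =
      map (sym_code \<Theta>) (proj_seq \<Theta> (enum_act \<Theta> i) (enum_act \<Theta> j) w)"
    and "mem s 2 (Suc (i * k + j)) - mem s 2 (i * k + j) =
      length (proj_seq \<Theta> (enum_act \<Theta> i) (enum_act \<Theta> j) w)"
proof -
  define W where "W = proj_words \<Theta> (proj_rep \<Theta> \<tau>)"
  have p: "i * k + j < length W"
    using pair_index_less[OF ij] by (simp add: W_def proj_words_def length_act_pairs k)
  have "W ! (i * k + j) = map (sym_code \<Theta>) (proj_rep \<Theta> \<tau> (enum_act \<Theta> i) (enum_act \<Theta> j))"
    using p nind act_pairs_nth[of i \<Theta> j] ij by (simp add: W_def proj_words_def k)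
  then have Wp: "W ! (i * k + j) = map (sym_code \<Theta>) (proj_seq \<Theta> (enum_act \<Theta> i) (enum_act \<Theta> j) w)"
    using proj_rep_eq[OF \<Theta> \<tau>(1) nind \<tau>(2)] by simp
  have mem: "mem s 2 = array_of (offsets W)" "mem s 3 = array_of (concat W)"
    by (simp_all add: s_def input_state_def W_def)
  show "map (mem s 3) [mem s 2 (i * k + j)..<mem s 2 (Suc (i * k + j))] =
      map (sym_code \<Theta>) (proj_seq \<Theta> (enum_act \<Theta> i) (enum_act \<Theta> j) w)"
    unfolding mem Wp[symmetric] by (rule offsets_slice(1)[OF p])
  show "mem s 2 (Suc (i * k + j)) - mem s 2 (i * k + j) =
      length (proj_seq \<Theta> (enum_act \<Theta> i) (enum_act \<Theta> j) w)"
    unfolding mem offsets_slice(2)[OF p] Wp by simp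
qed

lemma runs_init:
  assumes \<Theta>: "comtrace_alphabet \<Theta>" and \<tau>: "\<tau> \<in> comtraces \<Theta>" "w \<in> \<tau>" and k: "k = card (acts \<Theta>)"
  defines "s \<equiv> input_state \<Theta> (proj_rep \<Theta> \<tau>)"
  shows "runs (Seq init_strides (Seq init_positions init_count)) s (50 * k\<^sup>2) (\<lambda>s'. represents \<Theta> w s' \<and>
    reg s' 1 = 0 \<and> reg s' 2 = 0 \<and> reg s' 3 = occurrences w \<and> mem s' 4 0 = 0)"
proof (rule runs_Seq)
  have fin: "finite (acts \<Theta>)" using \<Theta> by (simp add: comtrace_alphabet_def)
  have s: "reg s = (\<lambda>_. 0)(0 := k)" "mem s 4 0 = 0"
    "mem s 1 = array_of (map (\<lambda>p. if p \<in> ser \<Theta> then 1 else 0) (act_pairs \<Theta>))"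
    by (simp_all add: s_def input_state_def k)
  note words = input_state_words[OF \<Theta> \<tau> k, folded s_def]
  show "runs init_strides s (8 * Suc k + 3) (ready k)"
    by (rule runs_init_strides) (simp_all add: s)
  fix s1 assume r1: "ready k s1" and f1: "frame init_strides s s1"
  have m1: "reg s1 1 = 0" "reg s1 2 = 0" "reg s1 3 = 0" "mem s1 1 = mem s 1" "mem s1 2 = mem s 2"
    "mem s1 3 = mem s 3" "mem s1 4 0 = 0"
    using f1 s by (simp_all add: frame_def io_defs)
  show "runs (Seq init_positions init_count) s1 ((5 * k\<^sup>2 + 3) + (10 * k + 2)) (\<lambda>s'. represents \<Theta> w s' \<and>
    reg s' 1 = 0 \<and> reg s' 2 = 0 \<and> reg s' 3 = occurrences w \<and> mem s' 4 0 = 0)"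
  proof (rule runs_Seq[OF runs_init_positions[OF r1]])
    fix s2 assume s2: "\<forall>p<k * k. mem s2 6 p = mem s1 2 p" and f2: "frame init_positions s1 s2"
    have r2: "ready k s2" by (rule ready_frame[OF r1 f2]) (auto simp: io_defs)
    have m2: "reg s2 1 = 0" "reg s2 2 = 0" "reg s2 3 = 0" "mem s2 1 = mem s 1" "mem s2 2 = mem s 2"
      "mem s2 3 = mem s 3" "mem s2 4 0 = 0"
      using f2 m1 by (simp_all add: frame_def io_defs)
    have "mem s2 1 (i * k + j) = (if (enum_act \<Theta> i, enum_act \<Theta> j) \<in> ser \<Theta> then 1 else 0)"
      if "i < k" "j < k" for i j
      using pair_index_less[OF that] act_pairs_nth[of i \<Theta> j] that
      unfolding m2(4) s(3) by (simp add: array_of_def length_act_pairs k)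
    moreover have "mem s2 6 (i * k + j) = mem s 2 (i * k + j)" if "i < k" "j < k" for i j
      using s2 m1 pair_index_less[OF that] by simp
    ultimately have rep2: "represents \<Theta> w s2"
      using r2 words(1) unfolding represents_def Let_def k[symmetric] m2 by simp
    have "(\<Sum>i<k. mem s2 2 (Suc (i * k + i)) - mem s2 2 (i * k + i)) =
        (\<Sum>i<k. length (proj_seq \<Theta> (enum_act \<Theta> i) (enum_act \<Theta> i) w))"
    proof (rule sum.cong[OF refl])
      fix i assume "i \<in> {..<k}"
      moreover have "(a, a) \<notin> ind \<Theta>" for a
        using \<Theta> by (auto simp: ind_def comtrace_alphabet_def irrefl_def)
      ultimately show "mem s2 2 (Suc (i * k + i)) - mem s2 2 (i * k + i) =
          length (proj_seq \<Theta> (enum_act \<Theta> i) (enum_act \<Theta> i) w)"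
        using words(2)[of i i] by (simp add: m2)
    qed
    also have "\<dots> = (\<Sum>a\<in>acts \<Theta>. length (proj_seq \<Theta> a a w))"
      using sum.reindex[OF inj_on_enum_act[of \<Theta>], of "\<lambda>a. length (proj_seq \<Theta> a a w)"]
      unfolding enum_act_image[OF fin] k by (simp add: o_def)
    also have "\<dots> = occurrences w"
      by (rule sum_length_proj_seq[OF \<Theta> comtraces_step_seqs[OF \<tau>]])
    finally have count: "(\<Sum>i<k. mem s2 2 (Suc (i * k + i)) - mem s2 2 (i * k + i)) = occurrences w" .
    show "runs init_count s2 (10 * k + 2) (\<lambda>s'. represents \<Theta> w s' \<and>
      reg s' 1 = 0 \<and> reg s' 2 = 0 \<and> reg s' 3 = occurrences w \<and> mem s' 4 0 = 0)"
    proof (rule runs_conseq[OF runs_init_count[OF r2 m2(3)] order_refl])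
      fix s3 assume s3: "reg s3 3 = (\<Sum>i<k. mem s2 2 (Suc (i * k + i)) - mem s2 2 (i * k + i))"
        and f3: "frame init_count s2 s3"
      have "represents \<Theta> w s3" by (rule represents_frame[OF rep2 f3]) (auto simp: io_defs)
      then show "represents \<Theta> w s3 \<and> reg s3 1 = 0 \<and> reg s3 2 = 0 \<and> reg s3 3 = occurrences w \<and> mem s3 4 0 = 0"
        using s3 f3 m2 count by (simp add: frame_def io_defs)
    qed
  qed simp
next
  have kpos: "1 \<le> k" using card_acts_pos[OF \<Theta>] k by simp
  then have "k \<le> k\<^sup>2" "1 \<le> k\<^sup>2" by (simp_all add: power2_eq_square Suc_leI)
  then show "8 * Suc k + 3 + ((5 * k\<^sup>2 + 3) + (10 * k + 2)) \<le> 50 * k\<^sup>2" unfolding mult_Suc_right by linarith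
qed

text \<open>One argument serves both forms. A selection may cost as much as its step is large, and
  since the step sizes add up to \<open>n\<close>, the total stays within the bound.\<close>

lemma runs_canonical:
  fixes \<Theta> :: "'a::linorder comtrace_alphabet"
  assumes \<Theta>: "comtrace_alphabet \<Theta>" and \<tau>: "\<tau> \<in> comtraces \<Theta>" and k: "k = card (acts \<Theta>)"
    and n: "\<And>w. w \<in> \<tau> \<Longrightarrow> occurrences w = n"
    and sel: "\<And>w s. w \<in> step_seqs \<Theta> \<Longrightarrow> w \<noteq> [] \<Longrightarrow> represents \<Theta> w s \<Longrightarrow>
      \<exists>V. selected R \<Theta> w V \<and> runs sel s (2000 * (card V * k\<^sup>2)) (marked k V)"
    and wr: "wregs sel \<inter> {0, 1, 2, 3, 4, 5, 6} = {}" "wmems sel \<inter> {1, 2, 3, 4, 5, 6, 8, 9} = {}"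
  shows "runs (canonical sel) (input_state \<Theta> (proj_rep \<Theta> \<tau>)) (3000 * (max 1 n * k\<^sup>2))
    (\<lambda>s. \<exists>w\<in>\<tau>. greedy R \<Theta> w \<and> outputs \<Theta> s w)"
proof -
  define s0 where "s0 = input_state \<Theta> (proj_rep \<Theta> \<tau>)"
  define body where "body = Seq sel (Seq emit advance)"
  have kpos: "1 \<le> k" using card_acts_pos[OF \<Theta>] k by simp
  then have kk: "k \<le> k\<^sup>2" "1 \<le> k\<^sup>2" by (simp_all add: power2_eq_square Suc_leI)
  have fin: "finite (acts \<Theta>)" using \<Theta> by (simp add: comtrace_alphabet_def)
  \<comment> \<open>The sequence \<open>w\<close> is just some representative of what remains. It
    changes to an equivalent \<open>A # v\<close> in every round, and \<open>best_step_cong\<close>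
    carries the optimality of the steps already emitted across the change.\<close>
  define I where "I = (\<lambda>s. \<exists>us w. us @ w \<in> \<tau> \<and> represents \<Theta> w s \<and> reg s 1 = length us \<and>
     reg s 2 = occurrences us \<and> reg s 3 = n \<and>
     (\<forall>i\<le>length us. mem s 4 i = occurrences (take i us)) \<and>
     (\<forall>i<length us. mem s 5 ` {mem s 4 i..<mem s 4 (Suc i)} = act_code \<Theta> ` (us ! i)) \<and>
     (\<forall>i<length us. best_step R \<Theta> (drop i us @ w) (us ! i)))"
  \<comment> \<open>Per action of the emitted step, 2000 k^2 units pay for the selection; the other
    100 k^2 cover emission, advancing and the loop test, since the step is nonempty.\<close>
  define f where "f = (\<lambda>s::ram_state. 2100 * ((n - reg s 2) * k\<^sup>2))"
  have loop: "runs (WhileLess 2 3 body) s (2100 * (n * k\<^sup>2) + 1)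
      (\<lambda>s. \<exists>w\<in>\<tau>. greedy R \<Theta> w \<and> outputs \<Theta> s w)" if "I s" for s
  proof (rule runs_conseq[OF runs_while[where I = I and f = f and T = "2100 * (n * k\<^sup>2) + 1"]])
    show "I s" by fact
    show "f s + 1 \<le> 2100 * (n * k\<^sup>2) + 1" by (simp add: f_def)
    show "2100 * (n * k\<^sup>2) + 1 \<le> 2100 * (n * k\<^sup>2) + 1" ..
  next
    fix s' assume s': "I s' \<and> \<not> reg s' 2 < reg s' 3"
    then obtain us w where *: "us @ w \<in> \<tau>" "reg s' 1 = length us" "reg s' 2 = occurrences us" "reg s' 3 = n"
     "\<forall>i\<le>length us. mem s' 4 i = occurrences (take i us)"
     "\<forall>i<length us. mem s' 5 ` {mem s' 4 i..<mem s' 4 (Suc i)} = act_code \<Theta> ` (us ! i)"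
     "\<forall>i<length us. best_step R \<Theta> (drop i us @ w) (us ! i)"
      unfolding I_def by blast
    have "occurrences w = 0" using s' * n[OF *(1)] by simp
    moreover have "w \<in> step_seqs \<Theta>" using comtraces_step_seqs[OF \<tau> *(1)] by simp
    ultimately have "w = []" using occurrences_eq_0[OF \<Theta>] by blast
    then show "\<exists>w\<in>\<tau>. greedy R \<Theta> w \<and> outputs \<Theta> s' w"
      using * by (intro bexI[of _ us]) (auto simp: greedy_def outputs_def)
  next
    fix s1 assume s1: "I s1" "reg s1 2 < reg s1 3"
    then obtain us w where *: "us @ w \<in> \<tau>" "represents \<Theta> w s1" "reg s1 1 = length us"
     "reg s1 2 = occurrences us" "reg s1 3 = n"
     "\<forall>i\<le>length us. mem s1 4 i = occurrences (take i us)"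
     "\<forall>i<length us. mem s1 5 ` {mem s1 4 i..<mem s1 4 (Suc i)} = act_code \<Theta> ` (us ! i)"
     "\<forall>i<length us. best_step R \<Theta> (drop i us @ w) (us ! i)"
      unfolding I_def by blast
    have seqs: "us \<in> step_seqs \<Theta>" "w \<in> step_seqs \<Theta>" using comtraces_step_seqs[OF \<tau> *(1)] by auto
    have "w \<noteq> []" using s1(2) * n[OF *(1)] by auto
    then obtain V where V: "selected R \<Theta> w V" and runsV: "runs sel s1 (2000 * (card V * k\<^sup>2)) (marked k V)"
      using sel[OF seqs(2) _ *(2)] by blast
    define A where "A = enum_act \<Theta> ` V"
    have Vk: "V \<subseteq> {..<k}" and bestA: "best_step R \<Theta> w A" using V by (auto simp: selected_def k A_def)
    then have stepA: "is_step \<Theta> A" by (simp add: best_step_def adm_def)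
    obtain v where v: "v \<in> step_seqs \<Theta>" "ct_equiv \<Theta> (A # v) w"
      using bestA by (auto simp: best_step_def adm_def)
    have cardA: "card A = card V"
      unfolding A_def using Vk inj_on_enum_act[of \<Theta>] by (auto simp: k intro!: card_image elim: inj_on_subset)
    have "V \<noteq> {}" using stepA by (auto simp: is_step_def A_def)
    then have cardV: "1 \<le> card V" using Vk by (simp add: card_gt_0_iff Suc_leI finite_subset)
    have codeA: "act_code \<Theta> ` A = V"
    proof -
      have "act_code \<Theta> (enum_act \<Theta> i) = i" if "i \<in> V" for i
        using that Vk act_code_enum_act[OF fin] by (auto simp: k)
      then show ?thesis by (force simp: A_def image_image)
    qed
    have equiv: "ct_equiv \<Theta> (x @ w) (x @ A # v)" if "x \<in> step_seqs \<Theta>" for x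
      using ct_equiv_append[OF ct_equiv_sym[OF v(2)] that, of "[]"] by simp
    have next_trace: "us @ A # v \<in> \<tau>"
      using comtraces_iff[OF \<tau> *(1), of "us @ A # v"] equiv[OF seqs(1)] seqs v(1) stepA by simp
    have occ: "occurrences us + card V \<le> n" using n[OF next_trace] cardA by simp
    have "runs body s1 (2000 * (card V * k\<^sup>2) + ((8 * k + 4) + 50 * k\<^sup>2))
        (\<lambda>s'. I s' \<and> reg s' 2 = occurrences us + card V)"
      unfolding body_def
    proof (rule runs_Seq[OF runsV])
      fix s2 assume s2: "marked k V s2" and f2: "frame sel s1 s2"
      have rep2: "represents \<Theta> w s2" by (rule represents_frame[OF *(2) f2]) (use wr in auto)
      then have r2: "ready k s2" by (simp add: represents_def k Let_def)
      have "1 \<notin> wregs sel" "2 \<notin> wregs sel" "3 \<notin> wregs sel" "4 \<notin> wmems sel" "5 \<notin> wmems sel"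
        using wr by auto
      then have m2: "reg s2 1 = length us" "reg s2 2 = occurrences us" "reg s2 3 = n"
        "mem s2 4 = mem s1 4" "mem s2 5 = mem s1 5"
        using f2 * by (simp_all add: frame_def)
      show "runs (Seq emit advance) s2 ((8 * k + 4) + 50 * k\<^sup>2)
          (\<lambda>s'. I s' \<and> reg s' 2 = occurrences us + card V)"
      proof (rule runs_Seq[OF runs_emit[OF r2 Vk s2 m2(2)]])
        fix s3 assume s3: "reg s3 2 = occurrences us + card V \<and> reg s3 1 = Suc (reg s2 1) \<and>
          mem s3 4 = (mem s2 4)(Suc (reg s2 1) := occurrences us + card V) \<and>
          mem s3 5 ` {occurrences us..<occurrences us + card V} = V \<and> (\<forall>j<occurrences us. mem s3 5 j = mem s2 5 j)"
          and f3: "frame emit s2 s3"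
        have rep3: "represents \<Theta> w s3" by (rule represents_frame[OF rep2 f3]) (auto simp: io_defs)
        have m3: "marked k V s3" "reg s3 3 = n" using f3 s2 m2 by (simp_all add: frame_def io_defs marked_def)
        show "runs advance s3 (50 * k\<^sup>2) (\<lambda>s'. I s' \<and> reg s' 2 = occurrences us + card V)"
        proof (rule runs_conseq[OF runs_advance[OF \<Theta> rep3 k Vk m3(1) A_def stepA v(2)] order_refl])
          fix s4 assume rep4: "represents \<Theta> v s4" and f4: "frame advance s3 s4"
          have m4: "reg s4 1 = Suc (length us)" "reg s4 2 = occurrences us + card V" "reg s4 3 = n"
            "mem s4 4 = (mem s1 4)(Suc (length us) := occurrences us + card V)"
            "mem s4 5 ` {occurrences us..<occurrences us + card V} = V"
            "\<forall>j<occurrences us. mem s4 5 j = mem s1 5 j"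
            using f4 s3 m2 m3 by (simp_all add: frame_def io_defs)
          have off: "mem s4 4 i = occurrences (take i (us @ [A]))" if "i \<le> Suc (length us)" for i
            using that *(6) m4(4) cardA by (cases "i = Suc (length us)") auto
          have "mem s4 5 ` {mem s4 4 i..<mem s4 4 (Suc i)} = act_code \<Theta> ` ((us @ [A]) ! i)"
            if i: "i < Suc (length us)" for i
          proof (cases "i = length us")
            case True
            then show ?thesis using off[of i] off[of "Suc i"] m4(5) codeA cardA by simp
          next
            case False
            then have i: "i < length us" using i by simp
            \<comment> \<open>Earlier steps occupy cells of array 5 below the number of occurrences
              written so far, and \<open>emit\<close> writes only from there on.\<close>
            have "occurrences us = occurrences (take (Suc i) us) + occurrences (drop (Suc i) us)"
              by (metis occurrences_append append_take_drop_id)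
            then have "mem s1 4 (Suc i) \<le> occurrences us" using *(6) i by simp
            then have "mem s4 5 ` {mem s1 4 i..<mem s1 4 (Suc i)} = mem s1 5 ` {mem s1 4 i..<mem s1 4 (Suc i)}"
              using m4(6) by (intro image_cong) auto
            then show ?thesis using *(7) i m4(4) by (simp add: nth_append)
          qed
          moreover have "best_step R \<Theta> (drop i (us @ [A]) @ v) ((us @ [A]) ! i)" if i: "i < Suc (length us)" for i
          proof (cases "i = length us")
            case True
            then show ?thesis using bestA best_step_cong[OF v(2)] by simp
          next
            case False
            then have i: "i < length us" using i by simp
            have "us = take i us @ drop i us" by simp
            then have "drop i us \<in> step_seqs \<Theta>" using seqs(1) by (metis step_seqs_append)
            from best_step_cong[OF equiv[OF this], of R "us ! i"] show ?thesis
              using *(8) i by (simp add: nth_append)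
          qed
          ultimately have "I s4"
            unfolding I_def using next_trace rep4 m4 off cardA
            by (intro exI[of _ "us @ [A]"] exI[of _ v]) simp
          then show "I s4 \<and> reg s4 2 = occurrences us + card V" using m4 by simp
        qed
      qed simp
    qed simp
    moreover have "f s' + (2000 * (card V * k\<^sup>2) + ((8 * k + 4) + 50 * k\<^sup>2)) + 1 \<le> f s1"
      if "reg s' 2 = occurrences us + card V" for s'
    proof -
      have "n - occurrences us = (n - (occurrences us + card V)) + card V" using occ by simp
      then have "f s1 = f s' + 2100 * (card V * k\<^sup>2)"
        unfolding f_def *(4) that by (simp only: distrib_right distrib_left)
      moreover have "k\<^sup>2 \<le> card V * k\<^sup>2" using cardV by simp
      ultimately show ?thesis using kk by linarith
    qed
    ultimately have "runs body s1 (2000 * (card V * k\<^sup>2) + ((8 * k + 4) + 50 * k\<^sup>2))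
        (\<lambda>s'. I s' \<and> f s' + (2000 * (card V * k\<^sup>2) + ((8 * k + 4) + 50 * k\<^sup>2)) + 1 \<le> f s1)"
      by (elim runs_conseq) auto
    then show "\<exists>T. runs body s1 T (\<lambda>s'. I s' \<and> f s' + T + 1 \<le> f s1)" by blast
  qed
  obtain w where w: "w \<in> \<tau>" using comtraces_nonempty[OF \<tau>] by blast
  obtain t1 s1 where e1: "exec (Seq init_strides (Seq init_positions init_count)) s0 t1 s1" "t1 \<le> 50 * k\<^sup>2"
    and s1: "represents \<Theta> w s1" "reg s1 1 = 0" "reg s1 2 = 0" "reg s1 3 = occurrences w" "mem s1 4 0 = 0"
    using runs_init[OF \<Theta> \<tau> w k] unfolding runs_def s0_def by blast
  have "I s1" unfolding I_def using s1 w n[OF w] by (intro exI[of _ "[]"] exI[of _ w]) simp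
  then obtain t2 s2 w' where e2: "exec (WhileLess 2 3 body) s1 t2 s2" "t2 \<le> 2100 * (n * k\<^sup>2) + 1"
    "w' \<in> \<tau>" "greedy R \<Theta> w'" "outputs \<Theta> s2 w'"
    using loop unfolding runs_def by blast
  \<comment> \<open>In \<open>canonical\<close> the loop sits inside the innermost
    \<open>Seq\<close>, so the run of the initialisation is taken apart and regrouped; the total
    time is the same.\<close>
  have "exec (canonical sel) s0 (t1 + t2) s2"
  proof -
    obtain a sa b sb c where "exec init_strides s0 a sa" "exec init_positions sa b sb" "exec init_count sb c s1"
      "t1 = a + (b + c)"
      using e1(1) by (auto elim!: exec.cases[of "Seq _ _"])
    then have "exec (canonical sel) s0 (a + (b + (c + t2))) s2"
      unfolding canonical_def body_def[symmetric] using e2(1) by (intro exec_Seq)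
    then show ?thesis using \<open>t1 = _\<close> by (simp add: add.assoc)
  qed
  moreover have "t1 + t2 \<le> 3000 * (max 1 n * k\<^sup>2)"
  proof -
    have "n * k\<^sup>2 \<le> max 1 n * k\<^sup>2" "k\<^sup>2 \<le> max 1 n * k\<^sup>2" by simp_all
    then show ?thesis using e1(2) e2(2) kk by linarith
  qed
  ultimately show ?thesis using e2 unfolding runs_def s0_def by blast
qed

lemma wregs_select:
  "wregs select_foata \<inter> {0, 1, 2, 3, 4, 5, 6} = {}" "wmems select_foata \<inter> {1, 2, 3, 4, 5, 6, 8, 9} = {}"
  "wregs select_lex \<inter> {0, 1, 2, 3, 4, 5, 6} = {}" "wmems select_lex \<inter> {1, 2, 3, 4, 5, 6, 8, 9} = {}"
  by (auto simp: select_foata_def lex_defs build_defs)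

text \<open>The factor \<open>max 1 n\<close> accounts for the empty comtrace: there n k^2 is 0,
  whereas every run takes at least one unit. Program and constant are chosen before the alphabet, so
  they are uniform in \<open>k\<close>; 3000 serves for both forms.\<close>

theorem theorem4p9:
  shows "(\<exists>P c. \<forall>(\<Theta> :: 'a::linorder comtrace_alphabet) \<tau> k n.
            comtrace_alphabet \<Theta> \<longrightarrow> card (acts \<Theta>) = k \<longrightarrow>
            \<tau> \<in> comtraces \<Theta> \<longrightarrow> (\<forall>w\<in>\<tau>. occurrences w = n) \<longrightarrow>
            (\<exists>t s. exec P (input_state \<Theta> (proj_rep \<Theta> \<tau>)) t s \<and>
                   t \<le> c * (max 1 n * k\<^sup>2) \<and>
                   outputs \<Theta> s (foata_form \<Theta> \<tau>)))
       \<and> (\<exists>P c. \<forall>(\<Theta> :: 'a::linorder comtrace_alphabet) \<tau> k n.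
            comtrace_alphabet \<Theta> \<longrightarrow> card (acts \<Theta>) = k \<longrightarrow>
            \<tau> \<in> comtraces \<Theta> \<longrightarrow> (\<forall>w\<in>\<tau>. occurrences w = n) \<longrightarrow>
            (\<exists>t s. exec P (input_state \<Theta> (proj_rep \<Theta> \<tau>)) t s \<and>
                   t \<le> c * (max 1 n * k\<^sup>2) \<and>
                   outputs \<Theta> s (lex_form \<tau>)))"
proof (rule conjI; rule exI; rule exI; intro allI impI)
  fix \<Theta> :: "'a comtrace_alphabet" and \<tau> k n
  assume \<Theta>: "comtrace_alphabet \<Theta>" and k: "card (acts \<Theta>) = k" and \<tau>: "\<tau> \<in> comtraces \<Theta>"
    and n: "\<forall>w\<in>\<tau>. occurrences w = n"
  have "runs (canonical select_foata) (input_state \<Theta> (proj_rep \<Theta> \<tau>)) (3000 * (max 1 n * k\<^sup>2))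
      (\<lambda>s. \<exists>w\<in>\<tau>. greedy (\<supseteq>) \<Theta> w \<and> outputs \<Theta> s w)"
    by (rule runs_canonical[OF \<Theta> \<tau> k[symmetric] _ runs_select_foata[OF \<Theta> _ _ _ k[symmetric]] wregs_select(1,2)])
      (use n in auto)
  then show "\<exists>t s. exec (canonical select_foata) (input_state \<Theta> (proj_rep \<Theta> \<tau>)) t s \<and>
      t \<le> 3000 * (max 1 n * k\<^sup>2) \<and> outputs \<Theta> s (foata_form \<Theta> \<tau>)"
    unfolding runs_def using foata_form_greedy[OF \<Theta> \<tau>] by metis
next
  fix \<Theta> :: "'a comtrace_alphabet" and \<tau> k n
  assume \<Theta>: "comtrace_alphabet \<Theta>" and k: "card (acts \<Theta>) = k" and \<tau>: "\<tau> \<in> comtraces \<Theta>"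
    and n: "\<forall>w\<in>\<tau>. occurrences w = n"
  have "runs (canonical select_lex) (input_state \<Theta> (proj_rep \<Theta> \<tau>)) (3000 * (max 1 n * k\<^sup>2))
      (\<lambda>s. \<exists>w\<in>\<tau>. greedy step_le \<Theta> w \<and> outputs \<Theta> s w)"
    by (rule runs_canonical[OF \<Theta> \<tau> k[symmetric] _ runs_select_lex[OF \<Theta> _ _ _ k[symmetric]] wregs_select(3,4)])
      (use n in auto)
  then show "\<exists>t s. exec (canonical select_lex) (input_state \<Theta> (proj_rep \<Theta> \<tau>)) t s \<and>
      t \<le> 3000 * (max 1 n * k\<^sup>2) \<and> outputs \<Theta> s (lex_form \<tau>)"
    unfolding runs_def using lex_form_greedy[OF \<Theta> \<tau>] by metis
qed

end
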